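(* Let $\lambda>0$ and let $\{(r_i,\varphi_i),i\in\mathbb N\}$ be a Poisson point process on $\mathbb R\times(\mathbb R/2\pi\mathbb Z)$ with intensity $\lambda\,dr\times d\varphi$. Let $\{F(t),t\in\mathbb R\}$ be a measurable process with values in $[0,\infty)$ such that $\int_{\mathbb R}\mathbb P[F(t)>a]\,dt<\infty$ for every $a>0$, and let $F_i$, $i\in\mathbb N$, be i.i.d. copies of $F$, independent of the Poisson process. Then the stationary max-i.d. process $$\eta(x,y)=\max_{i\in\mathbb N}F_i(x\cos\varphi_i+y\sin\varphi_i-r_i),\quad(x,y)\in\mathbb R^2,$$ is generated by a conservative flow.
   Context: $\stackrel{d}{=}$ denotes equality of finite-dimensional distributions. A process is max-i.d. if for every $n\in\mathbb N$ it equals in distribution the pointwise maximum of $n$ i.i.d. processes. For a $\sigma$-finite measure space $(\Omega,\mathcal B,\mu)$, $\mathcal L^\vee(\Omega,\mathcal B,\mu)$ is the set of measurable $f:\Omega\to\mathbb R$ with $f\ge0$ $\mu$-a.e. and $\mu\{f>a\}<\infty$ for all $a>0$ (functions equal $\mu$-a.e. are identified); $I(f):=\sup_{i\in J}f(U_i)$ ($0$ if there are no points), where $\Pi_\mu=\{U_i,i\in J\}$ is a Poisson point process on $(\Omega,\mathcal B)$ with intensity $\mu$. $\{f_t,t\in\mathbb R^d\}\subset\mathcal L^\vee$ is a spectral representation of $X$ if $\{X(t)\}\stackrel{d}{=}\{I(f_t)\}$; it has full support if there is no $B\in\mathcal B$ with $\mu(B)>0$ such that for every $t$, $f_t=0$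 $\mu$-a.e. on $B$. A $\sigma$-finite Borel space is a measurable space isomorphic to a complete separable metric space with its Borel $\sigma$-algebra, endowed with a $\sigma$-finite measure. A measurable measure-preserving flow on it is a family $\{T_t\}_{t\in\mathbb R^d}$ of measure space isomorphisms (modulo null sets) $T_t:\Omega\to\Omega$ with $T_0=\mathrm{id}$, $T_t\circ T_s=T_{t+s}$ $\mu$-a.e. for all $s,t$, and $(t,\omega)\mapsto T_t(\omega)$ jointly measurable. Its conservative part is $C=\{\omega:\int_{\mathbb R^d}h(T_t(\omega))\,dt=\infty\}$, where $h\in L^1(\Omega,\mathcal B,\mu)$ is any function with $h>0$ $\mu$-a.e. ($C$ does not depend on $h$ modulo $\mu$), and its dissipative part is $D=\Omega\setminus C$. The flow is conservative if $\mu(D)=0$ and dissipative if $\mu(C)=0$. A stationary max-i.d. process $X=\{X(t),t\in\mathbb R^d\}$ is generated by a conservative (dissipative) flow if it has a spectral representation $\{f_t\}$ of full support, on a $\sigma$-finite Borel space, with $f_t=f_0\circ T_t$ $\mu$-a.e. for every $t$, for some conservative (dissipative) measurable measure-preserving flow $\{T_t\}$; this does not depend on the choice of such a flow representation. Here $d=2$. *)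

theory Defs
  imports "HOL-Probability.Probability"
begin

section \<open>Processes\<close>

text \<open>A real-valued process \<open>X\<close> with index set \<open>'t\<close> on a probability space \<open>P\<close> is a function
  \<open>X :: 't \<Rightarrow> 'p \<Rightarrow> real\<close>.\<close>

definition fdd_eq ::
  "'p measure \<Rightarrow> ('t \<Rightarrow> 'p \<Rightarrow> real) \<Rightarrow> 'q measure \<Rightarrow> ('t \<Rightarrow> 'q \<Rightarrow> real) \<Rightarrow> bool" where
  "fdd_eq P X Q Y \<longleftrightarrow>
     (\<forall>t. X t \<in> borel_measurable P) \<and> (\<forall>t. Y t \<in> borel_measurable Q) \<and>
     (\<forall>J. finite J \<longrightarrow>
        distr P (Pi\<^sub>M J (\<lambda>_. borel)) (\<lambda>\<omega>. \<lambda>t\<in>J. X t \<omega>) =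
        distr Q (Pi\<^sub>M J (\<lambda>_. borel)) (\<lambda>\<omega>. \<lambda>t\<in>J. Y t \<omega>))"

definition stationary_process :: "'p measure \<Rightarrow> ('t::ab_group_add \<Rightarrow> 'p \<Rightarrow> real) \<Rightarrow> bool" where
  "stationary_process P X \<longleftrightarrow> (\<forall>s. fdd_eq P (\<lambda>t. X (t + s)) P X)"

text \<open>The i.i.d.\ processes may be taken on a probability space with sample points in
  \<open>nat \<Rightarrow> 't \<Rightarrow> real\<close>: any family of processes can be replaced by its joint law.\<close>

definition max_id :: "'p measure \<Rightarrow> ('t \<Rightarrow> 'p \<Rightarrow> real) \<Rightarrow> bool" where
  "max_id P X \<longleftrightarrow>
     (\<forall>n::nat. n \<ge> 1 \<longrightarrow>
       (\<exists>(Q :: (nat \<Rightarrow> 't \<Rightarrow> real) measure) Y.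
          prob_space Q \<and>
          prob_space.indep_vars Q (\<lambda>_. Pi\<^sub>M UNIV (\<lambda>_. borel)) (\<lambda>k \<omega> t. Y k t \<omega>) {..<n} \<and>
          (\<forall>k<n. \<forall>l<n. fdd_eq Q (Y k) Q (Y l)) \<and>
          fdd_eq P X Q (\<lambda>t \<omega>. Max ((\<lambda>k. Y k t \<omega>) ` {..<n}))))"

section \<open>Poisson point processes and spectral representations\<close>

text \<open>A point process on \<open>M\<close> is given by a random index set \<open>K \<omega> \<subseteq> \<nat>\<close> and random points
  \<open>U i \<omega>\<close>, \<open>i \<in> K \<omega>\<close> (repetitions count with multiplicity). The value of \<open>U i \<omega>\<close> for
  \<open>i \<notin> K \<omega>\<close> is irrelevant.\<close>

definition point_count ::
  "('p \<Rightarrow> nat set) \<Rightarrow> (nat \<Rightarrow> 'p \<Rightarrow> 'a) \<Rightarrow> 'a set \<Rightarrow> 'p \<Rightarrow> ennreal" where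
  "point_count K U B \<omega> = emeasure (count_space UNIV) {i \<in> K \<omega>. U i \<omega> \<in> B}"

definition poisson_point_process ::
  "'p measure \<Rightarrow> 'a measure \<Rightarrow> ('p \<Rightarrow> nat set) \<Rightarrow> (nat \<Rightarrow> 'p \<Rightarrow> 'a) \<Rightarrow> bool" where
  "poisson_point_process P M K U \<longleftrightarrow>
     prob_space P \<and>
     (\<forall>i. {\<omega> \<in> space P. i \<in> K \<omega>} \<in> sets P) \<and>
     (\<forall>i. U i \<in> restrict_space P {\<omega>. i \<in> K \<omega>} \<rightarrow>\<^sub>M M) \<and>
     (\<forall>B\<in>sets M.
        if emeasure M B = \<infinity> then AE \<omega> in P. point_count K U B \<omega> = \<infinity>
        else \<forall>n::nat. measure P {\<omega> \<in> space P. point_count K U B \<omega> = of_nat n} =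
               measure M B ^ n / fact n * exp (- measure M B)) \<and>
     (\<forall>(m::nat) B. (\<forall>k<m. B k \<in> sets M) \<and> disjoint_family_on B {..<m} \<longrightarrow>
        prob_space.indep_vars P (\<lambda>_. borel) (\<lambda>k. point_count K U (B k)) {..<m})"

definition L_vee :: "'a measure \<Rightarrow> ('a \<Rightarrow> real) set" where
  "L_vee M = {f \<in> borel_measurable M. (AE w in M. f w \<ge> 0) \<and>
     (\<forall>a>0. emeasure M {w \<in> space M. f w > a} < \<infinity>)}"

text \<open>For \<open>f \<in> L_vee M\<close> the supremum is over a set that is almost surely bounded.\<close>

definition sup_points ::
  "('p \<Rightarrow> nat set) \<Rightarrow> (nat \<Rightarrow> 'p \<Rightarrow> 'a) \<Rightarrow> ('a \<Rightarrow> real) \<Rightarrow> 'p \<Rightarrow> real" where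
  "sup_points K U f \<omega> = (if K \<omega> = {} then 0 else (SUP i\<in>K \<omega>. f (U i \<omega>)))"

text \<open>The finite-dimensional distributions of \<open>I(f\<^sub>t)\<close> do not depend on the realisation of the
  Poisson process, which may always be taken on sample points \<open>(K, U)\<close> in
  \<open>nat set \<times> (nat \<Rightarrow> 'a)\<close>.\<close>

definition spectral_representation ::
  "'p measure \<Rightarrow> ('t \<Rightarrow> 'p \<Rightarrow> real) \<Rightarrow> 'a measure \<Rightarrow> ('t \<Rightarrow> 'a \<Rightarrow> real) \<Rightarrow> bool" where
  "spectral_representation P X M f \<longleftrightarrow>
     sigma_finite_measure M \<and> (\<forall>t. f t \<in> L_vee M) \<and>
     (\<exists>(Q :: (nat set \<times> (nat \<Rightarrow> 'a)) measure) K U.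
        poisson_point_process Q M K U \<and> fdd_eq P X Q (\<lambda>t. sup_points K U (f t)))"

definition full_support :: "'a measure \<Rightarrow> ('t \<Rightarrow> 'a \<Rightarrow> real) \<Rightarrow> bool" where
  "full_support M f \<longleftrightarrow>
     \<not> (\<exists>B\<in>sets M. emeasure M B > 0 \<and> (\<forall>t. AE w in M. w \<in> B \<longrightarrow> f t w = 0))"

section \<open>Flows\<close>

text \<open>The metric space may be taken with points in the type \<open>'a\<close>, since its metric can be
  transported along the isomorphism.\<close>

definition sigma_finite_borel_space :: "'a measure \<Rightarrow> bool" where
  "sigma_finite_borel_space M \<longleftrightarrow>
     sigma_finite_measure M \<and>
     (\<exists>(S :: 'a set) d f.
        Metric_space S d \<and> Metric_space.mcomplete S d \<and>
        separable_space (Metric_space.mtopology S d) \<and>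
        bij_betw f (space M) S \<and>
        f \<in> M \<rightarrow>\<^sub>M sigma S {V. openin (Metric_space.mtopology S d) V} \<and>
        the_inv_into (space M) f \<in> sigma S {V. openin (Metric_space.mtopology S d) V} \<rightarrow>\<^sub>M M)"

definition measure_space_automorphism :: "'a measure \<Rightarrow> ('a \<Rightarrow> 'a) \<Rightarrow> bool" where
  "measure_space_automorphism M g \<longleftrightarrow>
     g \<in> M \<rightarrow>\<^sub>M M \<and> distr M M g = M \<and>
     (\<exists>A\<in>null_sets M. \<exists>B\<in>null_sets M.
        bij_betw g (space M - A) (space M - B) \<and>
        the_inv_into (space M - A) g \<in> restrict_space M (space M - B) \<rightarrow>\<^sub>M M)"

definition measure_preserving_flow ::
  "'a measure \<Rightarrow> ('t::euclidean_space \<Rightarrow> 'a \<Rightarrow> 'a) \<Rightarrow> bool" where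
  "measure_preserving_flow M T \<longleftrightarrow>
     (\<forall>t. measure_space_automorphism M (T t)) \<and>
     (\<forall>w\<in>space M. T 0 w = w) \<and>
     (\<forall>s t. AE w in M. T t (T s w) = T (t + s) w) \<and>
     (\<lambda>(t, w). T t w) \<in> borel \<Otimes>\<^sub>M M \<rightarrow>\<^sub>M M"

definition conservative_part ::
  "'a measure \<Rightarrow> ('t::euclidean_space \<Rightarrow> 'a \<Rightarrow> 'a) \<Rightarrow> ('a \<Rightarrow> real) \<Rightarrow> 'a set" where
  "conservative_part M T h =
     {w \<in> space M. (\<integral>\<^sup>+t. ennreal (h (T t w)) \<partial>lborel) = \<infinity>}"

definition dissipative_part ::
  "'a measure \<Rightarrow> ('t::euclidean_space \<Rightarrow> 'a \<Rightarrow> 'a) \<Rightarrow> ('a \<Rightarrow> real) \<Rightarrow> 'a set" where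
  "dissipative_part M T h = space M - conservative_part M T h"

text \<open>On a \<open>\<sigma>\<close>-finite space a function \<open>h\<close> as below exists, and modulo null sets the two parts do
  not depend on it.\<close>

definition conservative_flow ::
  "'a measure \<Rightarrow> ('t::euclidean_space \<Rightarrow> 'a \<Rightarrow> 'a) \<Rightarrow> bool" where
  "conservative_flow M T \<longleftrightarrow>
     measure_preserving_flow M T \<and>
     (\<forall>h. integrable M h \<and> (AE w in M. h w > 0) \<longrightarrow> dissipative_part M T h \<in> null_sets M)"

text \<open>The Borel space is taken on a set of reals, with an arbitrary \<open>\<sigma>\<close>-algebra unrelated to the
  topology of \<open>\<real>\<close>. This is no restriction: a separable metric space has at most the cardinality
  of the continuum, so every Borel space can be transported to such a carrier.\<close>

definition generated_by_conservative_flow ::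
  "'p measure \<Rightarrow> ('t::euclidean_space \<Rightarrow> 'p \<Rightarrow> real) \<Rightarrow> bool" where
  "generated_by_conservative_flow P X \<longleftrightarrow>
     (\<exists>(M :: real measure) f T.
        sigma_finite_borel_space M \<and> spectral_representation P X M f \<and> full_support M f \<and>
        conservative_flow M T \<and> (\<forall>t. AE w in M. f t w = f 0 (T t w)))"

section \<open>Poisson lines with random profiles\<close>

text \<open>The circle \<open>\<real>/2\<pi>\<int>\<close> is identified with its fundamental domain \<open>[0, 2\<pi>)\<close>.\<close>

definition line_intensity :: "real \<Rightarrow> (real \<times> real) measure" where
  "line_intensity lam =
     scale_measure (ennreal lam) (lborel \<Otimes>\<^sub>M restrict_space lborel {0..<2*pi})"

definition measurable_process :: "'p measure \<Rightarrow> (real \<Rightarrow> 'p \<Rightarrow> real) \<Rightarrow> bool" where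
  "measurable_process P F \<longleftrightarrow> (\<lambda>(t, \<omega>). F t \<omega>) \<in> borel_measurable (borel \<Otimes>\<^sub>M P)"

text \<open>The processes \<open>Fs i\<close> on \<open>P\<close> are i.i.d.\ copies of the measurable process \<open>F\<close> on \<open>Q\<close>,
  independent of the random element \<open>Z\<close> of \<open>N\<close>. As the copies get evaluated at random times,
  independence has to be understood for \<open>\<sigma>\<close>-algebras \<open>G i\<close> with respect to which \<open>Fs i\<close> is a
  measurable process, and not merely for the \<open>\<sigma>\<close>-algebras generated by the individual variables
  \<open>Fs i t\<close>. For example, if \<open>V\<close> is uniform on \<open>[0, 1]\<close>, then the variables
  \<open>indicator {V} t\<close>, \<open>t \<in> \<real>\<close>, are almost surely \<open>0\<close> and generate a trivial \<open>\<sigma>\<close>-algebra, which is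
  independent of \<open>V\<close>, but the process evaluated at time \<open>V\<close> is \<open>1\<close>. For copies
  \<open>Fs i t \<omega> = F t (\<zeta> i \<omega>)\<close>, with i.i.d.\ random elements \<open>\<zeta> i\<close> of \<open>Q\<close> independent of \<open>Z\<close>,
  the \<open>\<sigma>\<close>-algebra generated by \<open>\<zeta> i\<close> serves as \<open>G i\<close>.\<close>

definition iid_copies_indep_of ::
  "'p measure \<Rightarrow> (nat \<Rightarrow> real \<Rightarrow> 'p \<Rightarrow> real) \<Rightarrow> 'q measure \<Rightarrow> (real \<Rightarrow> 'q \<Rightarrow> real) \<Rightarrow>
   'b measure \<Rightarrow> ('p \<Rightarrow> 'b) \<Rightarrow> bool" where
  "iid_copies_indep_of P Fs Q F N Z \<longleftrightarrow>
     (\<forall>i. fdd_eq P (Fs i) Q F) \<and>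
     (\<exists>G :: nat \<Rightarrow> 'p measure.
        (\<forall>i. subalgebra P (G i) \<and> measurable_process (G i) (Fs i)) \<and>
        prob_space.indep_sets P
          (\<lambda>k. case k of None \<Rightarrow> {Z -` A \<inter> space P |A. A \<in> sets N} | Some i \<Rightarrow> sets (G i)) UNIV)"

text \<open>For fixed \<open>(x, y)\<close>, under the integrability condition on \<open>F\<close>, almost surely the supremum is a
  maximum of a bounded sequence.\<close>

definition line_max_process ::
  "(nat \<Rightarrow> real \<Rightarrow> 'p \<Rightarrow> real) \<Rightarrow> (nat \<Rightarrow> 'p \<Rightarrow> real) \<Rightarrow> (nat \<Rightarrow> 'p \<Rightarrow> real) \<Rightarrow>
   real \<times> real \<Rightarrow> 'p \<Rightarrow> real" where
  "line_max_process Fs r \<phi> = (\<lambda>(x, y) \<omega>.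
     (SUP i. Fs i (x * cos (\<phi> i \<omega>) + y * sin (\<phi> i \<omega>) - r i \<omega>) \<omega>))"

end

theory Submission
  imports Defs
begin

text \<open>
  Every law in sight is read off from avoidance probabilities. Call a nonnegative process \<open>X\<close> of
  type \<open>(M, f)\<close> if \<open>P (X t \<le> a t for all t in J) = exp (- M {some t in J has f t > a t})\<close> for all
  finite \<open>J\<close> and all \<open>a > 0\<close> (\<open>sup_law\<close> below). Two processes of the same type have the same
  finite-dimensional distributions, and for a Poisson process with intensity \<open>M\<close> the suprema \<open>I(f t)\<close>
  are of type \<open>(M, f)\<close> because only the probability that a set contains no point is needed
  (\<open>ppp_sup_law\<close>). So the theorem reduces to finding one \<open>(M, f)\<close> that is also the type of the
  maximum \<open>\<eta>\<close> over the random lines.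

  The space: since \<open>F\<close> is jointly measurable, it depends on the sample point only through countably
  many indicators, so that \<open>F t \<omega> = F' t (g \<omega>)\<close> with \<open>g\<close> valued in the Polish space of real sequences
  (\<open>measurable_process_factorization\<close>). Let \<open>N\<close> be the law of \<open>g\<close>. Then \<open>M\<close> is the product of the
  line intensity and \<open>N\<close>, restricted to those \<open>z\<close> for which \<open>F' u z\<close> is not zero for almost all \<open>u\<close>
  (this restriction gives full support), and
  \<open>f (x, y) (r, \<phi>, z) = F' (x cos \<phi> + y sin \<phi> - r) z\<close>. The plane acts by moving lines,
  \<open>T (x, y) (r, \<phi>, z) = (r - x cos \<phi> - y sin \<phi>, \<phi>, z)\<close>, which preserves \<open>M\<close> and gives
  \<open>f t = f 0 \<circ> T t\<close>; stationarity is immediate. A line is fixed by all translations along itself, so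
  \<open>\<integral> h (T t w) dt\<close> over the plane is a positive one-dimensional integral times the infinite length
  of the line (\<open>nn_integral_plane_infinite\<close>). This is why the flow is conservative, and the same
  computation with \<open>f\<close> in place of \<open>h\<close> proves full support.

  The type of \<open>\<eta>\<close>: given the lines, the profiles are independent, so the probability of not exceeding
  the levels is an expectation of a product \<open>\<Prod>i. 1 - v (r i, \<phi> i)\<close>. It equals
  \<open>exp (- \<integral> v d(line intensity))\<close> by the formula for the generating functional of a Poisson process
  (\<open>ppp_pgfl\<close>).

  Poisson processes with intensity \<open>M\<close>, and with intensity \<open>M / n\<close> for max-infinite divisibility, are
  obtained from the given process of lines by attaching independent marks and deleting points.
  That marking yields a Poisson process follows from the converse fact that the generating
  functional characterises Poisson processes: it contains the joint probability generating functions
  of all counts, and comparing power series coefficients gives their Poisson laws and independence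
  (locale \<open>point_sequence\<close>).
\<close>

section \<open>Exponentials and infinite products of extended nonnegative numbers\<close>

text \<open>This is \<open>exp (- x)\<close> with \<open>exp (- \<infinity>) = 0\<close>. The value at infinity lets one formula cover
  point processes with infinitely many points in a set.\<close>
definition nexp :: "ennreal \<Rightarrow> ennreal" where
  "nexp x = (if x = \<infinity> then 0 else ennreal (exp (- enn2real x)))"

lemma nexp_0 [simp]: "nexp 0 = 1"
  by (simp add: nexp_def)

lemma nexp_top [simp]: "nexp top = 0"
  by (simp add: nexp_def)

lemma nexp_ennreal: "0 \<le> x \<Longrightarrow> nexp (ennreal x) = ennreal (exp (- x))"
  by (simp add: nexp_def)

lemma nexp_le_1: "nexp x \<le> 1"
  by (simp add: nexp_def ennreal_le_1)

lemma nexp_add: "nexp (x + y) = nexp x * nexp y"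
proof (cases "x = top \<or> y = top")
  case False
  then obtain a b where "x = ennreal a" "y = ennreal b" "0 \<le> a" "0 \<le> b"
    by (cases x; cases y) auto
  then show ?thesis
    by (simp add: nexp_ennreal mult_exp_exp flip: ennreal_plus ennreal_mult')
qed auto

lemma nexp_sum: "finite J \<Longrightarrow> nexp (\<Sum>j\<in>J. f j) = (\<Prod>j\<in>J. nexp (f j))"
  by (induction J rule: finite_induct) (auto simp: nexp_add)

lemma nexp_antimono: "x \<le> y \<Longrightarrow> nexp y \<le> nexp x"
  by (cases x; cases y) (auto simp: nexp_ennreal top_unique intro!: ennreal_leI)

text \<open>Continuity, including at infinity, in the form in which it is combined with monotone
  convergence.\<close>
lemma nexp_incseq:
  assumes "incseq x"
  shows "(INF n. nexp (x n)) = nexp (SUP n. x n)"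
proof (cases "(SUP n. x n) = top")
  case True
  have "(INF n. nexp (x n)) \<le> 0 + ennreal e" if "e > 0" for e
  proof -
    \<comment> \<open>As soon as \<open>x n > - ln e\<close>, the value of \<open>nexp\<close> is below \<open>e\<close>; the maximum with \<open>0\<close> keeps \<open>ennreal\<close> faithful.\<close>
    have "ennreal (max 0 (- ln e)) < (SUP n. x n)"
      unfolding True by simp
    then obtain n where n: "ennreal (max 0 (- ln e)) < x n"
      unfolding less_SUP_iff by blast
    have "(INF n. nexp (x n)) \<le> nexp (x n)"
      by (rule INF_lower) simp
    also have "\<dots> \<le> nexp (ennreal (max 0 (- ln e)))"
      using n by (intro nexp_antimono less_imp_le)
    also have "\<dots> = ennreal (exp (- (max 0 (- ln e))))"
      by (subst nexp_ennreal) auto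
    also have "\<dots> \<le> ennreal (exp (ln e))"
      by (intro ennreal_leI) auto
    finally show ?thesis using that by simp
  qed
  then have "(INF n. nexp (x n)) \<le> 0"
    by (rule ennreal_le_epsilon)
  then show ?thesis unfolding True by simp
next
  case False
  define y where "y = (SUP n. x n)"
  have y: "y \<noteq> top" using False by (simp only: y_def not_False_eq_True)
  have le: "x n \<le> y" for n unfolding y_def by (rule SUP_upper) simp
  have fin: "x n \<noteq> top" for n using le[of n] y by (auto simp: top_unique)
  have "x \<longlonglongrightarrow> y" unfolding y_def by (rule LIMSEQ_SUP[OF assms])
  then have "(\<lambda>n. enn2real (x n)) \<longlonglongrightarrow> enn2real y"
    using y by (intro tendsto_enn2real) (simp_all add: less_top)
  then have "(\<lambda>n. ennreal (exp (- enn2real (x n)))) \<longlonglongrightarrow> ennreal (exp (- enn2real y))"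
    by (intro tendsto_ennrealI tendsto_exp tendsto_minus)
  then have *: "(\<lambda>n. nexp (x n)) \<longlonglongrightarrow> nexp y"
    using fin y by (simp add: nexp_def)
  have "decseq (\<lambda>n. nexp (x n))"
    using assms by (simp add: decseq_def incseq_def nexp_antimono)
  then have "(\<lambda>n. nexp (x n)) \<longlonglongrightarrow> (INF n. nexp (x n))"
    by (rule LIMSEQ_INF)
  with * show ?thesis unfolding y_def[symmetric] by (rule LIMSEQ_unique[symmetric])
qed

text \<open>The function \<open>s ^ x\<close> of a count \<open>x\<close>, with \<open>s ^ \<infinity> = 0\<close>. As a series of indicators it is measurable
  and can be integrated term by term, which turns its expectation into a probability generating
  function.\<close>
definition count_pow :: "ennreal \<Rightarrow> ennreal \<Rightarrow> ennreal" where
  "count_pow s x = (\<Sum>n. s ^ n * indicator {of_nat n} x)"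

lemma count_pow_of_nat [simp]: "count_pow s (of_nat n) = s ^ n"
proof -
  have "count_pow s (of_nat n) = (\<Sum>k. if k = n then s ^ n else 0)"
    unfolding count_pow_def by (intro suminf_cong) (auto simp: indicator_def)
  also have "\<dots> = s ^ n"
    by (subst suminf_finite[of "{n}"]) auto
  finally show ?thesis .
qed

lemma count_pow_0 [simp]: "count_pow s 0 = 1"
  using count_pow_of_nat[of s 0] by simp

lemma count_pow_top [simp]: "count_pow s top = 0"
proof -
  have "s ^ n * indicator {of_nat n} (top :: ennreal) = 0" for n
    by (auto simp: indicator_def)
  then show ?thesis by (simp add: count_pow_def)
qed

lemma borel_measurable_count_pow [measurable]: "count_pow s \<in> borel_measurable borel"
  unfolding count_pow_def[abs_def] by measurable

lemma ennreal_power_tendsto_0: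
  fixes s :: ennreal
  assumes "s < 1"
  shows "(\<lambda>n. s ^ n) \<longlonglongrightarrow> 0"
proof -
  from assms have "s < top" using less_trans[of s 1 top] by simp
  then obtain r where r: "s = ennreal r" "0 \<le> r" by (cases s) auto
  with assms have "r < 1" by (simp add: ennreal_less_one_iff)
  have "(\<lambda>n. ennreal (r ^ n)) \<longlonglongrightarrow> ennreal 0"
    using r \<open>r < 1\<close> by (intro tendsto_ennrealI LIMSEQ_power_zero) auto
  with r show ?thesis by (simp add: ennreal_power)
qed

lemma count_pow_tendsto:
  fixes s :: ennreal
  assumes "s < 1"
  shows "(\<lambda>N. \<Prod>i<N. if i \<in> I then s else 1) \<longlonglongrightarrow> count_pow s (emeasure (count_space UNIV) I)"
proof -
  have eq: "(\<Prod>i<N. if i \<in> I then s else 1) = s ^ card (I \<inter> {..<N})" for N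
    by (simp add: prod.If_cases Int_commute)
  show ?thesis
  proof (cases "finite I")
    case True
    then obtain N where N: "I \<subseteq> {..<N}" by (meson finite_nat_iff_bounded)
    have "\<forall>\<^sub>F M in sequentially. (\<Prod>i<M. if i \<in> I then s else 1) = s ^ card I"
      using eventually_ge_at_top[of N]
    proof eventually_elim
      case (elim M)
      with N have "I \<inter> {..<M} = I" by auto
      then show ?case unfolding eq by simp
    qed
    with True show ?thesis by (simp add: tendsto_eventually)
  next
    case False
    have "filterlim (\<lambda>N. card (I \<inter> {..<N})) at_top sequentially"
      unfolding filterlim_at_top
    proof
      fix k
      from False obtain A where A: "A \<subseteq> I" "finite A" "card A = k"
        using infinite_arbitrarily_large by metis
      then obtain N where N: "A \<subseteq> {..<N}" by (meson finite_nat_iff_bounded)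
      show "\<forall>\<^sub>F M in sequentially. k \<le> card (I \<inter> {..<M})"
        using eventually_ge_at_top[of N]
      proof eventually_elim
        case (elim M)
        with A N have "A \<subseteq> I \<inter> {..<M}" by auto
        then have "card A \<le> card (I \<inter> {..<M})" by (intro card_mono) auto
        with A show ?case by simp
      qed
    qed
    then have "(\<lambda>N. s ^ card (I \<inter> {..<N})) \<longlonglongrightarrow> 0"
      by (rule filterlim_compose[OF ennreal_power_tendsto_0[OF assms]])
    with False show ?thesis unfolding eq by simp
  qed
qed

lemma prod_le_1_ennreal:
  fixes f :: "'a \<Rightarrow> ennreal"
  assumes "\<And>i. i \<in> I \<Longrightarrow> f i \<le> 1"
  shows "(\<Prod>i\<in>I. f i) \<le> 1"
  using assms
proof (induction I rule: infinite_finite_induct)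
  case (insert x F)
  then have "f x * prod f F \<le> 1 * 1" by (intro mult_mono) auto
  with insert show ?case by simp
qed auto

lemma tendsto_prod_ennreal_le_1:
  fixes f :: "'a \<Rightarrow> nat \<Rightarrow> ennreal"
  assumes "finite J" "\<And>j. j \<in> J \<Longrightarrow> f j \<longlonglongrightarrow> l j" "\<And>j. j \<in> J \<Longrightarrow> l j \<le> 1"
  shows "(\<lambda>n. \<Prod>j\<in>J. f j n) \<longlonglongrightarrow> (\<Prod>j\<in>J. l j)"
  using assms
proof (induction J rule: finite_induct)
  case (insert x F)
  have "l x \<le> 1" "prod l F \<le> 1" using insert by (auto intro: prod_le_1_ennreal)
  then have "l x \<noteq> top" "prod l F \<noteq> top" by (auto simp: top_unique)
  with insert show ?case by (auto intro!: tendsto_mult_ennreal)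
qed auto

lemma count_pow_le_1: 
  assumes "s < 1"
  shows "count_pow s (emeasure (count_space UNIV) (I::nat set)) \<le> 1"
proof (cases "finite I")
  case True
  with assms show ?thesis by (simp add: power_le_one)
qed simp

text \<open>The infinite product of factors in \<open>[0, 1]\<close>. Its partial products decrease, so that it commutes
  with infima and monotone limits, without any question of convergence.\<close>
definition inf_prod :: "(nat \<Rightarrow> ennreal) \<Rightarrow> ennreal" where
  "inf_prod x = (INF N. \<Prod>i<N. x i)"

lemma decseq_prod_le_1:
  fixes x :: "nat \<Rightarrow> ennreal"
  assumes "\<And>i. x i \<le> 1"
  shows "decseq (\<lambda>N. \<Prod>i<N. x i)"
proof (rule decseq_SucI)
  fix n
  have "prod x {..<n} * x n \<le> prod x {..<n} * 1" using assms by (intro mult_left_mono) auto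
  then show "(\<Prod>i<Suc n. x i) \<le> (\<Prod>i<n. x i)" by simp
qed

lemma inf_prod_le_1: "inf_prod x \<le> 1"
  unfolding inf_prod_def by (rule INF_lower2[of 0]) auto

text \<open>A product over all points in which each visit to \<open>B j\<close> contributes a factor \<open>s j\<close> depends only on
  the numbers of visits. This is the bridge between products over points and counts.\<close>
lemma inf_prod_count_pow:
  fixes s :: "'j \<Rightarrow> ennreal" and z :: "nat \<Rightarrow> 'a"
  assumes "finite J" "\<And>j. j \<in> J \<Longrightarrow> s j < 1"
  shows "inf_prod (\<lambda>i. \<Prod>j\<in>J. if z i \<in> B j then s j else 1) =
    (\<Prod>j\<in>J. count_pow (s j) (emeasure (count_space UNIV) {i. z i \<in> B j}))"
proof -
  let ?x = "\<lambda>i. \<Prod>j\<in>J. if z i \<in> B j then s j else 1"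
  have "decseq (\<lambda>N. \<Prod>i<N. ?x i)"
    using assms by (intro decseq_prod_le_1 prod_le_1_ennreal) (auto simp: less_imp_le)
  then have "(\<lambda>N. \<Prod>i<N. ?x i) \<longlonglongrightarrow> inf_prod ?x"
    unfolding inf_prod_def by (rule LIMSEQ_INF)
  moreover have "(\<lambda>N. \<Prod>j\<in>J. \<Prod>i<N. if i \<in> {i. z i \<in> B j} then s j else 1) \<longlonglongrightarrow>
      (\<Prod>j\<in>J. count_pow (s j) (emeasure (count_space UNIV) {i. z i \<in> B j}))"
    using assms by (intro tendsto_prod_ennreal_le_1 count_pow_tendsto count_pow_le_1) auto
  moreover have "(\<Prod>j\<in>J. \<Prod>i<N. if i \<in> {i. z i \<in> B j} then s j else 1) = (\<Prod>i<N. ?x i)" for N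
    unfolding mem_Collect_eq by (rule prod.swap)
  ultimately show ?thesis by (simp only: LIMSEQ_unique)
qed

lemma nn_integral_count_pow:
  assumes [measurable]: "X \<in> borel_measurable P"
  shows "(\<integral>\<^sup>+\<omega>. count_pow s (X \<omega>) \<partial>P) = (\<Sum>n. s ^ n * emeasure P {\<omega> \<in> space P. X \<omega> = of_nat n})"
proof -
  have "(\<integral>\<^sup>+\<omega>. count_pow s (X \<omega>) \<partial>P) = (\<Sum>n. \<integral>\<^sup>+\<omega>. s ^ n * indicator {of_nat n} (X \<omega>) \<partial>P)"
    unfolding count_pow_def by (subst nn_integral_suminf) auto
  also have "\<dots> = (\<Sum>n. s ^ n * emeasure P {\<omega> \<in> space P. X \<omega> = of_nat n})"
  proof (intro suminf_cong)
    fix n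
    have "(\<integral>\<^sup>+\<omega>. s ^ n * indicator {of_nat n} (X \<omega>) \<partial>P) =
        s ^ n * (\<integral>\<^sup>+\<omega>. indicator {\<omega> \<in> space P. X \<omega> = of_nat n} \<omega> \<partial>P)"
      by (subst nn_integral_cmult[symmetric]) (auto intro!: nn_integral_cong simp: indicator_def)
    then show "(\<integral>\<^sup>+\<omega>. s ^ n * indicator {of_nat n} (X \<omega>) \<partial>P) =
        s ^ n * emeasure P {\<omega> \<in> space P. X \<omega> = of_nat n}"
      by simp
  qed
  finally show ?thesis .
qed

text \<open>The probability generating function of the Poisson distribution.\<close>
lemma poisson_pgf_suminf:
  fixes s :: ennreal
  assumes "s \<le> 1" "0 \<le> m"
  shows "(\<Sum>n. s ^ n * ennreal (m ^ n / fact n * exp (- m))) = nexp ((1 - s) * ennreal m)"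
proof -
  from assms obtain r where r: "s = ennreal r" "0 \<le> r" "r \<le> 1"
    by (cases s) (auto simp: ennreal_le_1 top_unique)
  have "(\<lambda>n. (r * m) ^ n / fact n) sums exp (r * m)"
    using exp_converges[of "r * m"] by (simp add: field_simps)
  then have "(\<lambda>n. (r * m) ^ n / fact n * exp (- m)) sums (exp (r * m) * exp (- m))"
    by (rule sums_mult2)
  then have "(\<lambda>n. r ^ n * (m ^ n / fact n * exp (- m))) sums exp (- ((1 - r) * m))"
    by (simp add: power_mult_distrib mult_exp_exp algebra_simps)
  then have "(\<Sum>n. ennreal (r ^ n * (m ^ n / fact n * exp (- m)))) = ennreal (exp (- ((1 - r) * m)))"
    using r assms by (subst suminf_ennreal_eq) auto
  moreover have "(1 - s) * ennreal m = ennreal ((1 - r) * m)"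
  proof -
    have "1 - s = ennreal (1 - r)"
      using r ennreal_minus[of r 1] by simp
    then show ?thesis using r assms by (simp only: ennreal_mult)
  qed
  moreover have "ennreal (r ^ n * (m ^ n / fact n * exp (- m))) = s ^ n * ennreal (m ^ n / fact n * exp (- m))" for n
    unfolding r(1) ennreal_power[OF r(2)] using r assms by (intro ennreal_mult) auto
  moreover have "nexp (ennreal ((1 - r) * m)) = ennreal (exp (- ((1 - r) * m)))"
    using r assms by (intro nexp_ennreal) auto
  ultimately show ?thesis
    by simp
qed

section \<open>The generating functional of a Poisson process\<close>

lemma ppp_prob_space: "poisson_point_process P M K U \<Longrightarrow> prob_space P"
  by (simp add: poisson_point_process_def)

lemma ppp_indep:
  assumes "poisson_point_process P M K U" "\<And>k. k < m \<Longrightarrow> B k \<in> sets M" "disjoint_family_on B {..<m::nat}"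
  shows "prob_space.indep_vars P (\<lambda>_. borel) (\<lambda>k. point_count K U (B k)) {..<m}"
  using assms by (auto simp: poisson_point_process_def)

lemma ppp_count_measurable:
  assumes ppp: "poisson_point_process P M K U" and B: "B \<in> sets M"
  shows "point_count K U B \<in> borel_measurable P"
proof -
  interpret prob_space P using ppp by (rule ppp_prob_space)
  have "indep_vars (\<lambda>_. borel) (\<lambda>k. point_count K U B) {..<Suc 0}"
    using B by (intro ppp_indep[OF ppp, of _ "\<lambda>_. B"]) (auto simp: disjoint_family_on_def)
  then show ?thesis by (auto simp: indep_vars_def)
qed

lemma ppp_measurable:
  assumes ppp: "poisson_point_process P M (\<lambda>_. UNIV) U"
  shows "U i \<in> P \<rightarrow>\<^sub>M M"
proof -
  have "U i \<in> restrict_space P {\<omega>. i \<in> UNIV} \<rightarrow>\<^sub>M M"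
    using ppp unfolding poisson_point_process_def by blast
  then show ?thesis using measurable_cong_sets[OF sets_restrict_UNIV[of P] refl, of M] by simp
qed

lemma ppp_points_measurable:
  assumes ppp: "poisson_point_process P M K U" and B: "B \<in> sets M"
  shows "{\<omega> \<in> space P. i \<in> K \<omega> \<and> U i \<omega> \<in> B} \<in> sets P"
proof -
  have "{\<omega> \<in> space P. i \<in> K \<omega>} \<in> sets P" using ppp by (simp add: poisson_point_process_def)
  moreover have "{\<omega>. i \<in> K \<omega>} \<inter> space P = {\<omega> \<in> space P. i \<in> K \<omega>}" by auto
  moreover have "U i -` B \<inter> space (restrict_space P {\<omega>. i \<in> K \<omega>}) \<in> sets (restrict_space P {\<omega>. i \<in> K \<omega>})"
    using ppp B by (intro measurable_sets) (auto simp: poisson_point_process_def)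
  ultimately have "U i -` B \<inter> space (restrict_space P {\<omega>. i \<in> K \<omega>}) \<in> sets P"
    by (subst (asm) sets_restrict_space_iff) auto
  moreover have "U i -` B \<inter> space (restrict_space P {\<omega>. i \<in> K \<omega>}) = {\<omega> \<in> space P. i \<in> K \<omega> \<and> U i \<omega> \<in> B}"
    by (auto simp: space_restrict_space)
  ultimately show ?thesis by simp
qed

lemma ppp_count_pgf:
  assumes ppp: "poisson_point_process P M K U" and B: "B \<in> sets M" "emeasure M B \<noteq> \<infinity>"
    and s: "s \<le> 1"
  shows "(\<integral>\<^sup>+\<omega>. count_pow s (point_count K U B \<omega>) \<partial>P) = nexp ((1 - s) * emeasure M B)"
proof -
  interpret prob_space P using ppp by (rule ppp_prob_space)
  have "\<forall>n::nat. measure P {\<omega> \<in> space P. point_count K U B \<omega> = of_nat n} =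
               measure M B ^ n / fact n * exp (- measure M B)"
    using ppp B unfolding poisson_point_process_def by auto
  then have "emeasure P {\<omega> \<in> space P. point_count K U B \<omega> = of_nat n} =
      ennreal (measure M B ^ n / fact n * exp (- measure M B))" for n
    by (simp add: emeasure_eq_measure)
  then show ?thesis
    using nn_integral_count_pow[OF ppp_count_measurable[OF ppp B(1)], of s]
      poisson_pgf_suminf[OF s, of "measure M B"] emeasure_eq_ennreal_measure[of M B] B(2)
    by simp
qed

text \<open>For a simple function \<open>q\<close> the product is determined by the counts of the level sets of \<open>q\<close>,
  which are independent and Poisson distributed.\<close>
lemma ppp_pgfl_simple:
  assumes ppp: "poisson_point_process P M (\<lambda>_. UNIV) Z"
    and q: "simple_function M q" "\<And>x. x \<in> space M \<Longrightarrow> q x \<le> 1" "(\<integral>\<^sup>+x. q x \<partial>M) \<noteq> \<infinity>"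
  shows "(\<integral>\<^sup>+\<omega>. inf_prod (\<lambda>i. 1 - q (Z i \<omega>)) \<partial>P) = nexp (\<integral>\<^sup>+x. q x \<partial>M)"
proof -
  interpret prob_space P using ppp by (rule ppp_prob_space)
  \<comment> \<open>The value \<open>0\<close> is left out, as its level set may have infinite measure; it contributes the factor \<open>1\<close>.\<close>
  define C where "C = q ` space M - {0}"
  have fin: "finite C" using q(1) by (auto simp: C_def simple_function_def)
  then obtain h where "bij_betw h {0..<card C} C" using ex_bij_betw_nat_finite by metis
  then have h: "bij_betw h {..<card C} C" by (simp add: atLeast0LessThan)
  define m where "m = card C"
  define B where "B k = q -` {h k} \<inter> space M" for k
  have hk: "h k \<in> C" if "k < m" for k using h that by (auto simp: bij_betw_def m_def)
  have inj: "h k = h l \<Longrightarrow> k = l" if "k < m" "l < m" for k l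
    using h that by (auto simp: bij_betw_def m_def inj_on_def)
  have h1: "h k \<le> 1" "h k \<noteq> 0" if "k < m" for k using hk[OF that] q(2) by (auto simp: C_def)
  have B [measurable]: "B k \<in> sets M" for k
    unfolding B_def using q(1) by (rule simple_functionD)
  have disj: "disjoint_family_on B {..<m}"
    using inj by (auto simp: disjoint_family_on_def B_def)
  have int: "(\<integral>\<^sup>+x. q x \<partial>M) = (\<Sum>k<m. h k * emeasure M (B k))"
  proof -
    have "(\<integral>\<^sup>+x. q x \<partial>M) = (\<Sum>c\<in>q ` space M. c * emeasure M (q -` {c} \<inter> space M))"
      using q(1) by (simp add: nn_integral_eq_simple_integral simple_integral_def)
    also have "\<dots> = (\<Sum>c\<in>C. c * emeasure M (q -` {c} \<inter> space M))"
      using q(1) unfolding C_def by (intro sum.mono_neutral_right) (auto simp: simple_function_def)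
    also have "\<dots> = (\<Sum>k<m. h k * emeasure M (B k))"
      using h unfolding B_def m_def by (intro sum.reindex_bij_betw[symmetric])
    finally show ?thesis .
  qed
  have finB: "emeasure M (B k) \<noteq> \<infinity>" if k: "k < m" for k
  proof
    assume "emeasure M (B k) = \<infinity>"
    then have "h k * emeasure M (B k) = \<infinity>" using h1[OF k] by (simp add: ennreal_mult_top)
    moreover have "h k * emeasure M (B k) \<le> (\<Sum>k<m. h k * emeasure M (B k))"
      using k by (intro member_le_sum) auto
    ultimately show False using q(3) int by (simp add: top_unique)
  qed
  have eq: "1 - q x = (\<Prod>k<m. if x \<in> B k then 1 - h k else 1)" if x: "x \<in> space M" for x
  proof (cases "q x = 0")
    case True
    then have "x \<notin> B k" if "k < m" for k using h1[OF that] by (auto simp: B_def)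
    then show ?thesis using True by simp
  next
    case False
    then have "q x \<in> C" using x by (auto simp: C_def)
    then obtain l where l: "l < m" "q x = h l" using h by (auto simp: bij_betw_def m_def)
    have "x \<in> B k \<longleftrightarrow> k = l" if "k < m" for k
      using l inj[OF that l(1)] x by (auto simp: B_def)
    then have "(\<Prod>k<m. if x \<in> B k then 1 - h k else 1) = (\<Prod>k<m. if k = l then 1 - h k else 1)"
      by (intro prod.cong) auto
    then show ?thesis using l by simp
  qed
  have s1: "1 - h k < 1" if "k < m" for k
  proof -
    from h1[OF that] obtain r where "h k = ennreal r" "0 \<le> r" "r \<le> 1"
      by (cases "h k") (auto simp: top_unique)
    then show ?thesis
      using h1[OF that] ennreal_minus[of r 1] by (auto simp: ennreal_less_one_iff)
  qed
  have inf: "inf_prod (\<lambda>i. 1 - q (Z i \<omega>)) = (\<Prod>k<m. count_pow (1 - h k) (point_count (\<lambda>_. UNIV) Z (B k) \<omega>))"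
    if w: "\<omega> \<in> space P" for \<omega>
  proof -
    have "inf_prod (\<lambda>i. 1 - q (Z i \<omega>)) = inf_prod (\<lambda>i. \<Prod>k<m. if Z i \<omega> \<in> B k then 1 - h k else 1)"
      using measurable_space[OF ppp_measurable[OF ppp] w] by (simp only: eq)
    also have "\<dots> = (\<Prod>k<m. count_pow (1 - h k) (point_count (\<lambda>_. UNIV) Z (B k) \<omega>))"
      using s1 by (subst inf_prod_count_pow) (auto simp: point_count_def)
    finally show ?thesis .
  qed
  have "(\<integral>\<^sup>+\<omega>. inf_prod (\<lambda>i. 1 - q (Z i \<omega>)) \<partial>P) =
      (\<integral>\<^sup>+\<omega>. (\<Prod>k<m. count_pow (1 - h k) (point_count (\<lambda>_. UNIV) Z (B k) \<omega>)) \<partial>P)"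
    by (intro nn_integral_cong inf)
  also have "\<dots> = (\<Prod>k<m. \<integral>\<^sup>+\<omega>. count_pow (1 - h k) (point_count (\<lambda>_. UNIV) Z (B k) \<omega>) \<partial>P)"
    by (intro indep_vars_nn_integral indep_vars_compose2[OF ppp_indep[OF ppp B disj]]) auto
  also have "\<dots> = (\<Prod>k<m. nexp (h k * emeasure M (B k)))"
  proof (intro prod.cong refl)
    fix k assume "k \<in> {..<m}"
    then have k: "k < m" by simp
    have "1 - (1 - h k) = h k"
      using h1[OF k] by (intro diff_diff_ennreal) auto
    then show "(\<integral>\<^sup>+\<omega>. count_pow (1 - h k) (point_count (\<lambda>_. UNIV) Z (B k) \<omega>) \<partial>P) =
        nexp (h k * emeasure M (B k))"
      using ppp_count_pgf[OF ppp B finB[OF k], of "1 - h k"] less_imp_le[OF s1[OF k]] by simp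
  qed
  also have "\<dots> = nexp (\<integral>\<^sup>+x. q x \<partial>M)"
    by (simp add: int nexp_sum)
  finally show ?thesis .
qed

lemma borel_measurable_inf_prod [measurable (raw)]:
  assumes [measurable]: "\<And>i. f i \<in> borel_measurable M"
  shows "(\<lambda>x. inf_prod (\<lambda>i. f i x)) \<in> borel_measurable M"
  unfolding inf_prod_def by measurable

lemma prod_mono_ennreal:
  fixes f g :: "'a \<Rightarrow> ennreal"
  assumes "\<And>i. i \<in> A \<Longrightarrow> f i \<le> g i"
  shows "prod f A \<le> prod g A"
  using assms by (induction A rule: infinite_finite_induct) (auto intro!: mult_mono)

text \<open>Both limits are infima, hence they may be exchanged.\<close>
lemma inf_prod_decseq:
  fixes f :: "nat \<Rightarrow> nat \<Rightarrow> ennreal"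
  assumes "\<And>i. f i \<longlonglongrightarrow> l i" "\<And>i. decseq (f i)" "\<And>n i. f i n \<le> 1"
  shows "(INF n. inf_prod (\<lambda>i. f i n)) = inf_prod l"
proof -
  have lim: "(INF n. \<Prod>i<N. f i n) = (\<Prod>i<N. l i)" for N
  proof -
    have "l i \<le> 1" for i
      using assms(1)[of i] by (rule LIMSEQ_le_const2) (auto intro: assms(3))
    then have "(\<lambda>n. \<Prod>i<N. f i n) \<longlonglongrightarrow> (\<Prod>i<N. l i)"
      using assms(1) by (intro tendsto_prod_ennreal_le_1) auto
    moreover have "decseq (\<lambda>n. \<Prod>i<N. f i n)"
      by (intro monotoneI prod_mono_ennreal decseqD[OF assms(2)]) auto
    then have "(\<lambda>n. \<Prod>i<N. f i n) \<longlonglongrightarrow> (INF n. \<Prod>i<N. f i n)"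
      by (rule LIMSEQ_INF)
    ultimately show ?thesis by (simp only: LIMSEQ_unique)
  qed
  have "(INF n. inf_prod (\<lambda>i. f i n)) = (INF N. INF n. \<Prod>i<N. f i n)"
    unfolding inf_prod_def by (rule INF_commute)
  then show ?thesis by (simp only: lim inf_prod_def)
qed

text \<open>Approximation from below by simple functions of finite integral. This also covers an infinite
  integral of \<open>q\<close>, where both sides are \<open>0\<close>.\<close>
theorem ppp_pgfl:
  assumes ppp: "poisson_point_process P M (\<lambda>_. UNIV) Z" and sf: "sigma_finite_measure M"
    and [measurable]: "q \<in> borel_measurable M" and q1: "\<And>x. x \<in> space M \<Longrightarrow> q x \<le> 1"
  shows "(\<integral>\<^sup>+\<omega>. inf_prod (\<lambda>i. 1 - q (Z i \<omega>)) \<partial>P) = nexp (\<integral>\<^sup>+x. q x \<partial>M)"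
proof -
  interpret prob_space P using ppp by (rule ppp_prob_space)
  note Z [measurable] = ppp_measurable[OF ppp]
  interpret M: sigma_finite_measure M by fact
  obtain U where U: "\<And>i::nat. simple_function M (U i)" "incseq U" "\<And>x. (SUP i. U i x) = q x"
    using borel_measurable_implies_simple_function_sequence'[OF assms(3)] by metis
  obtain A :: "nat \<Rightarrow> _" where A: "range A \<subseteq> sets M" "(\<Union>i. A i) = space M" "\<And>i. emeasure M (A i) \<noteq> \<infinity>" "incseq A"
    using M.sigma_finite_incseq by metis
  \<comment> \<open>Cutting off at sets of finite measure keeps the integrals finite.\<close>
  define r where "r n x = U n x * indicator (A n) x" for n x
  have AM [measurable]: "A n \<in> sets M" for n using A(1) by auto
  have r_simple: "simple_function M (r n)" for n
    unfolding r_def using U(1) by (intro simple_function_mult simple_function_indicator) auto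
  have Ur: "U n x \<le> q x" for n x unfolding U(3)[symmetric] by (rule SUP_upper) simp
  have r_inc: "incseq r"
    using U(2) A(4) unfolding incseq_def le_fun_def r_def
    by (intro allI impI mult_mono) (auto simp: indicator_def subset_eq)
  have r_le_q: "r n x \<le> q x" for n x
    using Ur[of n x] by (auto simp: r_def indicator_def)
  have r1: "r n x \<le> 1" if "x \<in> space M" for n x
    using order_trans[OF r_le_q q1[OF that]] .
  have r_sup: "(SUP n. r n x) = q x" if x: "x \<in> space M" for x
  proof (rule antisym)
    show "(SUP n. r n x) \<le> q x" by (intro SUP_least r_le_q)
    obtain N where N: "x \<in> A N" using x A(2) by blast
    show "q x \<le> (SUP n. r n x)"
      unfolding U(3)[symmetric]
    proof (rule SUP_least)
      fix i
      have "x \<in> A (max i N)" using N incseqD[OF A(4), of N "max i N"] by auto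
      then have "U i x \<le> r (max i N) x"
        using U(2) by (auto simp: r_def incseq_def le_fun_def)
      also have "\<dots> \<le> (SUP n. r n x)" by (rule SUP_upper) simp
      finally show "U i x \<le> (SUP n. r n x)" .
    qed
  qed
  have [measurable]: "r n \<in> borel_measurable M" for n
    using r_simple by (rule borel_measurable_simple_function)
  have r_fin: "(\<integral>\<^sup>+x. r n x \<partial>M) \<noteq> \<infinity>" for n
  proof -
    have "(\<integral>\<^sup>+x. r n x \<partial>M) \<le> (\<integral>\<^sup>+x. indicator (A n) x \<partial>M)"
      using q1 Ur by (intro nn_integral_mono) (auto simp: r_def indicator_def intro: order_trans)
    then show ?thesis using A(3)[of n] by (auto simp: top_unique)
  qed
  have int: "(\<integral>\<^sup>+x. q x \<partial>M) = (SUP n. \<integral>\<^sup>+x. r n x \<partial>M)"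
  proof -
    have "(\<integral>\<^sup>+x. q x \<partial>M) = (\<integral>\<^sup>+x. (SUP n. r n x) \<partial>M)"
      by (intro nn_integral_cong) (simp add: r_sup)
    then show ?thesis using r_inc by (simp add: nn_integral_monotone_convergence_SUP)
  qed
  define f where "f n \<omega> = inf_prod (\<lambda>i. 1 - r n (Z i \<omega>))" for n \<omega>
  have f_meas [measurable]: "f n \<in> borel_measurable P" for n
    unfolding f_def by measurable
  have f_dec: "decseq f"
  proof (intro monotoneI le_funI)
    fix n k :: nat and \<omega> assume "n \<le> k"
    then have "r n x \<le> r k x" for x using r_inc by (auto simp: incseq_def le_fun_def)
    then show "f k \<omega> \<le> f n \<omega>"
      unfolding f_def inf_prod_def
      by (intro INF_mono' prod_mono_ennreal ennreal_minus_mono) auto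
  qed
  have "inf_prod (\<lambda>i. 1 - q (Z i \<omega>)) = (INF n. f n \<omega>)" if w: "\<omega> \<in> space P" for \<omega>
    unfolding f_def
  proof (rule inf_prod_decseq[symmetric])
    fix i
    have zi: "Z i \<omega> \<in> space M" using measurable_space[OF Z w] .
    have "incseq (\<lambda>n. r n (Z i \<omega>))" using r_inc by (auto simp: incseq_def le_fun_def)
    then have "(\<lambda>n. r n (Z i \<omega>)) \<longlonglongrightarrow> q (Z i \<omega>)"
      unfolding r_sup[OF zi, symmetric] by (rule LIMSEQ_SUP)
    then show "(\<lambda>n. 1 - r n (Z i \<omega>)) \<longlonglongrightarrow> 1 - q (Z i \<omega>)"
      using q1[OF zi] by (intro tendsto_diff_ennreal tendsto_const) (auto simp: top_unique)
    show "decseq (\<lambda>n. 1 - r n (Z i \<omega>))"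
      using r_inc by (auto simp: incseq_def decseq_def le_fun_def intro!: ennreal_minus_mono)
  qed (simp add: diff_le_self_ennreal)
  then have "(\<integral>\<^sup>+\<omega>. inf_prod (\<lambda>i. 1 - q (Z i \<omega>)) \<partial>P) = (\<integral>\<^sup>+\<omega>. (INF n. f n \<omega>) \<partial>P)"
    by (intro nn_integral_cong)
  also have "\<dots> = (INF n. \<integral>\<^sup>+\<omega>. f n \<omega> \<partial>P)"
  proof (rule nn_integral_monotone_convergence_INF_decseq[OF f_dec f_meas])
    have "(\<integral>\<^sup>+\<omega>. f 0 \<omega> \<partial>P) \<le> (\<integral>\<^sup>+\<omega>. 1 \<partial>P)"
      by (intro nn_integral_mono) (simp add: f_def inf_prod_le_1)
    then show "(\<integral>\<^sup>+\<omega>. f 0 \<omega> \<partial>P) < \<infinity>"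
      by (simp add: emeasure_space_1 le_less_trans)
  qed
  also have "\<dots> = (INF n. nexp (\<integral>\<^sup>+x. r n x \<partial>M))"
    unfolding f_def using ppp_pgfl_simple[OF ppp r_simple r1 r_fin] by simp
  also have "\<dots> = nexp (SUP n. \<integral>\<^sup>+x. r n x \<partial>M)"
    using r_inc by (intro nexp_incseq) (auto simp: incseq_def le_fun_def intro: nn_integral_mono)
  finally show ?thesis by (simp add: int)
qed

section \<open>Recognising Poisson processes by their generating functional\<close>

text \<open>A power series that vanishes to the right of \<open>0\<close> has no first nonzero coefficient: divide by
  the corresponding power of \<open>x\<close> and let \<open>x\<close> tend to \<open>0\<close>.\<close>
lemma powser_right_zero:
  fixes d :: "nat \<Rightarrow> real"
  assumes bd: "\<And>n. \<bar>d n\<bar> \<le> 1"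
    and zero: "\<And>x. 0 < x \<Longrightarrow> x < 1 \<Longrightarrow> (\<lambda>n. d n * x ^ n) sums 0"
  shows "d n = 0"
proof (induction n rule: less_induct)
  case (less n)
  define g where "g x = (\<Sum>i. d (i + n) * x ^ i)" for x
  have "summable (\<lambda>i. d (i + n) * x ^ i)" if "norm x < 1" for x
  proof (rule summable_comparison_test)
    show "\<exists>N. \<forall>i\<ge>N. norm (d (i + n) * x ^ i) \<le> norm x ^ i"
      using bd by (auto simp: abs_mult power_abs intro!: mult_left_le_one_le)
    show "summable (\<lambda>i. norm x ^ i)" using that by (intro summable_geometric) simp
  qed
  then have "(g \<longlongrightarrow> d (0 + n)) (at 0)"
    unfolding g_def by (intro powser_limit_0[of 1] summable_sums) auto
  then have "(g \<longlongrightarrow> d n) (at_right 0)"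
    by (simp add: filterlim_at_split)
  moreover have "\<forall>\<^sub>F x in at_right 0. g x = 0"
  proof -
    have "g x = 0" if x: "0 < x" "x < 1" for x
    proof -
      have "(\<Sum>i<n. d i * x ^ i) = 0" using less by simp
      then have "(\<lambda>i. d (i + n) * x ^ (i + n)) sums 0"
        using zero[OF x] sums_iff_shift[of "\<lambda>i. d i * x ^ i" n 0] by simp
      then have "(\<lambda>i. d (i + n) * x ^ (i + n) * inverse (x ^ n)) sums (0 * inverse (x ^ n))"
        by (rule sums_mult2)
      then have "(\<lambda>i. d (i + n) * x ^ i) sums 0"
        using x by (simp add: power_add field_simps)
      then show ?thesis unfolding g_def by (rule sums_unique[symmetric])
    qed
    then show ?thesis by (auto simp: eventually_at_right_field intro!: exI[of _ 1])
  qed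
  then have "(g \<longlongrightarrow> 0) (at_right 0)" by (rule tendsto_eventually)
  ultimately show ?case using tendsto_unique[of "at_right (0::real)" g] by simp
qed

lemma pgf_coeff_unique:
  fixes a b :: "nat \<Rightarrow> ennreal"
  assumes a: "\<And>n. a n \<le> 1" and b: "\<And>n. b n \<le> 1"
    and eq: "\<And>s. s < 1 \<Longrightarrow> (\<Sum>n. s ^ n * a n) = (\<Sum>n. s ^ n * b n)"
  shows "a n = b n"
proof -
  have conv: "c n = ennreal (enn2real (c n)) \<and> 0 \<le> enn2real (c n) \<and> enn2real (c n) \<le> 1"
    if "c n \<le> 1" for c :: "nat \<Rightarrow> ennreal" and n
    using that by (cases "c n") (auto simp: top_unique)
  have real: "summable (\<lambda>n. x ^ n * enn2real (c n)) \<and>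
      (\<Sum>n. ennreal x ^ n * c n) = ennreal (\<Sum>n. x ^ n * enn2real (c n))"
    if x: "0 < x" "x < 1" and c: "\<And>n. c n \<le> 1" for x and c :: "nat \<Rightarrow> ennreal"
  proof
    have le: "x ^ n * enn2real (c n) \<le> x ^ n" for n
      using conv[of c n, OF c] x by (intro mult_right_le_one_le) auto
    show s: "summable (\<lambda>n. x ^ n * enn2real (c n))"
    proof (rule summable_comparison_test)
      show "\<exists>N. \<forall>n\<ge>N. norm (x ^ n * enn2real (c n)) \<le> x ^ n"
        using le x by (simp add: abs_mult)
      show "summable (\<lambda>n. x ^ n)" using x by (intro summable_geometric) simp
    qed
    have "ennreal x ^ n * c n = ennreal (x ^ n * enn2real (c n))" for n
    proof -
      have "ennreal x ^ n * c n = ennreal (x ^ n) * ennreal (enn2real (c n))"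
        using conv[of c n, OF c] x by (simp add: ennreal_power)
      then show ?thesis using x by (simp only: ennreal_mult' zero_le_power less_imp_le enn2real_nonneg ennreal_mult)
    qed
    then show "(\<Sum>n. ennreal x ^ n * c n) = ennreal (\<Sum>n. x ^ n * enn2real (c n))"
      using x s by (simp only:) (intro suminf_ennreal2, auto)
  qed
  define d where "d n = enn2real (a n) - enn2real (b n)" for n
  have "d n = 0"
  proof (rule powser_right_zero)
    show "\<bar>d n\<bar> \<le> 1" for n
      using conv[of a n, OF a] conv[of b n, OF b] enn2real_nonneg[of "a n"] enn2real_nonneg[of "b n"]
      unfolding d_def abs_le_iff by linarith
    fix x :: real assume x: "0 < x" "x < 1"
    have sa: "summable (\<lambda>n. x ^ n * enn2real (a n))"
      and ra: "(\<Sum>n. ennreal x ^ n * a n) = ennreal (\<Sum>n. x ^ n * enn2real (a n))"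
      using real[OF x, of a] a by auto
    have sb: "summable (\<lambda>n. x ^ n * enn2real (b n))"
      and rb: "(\<Sum>n. ennreal x ^ n * b n) = ennreal (\<Sum>n. x ^ n * enn2real (b n))"
      using real[OF x, of b] b by auto
    have "(\<Sum>n. x ^ n * enn2real (a n)) = (\<Sum>n. x ^ n * enn2real (b n))"
      using eq[of "ennreal x"] x sa sb by (simp add: ra rb suminf_nonneg ennreal_less_one_iff)
    then have "(\<lambda>n. x ^ n * enn2real (a n) - x ^ n * enn2real (b n)) sums 0"
      using sums_diff[of "\<lambda>n. x ^ n * enn2real (a n)" _ "\<lambda>n. x ^ n * enn2real (b n)"]
        summable_sums[OF sa] summable_sums[OF sb] by fastforce
    then show "(\<lambda>n. d n * x ^ n) sums 0" by (simp add: d_def algebra_simps)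
  qed
  then show ?thesis using conv[of a n, OF a] conv[of b n, OF b] by (simp add: d_def)
qed

text \<open>The Poisson probabilities, with a mean in \<open>[0, \<infinity>]\<close> that is to be finite.\<close>
definition poisson_prob :: "ennreal \<Rightarrow> nat \<Rightarrow> ennreal" where
  "poisson_prob m n = ennreal (enn2real m ^ n / fact n * exp (- enn2real m))"

lemma poisson_prob_pgf:
  assumes "s \<le> 1" "m \<noteq> \<infinity>"
  shows "(\<Sum>n. s ^ n * poisson_prob m n) = nexp ((1 - s) * m)"
  using poisson_pgf_suminf[OF assms(1), of "enn2real m"] assms(2)
  by (simp add: poisson_prob_def less_top)

lemma poisson_prob_le_1:
  assumes "m \<noteq> \<infinity>"
  shows "poisson_prob m n \<le> 1"
proof -
  have "poisson_prob m n = (\<Sum>k\<in>{n}. 1 ^ k * poisson_prob m k)" by simp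
  also have "\<dots> \<le> (\<Sum>n. 1 ^ n * poisson_prob m n)" by (intro sum_le_suminf) auto
  also have "\<dots> = nexp ((1 - 1) * m)" using assms by (intro poisson_prob_pgf) auto
  finally show ?thesis by simp
qed

lemma count_space_emeasure_cases:
  "emeasure (count_space UNIV) (I :: nat set) = \<infinity> \<or> (\<exists>n. emeasure (count_space UNIV) I = of_nat n)"
  by (cases "finite I") auto

lemma point_count_cases: "point_count K U B \<omega> = \<infinity> \<or> (\<exists>n. point_count K U B \<omega> = of_nat n)"
  unfolding point_count_def by (rule count_space_emeasure_cases)

lemma count_pow_point_count_le_1: "s < 1 \<Longrightarrow> count_pow s (point_count K U B \<omega>) \<le> 1"
  unfolding point_count_def by (rule count_pow_le_1)

lemma point_count_UNIV: "point_count (\<lambda>_. UNIV) U B \<omega> = (\<Sum>i. indicator B (U i \<omega>))"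
proof -
  have "point_count (\<lambda>_. UNIV) U B \<omega> = (\<integral>\<^sup>+i. indicator {i. U i \<omega> \<in> B} i \<partial>count_space UNIV)"
    by (simp add: point_count_def)
  also have "\<dots> = (\<Sum>i. indicator {i. U i \<omega> \<in> B} i)"
    by (rule nn_integral_count_space_nat)
  finally show ?thesis by (simp add: indicator_def)
qed

text \<open>Starting from the Poisson form of the generating functional alone, the counts are shown to be
  independent and Poisson distributed.\<close>
locale point_sequence = prob_space P for P :: "'p measure" +
  fixes M :: "'a measure" and U :: "nat \<Rightarrow> 'p \<Rightarrow> 'a"
  assumes U [measurable]: "\<And>i. U i \<in> P \<rightarrow>\<^sub>M M"
    and pgfl: "\<And>q. q \<in> borel_measurable M \<Longrightarrow> (\<And>x. x \<in> space M \<Longrightarrow> q x \<le> 1) \<Longrightarrow>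
      (\<integral>\<^sup>+\<omega>. inf_prod (\<lambda>i. 1 - q (U i \<omega>)) \<partial>P) = nexp (\<integral>\<^sup>+x. q x \<partial>M)"
begin

abbreviation N :: "'a set \<Rightarrow> 'p \<Rightarrow> ennreal" where "N \<equiv> point_count (\<lambda>_. UNIV) U"

lemma N_measurable [measurable]:
  assumes [measurable]: "B \<in> sets M"
  shows "N B \<in> borel_measurable P"
  unfolding point_count_UNIV[abs_def] by measurable

lemma joint_pgf:
  assumes J: "finite J" and B: "\<And>j. j \<in> J \<Longrightarrow> B j \<in> sets M" "disjoint_family_on B J"
    and s: "\<And>j. j \<in> J \<Longrightarrow> s j < 1"
  shows "(\<integral>\<^sup>+\<omega>. (\<Prod>j\<in>J. count_pow (s j) (N (B j) \<omega>)) \<partial>P) =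
    (\<Prod>j\<in>J. nexp ((1 - s j) * emeasure M (B j)))"
proof -
  note B(1) [measurable]
  define q where "q x = (\<Sum>j\<in>J. (1 - s j) * indicator (B j) x)" for x
  have qm [measurable]: "q \<in> borel_measurable M" unfolding q_def by measurable
  have q: "1 - q x = (\<Prod>j\<in>J. if x \<in> B j then s j else 1) \<and> q x \<le> 1" for x
  proof (cases "\<exists>k\<in>J. x \<in> B k")
    case True
    then obtain k where k: "k \<in> J" "x \<in> B k" by blast
    then have iff: "x \<in> B j \<longleftrightarrow> j = k" if "j \<in> J" for j
      using B(2) that by (auto simp: disjoint_family_on_def)
    have "q x = (\<Sum>j\<in>J. if j = k then 1 - s j else 0)"
      unfolding q_def by (intro sum.cong refl) (auto simp: iff indicator_def)
    then have qx: "q x = 1 - s k" using J k by simp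
    have "(\<Prod>j\<in>J. if x \<in> B j then s j else 1) = (\<Prod>j\<in>J. if j = k then s j else 1)"
      by (intro prod.cong refl) (auto simp: iff)
    also have "\<dots> = s k" using J k by simp
    finally show ?thesis using qx s[OF k(1)] by (simp add: diff_diff_ennreal diff_le_self_ennreal)
  next
    case False
    then show ?thesis by (auto simp: q_def indicator_def intro!: sum.neutral)
  qed
  have "(\<integral>\<^sup>+\<omega>. (\<Prod>j\<in>J. count_pow (s j) (N (B j) \<omega>)) \<partial>P) = (\<integral>\<^sup>+\<omega>. inf_prod (\<lambda>i. 1 - q (U i \<omega>)) \<partial>P)"
    using q inf_prod_count_pow[where J=J and s=s and B=B and z="\<lambda>i. U i \<omega>" for \<omega>, OF J s]
    by (simp add: point_count_def)
  also have "\<dots> = nexp (\<integral>\<^sup>+x. q x \<partial>M)" using q by (intro pgfl) auto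
  also have "(\<integral>\<^sup>+x. q x \<partial>M) = (\<Sum>j\<in>J. (1 - s j) * emeasure M (B j))"
    unfolding q_def by (simp add: nn_integral_sum nn_integral_cmult)
  finally show ?thesis using J by (simp add: nexp_sum)
qed

text \<open>Interpolation between the joint probability generating function (\<open>A = {}\<close>) and the joint
  distribution of the counts (\<open>A = J\<close>). Moving one index into \<open>A\<close> amounts to comparing the
  coefficients of a power series in one of the variables \<open>s j\<close>.\<close>
lemma joint_counts_aux:
  assumes J: "finite J" and B: "\<And>j. j \<in> J \<Longrightarrow> B j \<in> sets M" "disjoint_family_on B J"
    and fin: "\<And>j. j \<in> J \<Longrightarrow> emeasure M (B j) \<noteq> \<infinity>"
    and A: "finite A" "A \<subseteq> J"
    and s: "\<And>j. j \<in> J - A \<Longrightarrow> s j < 1"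
  shows "(\<integral>\<^sup>+\<omega>. (\<Prod>j\<in>A. indicator {of_nat (n j)} (N (B j) \<omega>)) *
      (\<Prod>j\<in>J - A. count_pow (s j) (N (B j) \<omega>)) \<partial>P) =
    (\<Prod>j\<in>A. poisson_prob (emeasure M (B j)) (n j)) * (\<Prod>j\<in>J - A. nexp ((1 - s j) * emeasure M (B j)))"
  using A s
proof (induction A arbitrary: n s rule: finite_subset_induct')
  case empty
  then show ?case using joint_pgf[OF J B, of s] by simp
next
  case (insert k A)
  note [measurable] = B(1)
  have Jk: "J - A = insert k (J - insert k A)" "k \<notin> J - insert k A" "finite (J - insert k A)"
    using insert.hyps J by auto
  have [measurable]: "B k \<in> sets M" using insert.hyps B by auto
  have [measurable]: "B j \<in> sets M" if "j \<in> A" for j using insert.hyps B that by auto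
  define W where "W \<omega> = (\<Prod>j\<in>A. indicator {of_nat (n j)} (N (B j) \<omega>)) *
      (\<Prod>j\<in>J - insert k A. count_pow (s j) (N (B j) \<omega>))" for \<omega>
  define R where "R = (\<Prod>j\<in>A. poisson_prob (emeasure M (B j)) (n j)) *
      (\<Prod>j\<in>J - insert k A. nexp ((1 - s j) * emeasure M (B j)))"
  have [measurable]: "W \<in> borel_measurable P" unfolding W_def by measurable
  have W1: "W \<omega> \<le> 1" for \<omega>
  proof -
    have "W \<omega> \<le> 1 * 1" unfolding W_def
      using insert.prems
      by (intro mult_mono prod_le_1_ennreal count_pow_point_count_le_1) (auto simp: indicator_def)
    then show ?thesis by simp
  qed
  have R1: "R \<le> 1"
  proof -
    have "R \<le> 1 * 1" unfolding R_def
      using insert.hyps by (intro mult_mono prod_le_1_ennreal poisson_prob_le_1 fin nexp_le_1) auto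
    then show ?thesis by simp
  qed
  have mk: "emeasure M (B k) \<noteq> \<infinity>" using insert.hyps fin by auto
  have "(\<integral>\<^sup>+\<omega>. W \<omega> * indicator {of_nat (n k)} (N (B k) \<omega>) \<partial>P) = R * poisson_prob (emeasure M (B k)) (n k)"
  proof (rule pgf_coeff_unique[of "\<lambda>i. \<integral>\<^sup>+\<omega>. W \<omega> * indicator {of_nat i} (N (B k) \<omega>) \<partial>P"
        "\<lambda>i. R * poisson_prob (emeasure M (B k)) i"])
    fix i
    have "(\<integral>\<^sup>+\<omega>. W \<omega> * indicator {of_nat i} (N (B k) \<omega>) \<partial>P) \<le> (\<integral>\<^sup>+\<omega>. 1 \<partial>P)"
      using W1 by (intro nn_integral_mono) (auto simp: indicator_def)
    then show "(\<integral>\<^sup>+\<omega>. W \<omega> * indicator {of_nat i} (N (B k) \<omega>) \<partial>P) \<le> 1"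
      by (simp add: emeasure_space_1)
    have "R * poisson_prob (emeasure M (B k)) i \<le> 1 * 1"
      using R1 poisson_prob_le_1[OF mk] by (intro mult_mono) auto
    then show "R * poisson_prob (emeasure M (B k)) i \<le> 1" by simp
  next
    fix t :: ennreal assume t: "t < 1"
    have "(\<Sum>i. t ^ i * (\<integral>\<^sup>+\<omega>. W \<omega> * indicator {of_nat i} (N (B k) \<omega>) \<partial>P)) =
        (\<Sum>i. \<integral>\<^sup>+\<omega>. W \<omega> * (t ^ i * indicator {of_nat i} (N (B k) \<omega>)) \<partial>P)"
      by (intro suminf_cong, subst nn_integral_cmult[symmetric]) (auto simp: mult_ac)
    also have "\<dots> = (\<integral>\<^sup>+\<omega>. W \<omega> * count_pow t (N (B k) \<omega>) \<partial>P)"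
      unfolding count_pow_def ennreal_suminf_cmult[symmetric] by (subst nn_integral_suminf) auto
    also have "\<dots> = R * nexp ((1 - t) * emeasure M (B k))"
    proof -
      have cong: "(\<Prod>j\<in>J - insert k A. f (if j = k then t else s j) j) = (\<Prod>j\<in>J - insert k A. f (s j) j)"
        for f :: "ennreal \<Rightarrow> _ \<Rightarrow> ennreal"
        by (intro prod.cong) auto
      have "(\<integral>\<^sup>+\<omega>. (\<Prod>j\<in>A. indicator {of_nat (n j)} (N (B j) \<omega>)) *
          (\<Prod>j\<in>J - A. count_pow ((s(k := t)) j) (N (B j) \<omega>)) \<partial>P) =
        (\<Prod>j\<in>A. poisson_prob (emeasure M (B j)) (n j)) *
          (\<Prod>j\<in>J - A. nexp ((1 - (s(k := t)) j) * emeasure M (B j)))"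
        using t insert.prems by (intro insert.IH) auto
      then show ?thesis
        unfolding Jk(1) prod.insert[OF Jk(3,2)] W_def R_def
        using cong[of "\<lambda>x j. nexp ((1 - x) * emeasure M (B j))"]
          cong[of "\<lambda>x j. count_pow x (N (B j) \<omega>)" for \<omega>]
        by (simp add: mult_ac)
    qed
    also have "\<dots> = (\<Sum>i. t ^ i * (R * poisson_prob (emeasure M (B k)) i))"
      using t by (simp add: poisson_prob_pgf[OF _ mk, symmetric] mult_ac flip: ennreal_suminf_cmult)
    finally show "(\<Sum>i. t ^ i * (\<integral>\<^sup>+\<omega>. W \<omega> * indicator {of_nat i} (N (B k) \<omega>) \<partial>P)) =
        (\<Sum>i. t ^ i * (R * poisson_prob (emeasure M (B k)) i))" .
  qed
  then show ?case
    using insert.hyps by (simp add: W_def R_def mult_ac)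
qed

lemma joint_counts:
  assumes J: "finite J" and B: "\<And>j. j \<in> J \<Longrightarrow> B j \<in> sets M" "disjoint_family_on B J"
    and fin: "\<And>j. j \<in> J \<Longrightarrow> emeasure M (B j) \<noteq> \<infinity>"
  shows "emeasure P {\<omega> \<in> space P. \<forall>j\<in>J. N (B j) \<omega> = of_nat (n j)} =
    (\<Prod>j\<in>J. poisson_prob (emeasure M (B j)) (n j))"
proof -
  note [measurable] = B(1)
  have "emeasure P {\<omega> \<in> space P. \<forall>j\<in>J. N (B j) \<omega> = of_nat (n j)} =
      (\<integral>\<^sup>+\<omega>. indicator {\<omega> \<in> space P. \<forall>j\<in>J. N (B j) \<omega> = of_nat (n j)} \<omega> \<partial>P)"
    using J by (subst nn_integral_indicator) auto
  also have "\<dots> = (\<integral>\<^sup>+\<omega>. (\<Prod>j\<in>J. indicator {of_nat (n j)} (N (B j) \<omega>)) \<partial>P)"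
  proof (intro nn_integral_cong)
    fix \<omega> assume w: "\<omega> \<in> space P"
    show "indicator {\<omega> \<in> space P. \<forall>j\<in>J. N (B j) \<omega> = of_nat (n j)} \<omega> =
        (\<Prod>j\<in>J. indicator {of_nat (n j)} (N (B j) \<omega>) :: ennreal)"
    proof (cases "\<forall>j\<in>J. N (B j) \<omega> = of_nat (n j)")
      case False
      then show ?thesis using J by (auto simp: prod_zero_iff indicator_def)
    qed (use w in auto)
  qed
  also have "\<dots> = (\<Prod>j\<in>J. poisson_prob (emeasure M (B j)) (n j))"
    using joint_counts_aux[OF J B fin J subset_refl, of "\<lambda>_. 0" n] by simp
  finally show ?thesis .
qed

text \<open>If \<open>B\<close> has infinite measure, then the generating function of its count vanishes, at \<open>1 / 2\<close>
  say, although \<open>(1 / 2) ^ n\<close> is positive for each finite \<open>n\<close>.\<close>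
lemma count_infinite:
  assumes [measurable]: "B \<in> sets M" and inf: "emeasure M B = \<infinity>"
  shows "AE \<omega> in P. N B \<omega> = \<infinity>"
proof -
  have half: "(1 / 2 :: ennreal) < 1" by (simp add: divide_less_ennreal)
  have pos: "(1 - 1 / 2 :: ennreal) \<noteq> 0" using half by (simp add: diff_eq_0_iff_ennreal)
  have "(\<integral>\<^sup>+\<omega>. (\<Prod>j\<in>{()}. count_pow (1/2) (N B \<omega>)) \<partial>P) =
      (\<Prod>j\<in>{()}. nexp ((1 - 1/2) * emeasure M B))"
    using half by (intro joint_pgf) (auto simp: disjoint_family_on_def)
  then have "(\<integral>\<^sup>+\<omega>. count_pow (1/2) (N B \<omega>) \<partial>P) = 0"
    using pos by (simp add: inf ennreal_mult_top)
  then have "AE \<omega> in P. count_pow (1/2) (N B \<omega>) = 0"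
    by (subst (asm) nn_integral_0_iff_AE) auto
  then show ?thesis
  proof eventually_elim
    case (elim \<omega>)
    show ?case
    proof (rule ccontr)
      assume "\<not> ?case"
      then obtain n where "N B \<omega> = of_nat n" using point_count_cases[of "\<lambda>_. UNIV" U B \<omega>] by auto
      with elim show False by (simp add: ennreal_divide_eq_0_iff)
    qed
  qed
qed

text \<open>Independence of the counts on finite values. If some \<open>B j\<close> has infinite measure, then both
  sides are \<open>0\<close>.\<close>
lemma prob_counts:
  assumes J: "finite J" and B: "\<And>j. j \<in> J \<Longrightarrow> B j \<in> sets M" "disjoint_family_on B J"
  shows "prob {\<omega> \<in> space P. \<forall>j\<in>J. N (B j) \<omega> = of_nat (n j)} =
    (\<Prod>j\<in>J. prob {\<omega> \<in> space P. N (B j) \<omega> = of_nat (n j)})"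
proof (cases "\<exists>j\<in>J. emeasure M (B j) = \<infinity>")
  case True
  then obtain j where j: "j \<in> J" "emeasure M (B j) = \<infinity>" by blast
  have ae: "AE \<omega> in P. N (B j) \<omega> \<noteq> of_nat (n j)"
    using count_infinite[OF B(1)[OF j(1)] j(2)] by eventually_elim simp
  have 0: "prob {\<omega> \<in> space P. N (B j) \<omega> = of_nat (n j)} = 0"
    using ae B(1)[OF j(1)] by (intro prob_eq_0[THEN iffD2]) auto
  have "prob {\<omega> \<in> space P. \<forall>j\<in>J. N (B j) \<omega> = of_nat (n j)} \<le> prob {\<omega> \<in> space P. N (B j) \<omega> = of_nat (n j)}"
    using j B(1)[OF j(1)] by (intro finite_measure_mono) auto
  then have "prob {\<omega> \<in> space P. \<forall>j\<in>J. N (B j) \<omega> = of_nat (n j)} = 0"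
    unfolding 0 by (simp add: measure_le_0_iff)
  moreover have "(\<Prod>j\<in>J. prob {\<omega> \<in> space P. N (B j) \<omega> = of_nat (n j)}) = 0"
    using J j 0 by (auto simp: prod_zero_iff)
  ultimately show ?thesis by simp
next
  case False
  have single: "emeasure P {\<omega> \<in> space P. N (B j) \<omega> = of_nat (n j)} = poisson_prob (emeasure M (B j)) (n j)"
    if "j \<in> J" for j
    using joint_counts[of "{j}" B n] B False that by (auto simp: disjoint_family_on_def)
  have "emeasure P {\<omega> \<in> space P. \<forall>j\<in>J. N (B j) \<omega> = of_nat (n j)} =
      (\<Prod>j\<in>J. emeasure P {\<omega> \<in> space P. N (B j) \<omega> = of_nat (n j)})"
    using joint_counts[OF J B] False by (simp add: single)
  then have "ennreal (prob {\<omega> \<in> space P. \<forall>j\<in>J. N (B j) \<omega> = of_nat (n j)}) =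
      ennreal (\<Prod>j\<in>J. prob {\<omega> \<in> space P. N (B j) \<omega> = of_nat (n j)})"
    by (simp add: emeasure_eq_measure prod_ennreal)
  then show ?thesis by (simp add: prod_nonneg)
qed

text \<open>The events that a count equals \<open>n\<close>, for finite \<open>n\<close>, together with the empty set are stable under
  intersection and generate all events of that count: the remaining value is \<open>\<infinity>\<close>.\<close>
lemma indep_counts:
  assumes B: "\<And>j. j \<in> I \<Longrightarrow> B j \<in> sets M" "disjoint_family_on B I"
  shows "indep_vars (\<lambda>_. borel) (\<lambda>j. N (B j)) I"
proof -
  define E where "E j = insert {} (range (\<lambda>n::nat. {\<omega> \<in> space P. N (B j) \<omega> = of_nat n}))" for j
  have "indep_sets E I"
  proof (rule indep_setsI)
    show "E j \<subseteq> events" if "j \<in> I" for j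
      using B(1)[OF that] by (auto simp: E_def)
    fix A J assume J: "J \<noteq> {}" "J \<subseteq> I" "finite J" and A: "\<forall>j\<in>J. A j \<in> E j"
    show "prob (\<Inter>j\<in>J. A j) = (\<Prod>j\<in>J. prob (A j))"
    proof (cases "\<exists>j\<in>J. A j = {}")
      case True
      then have "(\<Inter>j\<in>J. A j) = {}" by auto
      moreover have "(\<Prod>j\<in>J. prob (A j)) = 0" using True J by (auto simp: prod_zero_iff intro!: bexI)
      ultimately show ?thesis by simp
    next
      case False
      then have "\<forall>j\<in>J. \<exists>n::nat. A j = {\<omega> \<in> space P. N (B j) \<omega> = of_nat n}"
        using A unfolding E_def by blast
      then obtain n :: "_ \<Rightarrow> nat" where n: "\<And>j. j \<in> J \<Longrightarrow> A j = {\<omega> \<in> space P. N (B j) \<omega> = of_nat (n j)}"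
        by metis
      have "(\<Inter>j\<in>J. A j) = {\<omega> \<in> space P. \<forall>j\<in>J. N (B j) \<omega> = of_nat (n j)}"
        using J by (auto simp: n)
      moreover have "disjoint_family_on B J" using B(2) J(2) by (rule disjoint_family_on_mono[rotated])
      ultimately show ?thesis using prob_counts[OF J(3), of B n] B(1) J(2) by (simp add: n subset_eq)
    qed
  qed
  moreover have "Int_stable (E j)" for j
    by (auto simp: Int_stable_def E_def)
  ultimately have indep: "indep_sets (\<lambda>j. sigma_sets (space P) (E j)) I"
    by (rule indep_sets_sigma)
  have "indep_sets (\<lambda>j. {N (B j) -` A \<inter> space P |A. A \<in> sets borel}) I"
  proof (rule indep_sets_mono_sets[OF indep], safe)
    fix j and A :: "ennreal set" assume "j \<in> I"
    have "E j \<subseteq> Pow (space P)" by (auto simp: E_def)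
    then interpret S: sigma_algebra "space P" "sigma_sets (space P) (E j)"
      by (rule sigma_algebra_sigma_sets)
    have single: "{\<omega> \<in> space P. N (B j) \<omega> = of_nat n} \<in> sigma_sets (space P) (E j)" for n :: nat
      by (rule sigma_sets.Basic) (auto simp: E_def)
    have fin: "(\<Union>n\<in>X. {\<omega> \<in> space P. N (B j) \<omega> = of_nat n}) \<in> sigma_sets (space P) (E j)" for X :: "nat set"
      using single by (intro S.countable_UN') auto
    define F where "F = (\<Union>n\<in>{n. of_nat n \<in> A}. {\<omega> \<in> space P. N (B j) \<omega> = of_nat (n::nat)})"
    define G where "G = space P - (\<Union>n\<in>UNIV. {\<omega> \<in> space P. N (B j) \<omega> = of_nat (n::nat)})"
    have "N (B j) -` A \<inter> space P = F \<union> (if \<infinity> \<in> A then G else {})"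
    proof (intro set_eqI)
      fix \<omega>
      show "\<omega> \<in> N (B j) -` A \<inter> space P \<longleftrightarrow> \<omega> \<in> F \<union> (if \<infinity> \<in> A then G else {})"
        using point_count_cases[of "\<lambda>_. UNIV" U "B j" \<omega>] by (auto simp: F_def G_def)
    qed
    moreover have "F \<in> sigma_sets (space P) (E j)" "G \<in> sigma_sets (space P) (E j)"
      unfolding F_def G_def using fin by blast+
    ultimately show "N (B j) -` A \<inter> space P \<in> sigma_sets (space P) (E j)" by auto
  qed
  then show ?thesis using B(1) by (auto simp: indep_vars_def2)
qed

lemma poisson_point_process: "poisson_point_process P M (\<lambda>_. UNIV) U"
  unfolding poisson_point_process_def
proof (intro conjI allI ballI impI)
  show "prob_space P" by (rule prob_space_axioms)
  show "{\<omega> \<in> space P. i \<in> UNIV} \<in> events" for i :: nat by simp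
  show "U i \<in> restrict_space P {\<omega>. i \<in> UNIV} \<rightarrow>\<^sub>M M" for i
    using U[of i] measurable_cong_sets[OF sets_restrict_UNIV[of P] refl, of M] by simp
  fix B assume B: "B \<in> sets M"
  show "if emeasure M B = \<infinity> then AE \<omega> in P. N B \<omega> = \<infinity>
        else \<forall>n::nat. prob {\<omega> \<in> space P. N B \<omega> = of_nat n} = measure M B ^ n / fact n * exp (- measure M B)"
  proof (cases "emeasure M B = \<infinity>")
    case True
    then show ?thesis using count_infinite[OF B] by simp
  next
    case False
    have "prob {\<omega> \<in> space P. N B \<omega> = of_nat n} = measure M B ^ n / fact n * exp (- measure M B)" for n :: nat
      using joint_counts[of "{()}" "\<lambda>_. B" "\<lambda>_. n"] B False
      by (simp add: disjoint_family_on_def poisson_prob_def measure_def)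
    with False show ?thesis by simp
  qed
next
  fix m :: nat and B assume "(\<forall>k<m. B k \<in> sets M) \<and> disjoint_family_on B {..<m}"
  then show "indep_vars (\<lambda>_. borel) (\<lambda>k. N (B k)) {..<m}" by (intro indep_counts) auto
qed

end

section \<open>Marking, mapping and thinning\<close>

lemma (in prob_space) nn_integral_inf_prod:
  assumes [measurable]: "\<And>i. f i \<in> borel_measurable M" and le: "\<And>i x. f i x \<le> 1"
  shows "(\<integral>\<^sup>+x. inf_prod (\<lambda>i. f i x) \<partial>M) = (INF N. \<integral>\<^sup>+x. (\<Prod>i<N. f i x) \<partial>M)"
  unfolding inf_prod_def
proof (rule nn_integral_monotone_convergence_INF_decseq)
  show "decseq (\<lambda>N x. \<Prod>i<N. f i x)"
    by (intro monotoneI le_funI) (rule decseqD[OF decseq_prod_le_1[OF le]])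
  show "(\<integral>\<^sup>+x. (\<Prod>i<0. f i x) \<partial>M) < \<infinity>" by (simp add: emeasure_space_1)
qed measurable

text \<open>The hypothesis on finite products says that, given the points \<open>Z i\<close>, the factors \<open>V i\<close> are
  independent with conditional expectations \<open>1 - v (Z i)\<close>. The space \<open>R\<close> need not be \<open>P\<close>, so that
  the marks may live on an extension.\<close>
lemma marked_pgfl:
  assumes ppp: "poisson_point_process P L (\<lambda>_. UNIV) Z" and sf: "sigma_finite_measure L"
    and R: "prob_space R" and V: "\<And>i. V i \<in> borel_measurable R" "\<And>i x. V i x \<le> 1"
    and v [measurable]: "v \<in> borel_measurable L" and v1: "\<And>z. z \<in> space L \<Longrightarrow> v z \<le> 1"
    and eq: "\<And>N. (\<integral>\<^sup>+x. (\<Prod>i<N. V i x) \<partial>R) = (\<integral>\<^sup>+\<omega>. (\<Prod>i<N. 1 - v (Z i \<omega>)) \<partial>P)"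
  shows "(\<integral>\<^sup>+x. inf_prod (\<lambda>i. V i x) \<partial>R) = nexp (\<integral>\<^sup>+z. v z \<partial>L)"
proof -
  note ppp_measurable[OF ppp, measurable]
  have "(\<integral>\<^sup>+x. inf_prod (\<lambda>i. V i x) \<partial>R) = (INF N. \<integral>\<^sup>+\<omega>. (\<Prod>i<N. 1 - v (Z i \<omega>)) \<partial>P)"
    by (subst prob_space.nn_integral_inf_prod[OF R V]) (simp only: eq)
  also have "\<dots> = (\<integral>\<^sup>+\<omega>. inf_prod (\<lambda>i. 1 - v (Z i \<omega>)) \<partial>P)"
    by (rule prob_space.nn_integral_inf_prod[OF ppp_prob_space[OF ppp], symmetric])
      (simp_all add: diff_le_self_ennreal)
  also have "\<dots> = nexp (\<integral>\<^sup>+z. v z \<partial>L)" by (rule ppp_pgfl[OF ppp sf v v1])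
  finally show ?thesis .
qed

lemma (in prob_space) nn_integral_one_minus:
  assumes [measurable]: "f \<in> borel_measurable M" and "\<And>x. x \<in> space M \<Longrightarrow> f x \<le> 1"
  shows "(\<integral>\<^sup>+x. 1 - f x \<partial>M) = 1 - (\<integral>\<^sup>+x. f x \<partial>M)" "(\<integral>\<^sup>+x. f x \<partial>M) \<le> 1"
proof -
  have "(\<integral>\<^sup>+x. f x \<partial>M) \<le> (\<integral>\<^sup>+x. 1 \<partial>M)" using assms(2) by (intro nn_integral_mono)
  then show le: "(\<integral>\<^sup>+x. f x \<partial>M) \<le> 1" by (simp add: emeasure_space_1)
  show "(\<integral>\<^sup>+x. 1 - f x \<partial>M) = 1 - (\<integral>\<^sup>+x. f x \<partial>M)"
    using assms(2) le by (subst nn_integral_diff) (auto simp: emeasure_space_1 top_unique intro!: AE_I2)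
qed

lemma nn_integral_iid_prod:
  assumes "prob_space N" and [measurable]: "\<And>i. g i \<in> borel_measurable N"
  shows "(\<integral>\<^sup>+\<zeta>. (\<Prod>i<n. g i (\<zeta> i)) \<partial>Pi\<^sub>M (UNIV :: nat set) (\<lambda>_. N)) = (\<Prod>i<n. \<integral>\<^sup>+x. g i x \<partial>N)"
proof -
  interpret N: prob_space N by fact
  interpret product_prob_space "\<lambda>_. N" "UNIV :: nat set" ..
  have "(\<Prod>i<n. \<integral>\<^sup>+x. g i x \<partial>N) = (\<integral>\<^sup>+\<zeta>. (\<Prod>i<n. g i (\<zeta> i)) \<partial>Pi\<^sub>M {..<n} (\<lambda>_. N))"
    by (subst product_nn_integral_prod) auto
  also have "\<dots> = (\<integral>\<^sup>+\<zeta>. (\<Prod>i<n. g i (\<zeta> i)) \<partial>distr (Pi\<^sub>M UNIV (\<lambda>_. N)) (Pi\<^sub>M {..<n} (\<lambda>_. N)) (\<lambda>x. restrict x {..<n}))"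
    by (subst distr_PiM_restrict_finite) auto
  also have "\<dots> = (\<integral>\<^sup>+\<zeta>. (\<Prod>i<n. g i (\<zeta> i)) \<partial>Pi\<^sub>M (UNIV :: nat set) (\<lambda>_. N))"
    by (subst nn_integral_distr) (auto intro!: nn_integral_cong)
  finally show ?thesis by simp
qed

text \<open>Given the points, averaging over the marks turns a test function on marked points into one on
  points, so that the generating functional of the marked process has the Poisson form.\<close>
theorem ppp_marking:
  assumes ppp: "poisson_point_process P L (\<lambda>_. UNIV) Z" and sf: "sigma_finite_measure L"
    and N: "prob_space N"
  shows "poisson_point_process (P \<Otimes>\<^sub>M Pi\<^sub>M UNIV (\<lambda>_::nat. N)) (L \<Otimes>\<^sub>M N) (\<lambda>_. UNIV)
    (\<lambda>i (\<omega>, \<zeta>). (Z i \<omega>, \<zeta> i))"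
proof -
  note Z [measurable] = ppp_measurable[OF ppp]
  interpret P: prob_space P using ppp by (rule ppp_prob_space)
  interpret N: prob_space N by fact
  interpret L: sigma_finite_measure L by fact
  interpret Pi: prob_space "Pi\<^sub>M (UNIV :: nat set) (\<lambda>_. N)" by (intro prob_space_PiM) (rule N)
  interpret R: pair_prob_space P "Pi\<^sub>M (UNIV :: nat set) (\<lambda>_. N)" ..
  interpret LN: pair_sigma_finite L N ..
  show ?thesis
  proof (intro point_sequence.poisson_point_process, unfold_locales)
    fix i show "(\<lambda>(\<omega>, \<zeta>). (Z i \<omega>, \<zeta> i)) \<in> P \<Otimes>\<^sub>M Pi\<^sub>M UNIV (\<lambda>_. N) \<rightarrow>\<^sub>M L \<Otimes>\<^sub>M N" by measurable
  next
    fix q :: "_ \<Rightarrow> ennreal" assume [measurable]: "q \<in> borel_measurable (L \<Otimes>\<^sub>M N)"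
      and q1: "\<And>x. x \<in> space (L \<Otimes>\<^sub>M N) \<Longrightarrow> q x \<le> 1"
    define v where "v z = (\<integral>\<^sup>+x. q (z, x) \<partial>N)" for z
    have [measurable]: "v \<in> borel_measurable L" unfolding v_def by measurable
    have v: "(\<integral>\<^sup>+x. 1 - q (z, x) \<partial>N) = 1 - v z" "v z \<le> 1" if [measurable]: "z \<in> space L" for z
      unfolding v_def using that
      by (intro N.nn_integral_one_minus; auto intro!: q1 simp: space_pair_measure)+
    have "(\<integral>\<^sup>+x. inf_prod (\<lambda>i. case x of (\<omega>, \<zeta>) \<Rightarrow> 1 - q (Z i \<omega>, \<zeta> i)) \<partial>(P \<Otimes>\<^sub>M Pi\<^sub>M UNIV (\<lambda>_. N))) =
        nexp (\<integral>\<^sup>+z. v z \<partial>L)"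
    proof (rule marked_pgfl[OF ppp sf])
      fix n
      have "(\<integral>\<^sup>+x. (\<Prod>i<n. case x of (\<omega>, \<zeta>) \<Rightarrow> 1 - q (Z i \<omega>, \<zeta> i)) \<partial>(P \<Otimes>\<^sub>M Pi\<^sub>M UNIV (\<lambda>_. N))) =
          (\<integral>\<^sup>+\<omega>. (\<integral>\<^sup>+\<zeta>. (\<Prod>i<n. 1 - q (Z i \<omega>, \<zeta> i)) \<partial>Pi\<^sub>M UNIV (\<lambda>_. N)) \<partial>P)"
        by (subst Pi.nn_integral_fst[symmetric]) (auto simp: split_beta')
      also have "\<dots> = (\<integral>\<^sup>+\<omega>. (\<Prod>i<n. 1 - v (Z i \<omega>)) \<partial>P)"
      proof (rule nn_integral_cong)
        fix \<omega> assume w: "\<omega> \<in> space P"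
        have Zw [measurable]: "Z i \<omega> \<in> space L" for i using measurable_space[OF Z w] .
        show "(\<integral>\<^sup>+\<zeta>. (\<Prod>i<n. 1 - q (Z i \<omega>, \<zeta> i)) \<partial>Pi\<^sub>M UNIV (\<lambda>_. N)) = (\<Prod>i<n. 1 - v (Z i \<omega>))"
          by (subst nn_integral_iid_prod[OF N]) (simp_all add: v(1)[OF Zw])
      qed
      finally show "(\<integral>\<^sup>+x. (\<Prod>i<n. case x of (\<omega>, \<zeta>) \<Rightarrow> 1 - q (Z i \<omega>, \<zeta> i)) \<partial>(P \<Otimes>\<^sub>M Pi\<^sub>M UNIV (\<lambda>_. N))) =
          (\<integral>\<^sup>+\<omega>. (\<Prod>i<n. 1 - v (Z i \<omega>)) \<partial>P)" .
    qed (auto simp: v R.prob_space_axioms diff_le_self_ennreal split: prod.split)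
    also have "(\<integral>\<^sup>+z. v z \<partial>L) = (\<integral>\<^sup>+x. q x \<partial>(L \<Otimes>\<^sub>M N))"
      unfolding v_def by (rule N.nn_integral_fst) measurable
    finally show "(\<integral>\<^sup>+x. inf_prod (\<lambda>i. 1 - q (case x of (\<omega>, \<zeta>) \<Rightarrow> (Z i \<omega>, \<zeta> i)))
        \<partial>(P \<Otimes>\<^sub>M Pi\<^sub>M UNIV (\<lambda>_. N))) = nexp (\<integral>\<^sup>+x. q x \<partial>(L \<Otimes>\<^sub>M N))"
      by (simp add: split_beta')
  qed
qed

text \<open>The counts of the new process are counts of the old one, taken for the sets \<open>D \<inter> h -` B\<close>.\<close>
theorem ppp_restrict_map:
  assumes ppp: "poisson_point_process P M K U" and D [measurable]: "D \<in> sets M"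
    and h [measurable]: "h \<in> M \<rightarrow>\<^sub>M M'"
  shows "poisson_point_process P (distr (density M (indicator D)) M' h)
    (\<lambda>\<omega>. {i \<in> K \<omega>. U i \<omega> \<in> D}) (\<lambda>i \<omega>. h (U i \<omega>))"
proof -
  let ?M' = "distr (density M (indicator D)) M' h"
  let ?K' = "\<lambda>\<omega>. {i \<in> K \<omega>. U i \<omega> \<in> D}" and ?U' = "\<lambda>i \<omega>. h (U i \<omega>)"
  have U: "U i \<in> restrict_space P {\<omega>. i \<in> K \<omega>} \<rightarrow>\<^sub>M M" for i
    using ppp by (simp add: poisson_point_process_def)
  have B': "D \<inter> h -` B \<in> sets M" if [measurable]: "B \<in> sets M'" for B
  proof -
    have "D \<inter> h -` B = D \<inter> (h -` B \<inter> space M)" using sets.sets_into_space[OF D] by auto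
    also have "\<dots> \<in> sets M" by measurable
    finally show ?thesis .
  qed
  have em: "emeasure ?M' B = emeasure M (D \<inter> h -` B)" if [measurable]: "B \<in> sets M'" for B
  proof -
    have "h -` B \<inter> space M \<in> sets M" by measurable
    moreover have "h -` B \<inter> space M \<inter> D = D \<inter> h -` B" using sets.sets_into_space[OF D] by auto
    ultimately show ?thesis
      by (subst emeasure_distr) (auto simp: emeasure_restricted Int_ac)
  qed
  have cnt: "point_count ?K' ?U' B = point_count K U (D \<inter> h -` B)" for B
    unfolding point_count_def[abs_def] by (intro ext arg_cong[where f="emeasure _"]) auto
  have cnts: "\<And>B. B\<in>sets M \<Longrightarrow>
        if emeasure M B = \<infinity> then AE \<omega> in P. point_count K U B \<omega> = \<infinity>
        else \<forall>n::nat. measure P {\<omega> \<in> space P. point_count K U B \<omega> = of_nat n} =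
               measure M B ^ n / fact n * exp (- measure M B)"
    using ppp unfolding poisson_point_process_def by blast
  show ?thesis
    unfolding poisson_point_process_def cnt
  proof (intro conjI allI ballI impI)
    show "prob_space P" using ppp by (rule ppp_prob_space)
    show "{\<omega> \<in> space P. i \<in> ?K' \<omega>} \<in> sets P" for i
      using ppp_points_measurable[OF ppp D, of i] by simp
    show "?U' i \<in> restrict_space P {\<omega>. i \<in> ?K' \<omega>} \<rightarrow>\<^sub>M ?M'" for i
    proof -
      have "U i \<in> restrict_space P {\<omega>. i \<in> ?K' \<omega>} \<rightarrow>\<^sub>M M"
        by (rule measurable_restrict_mono[OF U]) auto
      from measurable_compose[OF this h] show ?thesis by simp
    qed
    fix B assume "B \<in> sets ?M'"
    then have B: "B \<in> sets M'" by simp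
    show "if emeasure ?M' B = \<infinity> then AE \<omega> in P. point_count K U (D \<inter> h -` B) \<omega> = \<infinity>
        else \<forall>n::nat. measure P {\<omega> \<in> space P. point_count K U (D \<inter> h -` B) \<omega> = of_nat n} =
               measure ?M' B ^ n / fact n * exp (- measure ?M' B)"
    proof -
      have "measure ?M' B = measure M (D \<inter> h -` B)" using em[OF B] by (simp add: measure_def)
      then show ?thesis using cnts[OF B'[OF B]] by (simp only: em[OF B])
    qed
  next
    fix m :: nat and B assume B: "(\<forall>k<m. B k \<in> sets ?M') \<and> disjoint_family_on B {..<m}"
    then show "prob_space.indep_vars P (\<lambda>_. borel) (\<lambda>k. point_count K U (D \<inter> h -` B k)) {..<m}"
      by (intro ppp_indep[OF ppp] B') (auto simp: disjoint_family_on_def)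
  qed
qed

text \<open>The pair \<open>(K, U)\<close> itself serves as the sample point. Its space carries the largest \<open>\<sigma>\<close>-algebra for
  which the map to it is measurable, so that events transfer without further checks.\<close>
lemma ppp_canonical:
  fixes M :: "'a measure"
  assumes ppp: "poisson_point_process P M K U" and space: "space M = UNIV"
  shows "\<exists>Q :: (nat set \<times> (nat \<Rightarrow> 'a)) measure.
    poisson_point_process Q M fst (\<lambda>i x. snd x i)"
proof -
  interpret P: prob_space P using ppp by (rule ppp_prob_space)
  let ?C = "point_count fst (\<lambda>i x. snd x i) :: 'a set \<Rightarrow> nat set \<times> (nat \<Rightarrow> 'a) \<Rightarrow> ennreal"
  define h where "h \<omega> = (K \<omega>, \<lambda>i. U i \<omega>)" for \<omega>
  define S where "S = sigma UNIV {A. h -` A \<inter> space P \<in> sets P}"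
  have S [simp]: "space S = UNIV" by (simp add: S_def)
  have in_S: "A \<in> sets S" if "h -` A \<inter> space P \<in> sets P" for A
    unfolding S_def using that by (auto intro: sigma_sets.Basic)
  have h [measurable]: "h \<in> P \<rightarrow>\<^sub>M S"
    unfolding S_def by (rule measurable_measure_of) auto
  have meas_S: "g \<in> S \<rightarrow>\<^sub>M borel" if "(\<lambda>\<omega>. g (h \<omega>)) \<in> P \<rightarrow>\<^sub>M borel" for g :: "_ \<Rightarrow> ennreal"
  proof (rule measurableI)
    fix A :: "ennreal set" assume "A \<in> sets borel"
    from measurable_sets[OF that this]
    show "g -` A \<inter> space S \<in> sets S"
      by (intro in_S) (simp add: vimage_def)
  qed simp
  define Q where "Q = distr P S h"
  have cnt: "?C B (h \<omega>) = point_count K U B \<omega>" for B \<omega>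
    by (simp add: point_count_def h_def)
  have cnt_S [measurable]: "?C B \<in> borel_measurable S" if "B \<in> sets M" for B
    using ppp_count_measurable[OF ppp that] by (intro meas_S) (simp add: cnt)
  have "poisson_point_process Q M fst (\<lambda>i x. snd x i)"
    unfolding poisson_point_process_def
  proof (intro conjI allI ballI impI)
    show Q: "prob_space Q" unfolding Q_def by (rule P.prob_space_distr) (rule h)
    have Ki: "{x. i \<in> fst x} \<in> sets S" for i
    proof (rule in_S)
      have "{\<omega> \<in> space P. i \<in> K \<omega>} \<in> sets P" using ppp by (simp add: poisson_point_process_def)
      moreover have "h -` {x. i \<in> fst x} \<inter> space P = {\<omega> \<in> space P. i \<in> K \<omega>}" by (auto simp: h_def)
      ultimately show "h -` {x. i \<in> fst x} \<inter> space P \<in> sets P" by simp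
    qed
    then show "{x \<in> space Q. i \<in> fst x} \<in> sets Q" for i
      by (simp add: Q_def)
    show "(\<lambda>x. snd x i) \<in> restrict_space Q {x. i \<in> fst x} \<rightarrow>\<^sub>M M" for i
    proof (rule measurableI)
      fix B assume B: "B \<in> sets M"
      have "h -` {x. i \<in> fst x \<and> snd x i \<in> B} \<inter> space P = {\<omega> \<in> space P. i \<in> K \<omega> \<and> U i \<omega> \<in> B}"
        by (auto simp: h_def)
      then have "{x. i \<in> fst x \<and> snd x i \<in> B} \<in> sets S"
        using ppp_points_measurable[OF ppp B, of i] by (intro in_S) simp
      then show "(\<lambda>x. snd x i) -` B \<inter> space (restrict_space Q {x. i \<in> fst x}) \<in>
          sets (restrict_space Q {x. i \<in> fst x})"
        using Ki[of i] by (subst sets_restrict_space_iff)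
          (auto simp: Q_def space_restrict_space Int_def vimage_def conj_commute)
    qed (simp add: space)
    fix B assume B: "B \<in> sets M"
    have ifs: "if emeasure M B = \<infinity> then AE \<omega> in P. point_count K U B \<omega> = \<infinity>
        else \<forall>n::nat. measure P {\<omega> \<in> space P. point_count K U B \<omega> = of_nat n} =
               measure M B ^ n / fact n * exp (- measure M B)"
      using ppp B unfolding poisson_point_process_def by blast
    have eqS: "{x \<in> space S. ?C B x = y} \<in> sets S" for y
      using cnt_S[OF B] by measurable
    then have 1: "measure Q {x \<in> space Q. ?C B x = y} =
        measure P {\<omega> \<in> space P. point_count K U B \<omega> = y}" for y
      unfolding Q_def by (subst measure_distr) (auto simp: cnt vimage_def Int_def conj_commute)
    have 2: "(AE x in Q. ?C B x = \<infinity>) \<longleftrightarrow>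
        (AE \<omega> in P. point_count K U B \<omega> = \<infinity>)"
      unfolding Q_def using eqS[of \<infinity>] by (subst AE_distr_iff) (auto simp: cnt)
    show "if emeasure M B = \<infinity> then AE x in Q. ?C B x = \<infinity>
        else \<forall>n::nat. measure Q {x \<in> space Q. ?C B x = of_nat n} =
               measure M B ^ n / fact n * exp (- measure M B)"
      using ifs unfolding 1 2 .
  next
    fix m :: nat and B assume B: "(\<forall>k<m. B k \<in> sets M) \<and> disjoint_family_on B {..<m}"
    interpret Q: prob_space Q unfolding Q_def by (rule P.prob_space_distr) (rule h)
    show "Q.indep_vars (\<lambda>_. borel) (\<lambda>k. ?C (B k)) {..<m}"
    proof (cases "m = 0")
      case True
      then show ?thesis by (simp add: Q.indep_vars_def Q.indep_sets_def)
    next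
      case False
      note [measurable] = cnt_S
      have [measurable]: "B k \<in> sets M" if "k < m" for k using B that by auto
      have "distr P (\<Pi>\<^sub>M k\<in>{..<m}. borel) (\<lambda>\<omega>. \<lambda>k\<in>{..<m}. point_count K U (B k) \<omega>) =
          (\<Pi>\<^sub>M k\<in>{..<m}. distr P borel (point_count K U (B k)))"
      proof (rule P.indep_vars_iff_distr_eq_PiM'[THEN iffD1])
        show "P.indep_vars (\<lambda>_. borel) (\<lambda>k. point_count K U (B k)) {..<m}"
          using B by (intro ppp_indep[OF ppp]) auto
        show "point_count K U (B k) \<in> borel_measurable P" if "k \<in> {..<m}" for k
          using that B by (intro ppp_count_measurable[OF ppp]) auto
      qed (use False in auto)
      moreover have "distr Q (\<Pi>\<^sub>M k\<in>{..<m}. borel) (\<lambda>x. \<lambda>k\<in>{..<m}. ?C (B k) x) =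
          distr P (\<Pi>\<^sub>M k\<in>{..<m}. borel) (\<lambda>\<omega>. \<lambda>k\<in>{..<m}. point_count K U (B k) \<omega>)"
        unfolding Q_def
        by (subst distr_distr) (auto simp: comp_def cnt intro!: measurable_restrict cnt_S)
      moreover have "(\<Pi>\<^sub>M k\<in>{..<m}. distr Q borel (?C (B k))) =
          (\<Pi>\<^sub>M k\<in>{..<m}. distr P borel (point_count K U (B k)))"
        unfolding Q_def by (intro PiM_cong refl) (subst distr_distr, auto simp: comp_def cnt)
      ultimately show ?thesis
        using False by (subst Q.indep_vars_iff_distr_eq_PiM') (auto simp: Q_def cnt_S)
    qed
  qed
  then show ?thesis by blast
qed

text \<open>Each point is kept with probability \<open>c\<close>, independently of the others, by attaching a coin to it.
  This multiplies the intensity by \<open>c\<close>.\<close>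
lemma ppp_thinned_exists:
  fixes M' :: "'b measure"
  assumes ppp: "poisson_point_process P M (\<lambda>_. UNIV) U" and sf: "sigma_finite_measure M"
    and D [measurable]: "D \<in> sets M" and h [measurable]: "h \<in> M \<rightarrow>\<^sub>M M'" and space: "space M' = UNIV"
    and c: "0 \<le> c" "c \<le> 1"
  shows "\<exists>Q :: (nat set \<times> (nat \<Rightarrow> 'b)) measure.
    poisson_point_process Q (scale_measure (ennreal c) (distr (density M (indicator D)) M' h))
      fst (\<lambda>i x. snd x i)"
proof -
  define coin where "coin = measure_pmf (bernoulli_pmf c)"
  have coin: "prob_space coin" unfolding coin_def by (rule measure_pmf.prob_space_axioms)
  interpret coin: prob_space coin by fact
  interpret M: sigma_finite_measure M by fact
  have sets_coin [simp]: "sets coin = UNIV" by (simp add: coin_def)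
  have True_coin: "emeasure coin {True} = ennreal c"
    using c by (simp add: coin_def emeasure_pmf_single)
  define D' where "D' = D \<times> {True}"
  have D' [measurable]: "D' \<in> sets (M \<Otimes>\<^sub>M coin)" unfolding D'_def by (intro pair_measureI) auto
  have h' [measurable]: "h \<circ> fst \<in> M \<Otimes>\<^sub>M coin \<rightarrow>\<^sub>M M'" by measurable
  have "distr (density (M \<Otimes>\<^sub>M coin) (indicator D')) M' (h \<circ> fst) =
      scale_measure (ennreal c) (distr (density M (indicator D)) M' h)"
  proof (rule measure_eqI)
    fix B assume "B \<in> sets (distr (density (M \<Otimes>\<^sub>M coin) (indicator D')) M' (h \<circ> fst))"
    then have B [measurable]: "B \<in> sets M'" by simp
    have hB: "h -` B \<inter> space M \<in> sets M" by measurable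
    have "emeasure (distr (density (M \<Otimes>\<^sub>M coin) (indicator D')) M' (h \<circ> fst)) B =
        emeasure (M \<Otimes>\<^sub>M coin) (D' \<inter> ((h \<circ> fst) -` B \<inter> space (M \<Otimes>\<^sub>M coin)))"
      using h' B D' by (subst emeasure_distr) (auto intro!: emeasure_restricted)
    also have "D' \<inter> ((h \<circ> fst) -` B \<inter> space (M \<Otimes>\<^sub>M coin)) = (D \<inter> (h -` B \<inter> space M)) \<times> {True}"
      using sets.sets_into_space[OF D] by (auto simp: D'_def space_pair_measure coin_def)
    also have "emeasure (M \<Otimes>\<^sub>M coin) \<dots> = emeasure M (D \<inter> (h -` B \<inter> space M)) * ennreal c"
      using hB by (subst coin.emeasure_pair_measure_Times) (auto simp: True_coin)
    also have "emeasure M (D \<inter> (h -` B \<inter> space M)) = emeasure (distr (density M (indicator D)) M' h) B"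
      using hB by (subst emeasure_distr) (auto simp: emeasure_restricted)
    finally show "emeasure (distr (density (M \<Otimes>\<^sub>M coin) (indicator D')) M' (h \<circ> fst)) B =
        emeasure (scale_measure (ennreal c) (distr (density M (indicator D)) M' h)) B"
      by (simp add: mult.commute comp_def)
  qed simp
  then show ?thesis
    using ppp_canonical[OF ppp_restrict_map[OF ppp_marking[OF ppp sf coin] D' h']] space
    by (simp add: space_scale_measure)
qed

section \<open>Laws of suprema\<close>

text \<open>Distribution functions at positive levels determine the law of a nonnegative process: level \<open>0\<close>
  is reached by continuity from above, and negative levels have probability \<open>0\<close>.\<close>
lemma fdd_eqI:
  fixes X :: "'t \<Rightarrow> 'p \<Rightarrow> real" and Y :: "'t \<Rightarrow> 'q \<Rightarrow> real"
  assumes P: "prob_space P" and Q: "prob_space Q"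
    and X [measurable]: "\<And>t. X t \<in> borel_measurable P"
    and Y [measurable]: "\<And>t. Y t \<in> borel_measurable Q"
    and X0: "\<And>t. AE \<omega> in P. 0 \<le> X t \<omega>" and Y0: "\<And>t. AE \<omega> in Q. 0 \<le> Y t \<omega>"
    and eq: "\<And>J a. finite J \<Longrightarrow> (\<And>t. t \<in> J \<Longrightarrow> 0 < a t) \<Longrightarrow>
      measure P {\<omega> \<in> space P. \<forall>t\<in>J. X t \<omega> \<le> a t} = measure Q {\<omega> \<in> space Q. \<forall>t\<in>J. Y t \<omega> \<le> a t}"
  shows "fdd_eq P X Q Y"
proof -
  have cdf: "measure P {\<omega> \<in> space P. \<forall>t\<in>J. X t \<omega> \<le> a t} = measure Q {\<omega> \<in> space Q. \<forall>t\<in>J. Y t \<omega> \<le> a t}"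
    if J: "finite J" for J a
  proof (cases "\<exists>t\<in>J. a t < 0")
    case True
    then obtain t where t: "t \<in> J" "a t < 0" by blast
    have "AE \<omega> in P. \<not> (\<forall>t\<in>J. X t \<omega> \<le> a t)" using X0[of t] by eventually_elim (use t in force)
    moreover have "{\<omega> \<in> space P. \<forall>t\<in>J. X t \<omega> \<le> a t} \<in> sets P" using J by measurable
    ultimately have "measure P {\<omega> \<in> space P. \<forall>t\<in>J. X t \<omega> \<le> a t} = 0"
      by (intro measure_eq_0_null_sets iffD2[OF AE_iff_null_sets]) auto
    note zero = this
    have "AE \<omega> in Q. \<not> (\<forall>t\<in>J. Y t \<omega> \<le> a t)" using Y0[of t] by eventually_elim (use t in force)
    moreover have "{\<omega> \<in> space Q. \<forall>t\<in>J. Y t \<omega> \<le> a t} \<in> sets Q" using J by measurable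
    ultimately have "measure Q {\<omega> \<in> space Q. \<forall>t\<in>J. Y t \<omega> \<le> a t} = 0"
      by (intro measure_eq_0_null_sets iffD2[OF AE_iff_null_sets]) auto
    with zero show ?thesis by simp
  next
    case False
    have lim: "(\<lambda>n. measure R {\<omega> \<in> space R. \<forall>t\<in>J. W t \<omega> \<le> a t + 1 / real (Suc n)}) \<longlonglongrightarrow>
        measure R {\<omega> \<in> space R. \<forall>t\<in>J. W t \<omega> \<le> a t}"
      if R: "prob_space R" and [measurable]: "\<And>t. W t \<in> borel_measurable R" for R :: "'r measure" and W
    proof -
      interpret R: prob_space R by fact
      let ?A = "\<lambda>n. {\<omega> \<in> space R. \<forall>t\<in>J. W t \<omega> \<le> a t + 1 / real (Suc n)}"
      have "(\<lambda>n. measure R (?A n)) \<longlonglongrightarrow> measure R (\<Inter>n. ?A n)"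
      proof (rule R.finite_Lim_measure_decseq)
        show "range ?A \<subseteq> sets R" using J by auto
        show "decseq ?A"
        proof (intro monotoneI subsetI)
          fix m n :: nat and \<omega> assume "m \<le> n" and w: "\<omega> \<in> ?A n"
          then have "1 / real (Suc n) \<le> 1 / real (Suc m)" by (simp add: field_simps)
          then show "\<omega> \<in> ?A m" using w by (fastforce intro: order_trans)
        qed
      qed
      moreover have "(\<Inter>n. ?A n) = {\<omega> \<in> space R. \<forall>t\<in>J. W t \<omega> \<le> a t}"
      proof (intro set_eqI iffI)
        fix \<omega> assume w: "\<omega> \<in> (\<Inter>n. ?A n)"
        have "W t \<omega> \<le> a t" if "t \<in> J" for t
        proof (rule field_le_epsilon)
          fix e :: real assume "0 < e"
          then obtain n where "1 / real (Suc n) < e" using nat_approx_posE by blast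
          moreover have "W t \<omega> \<le> a t + 1 / real (Suc n)" using w that by blast
          ultimately show "W t \<omega> \<le> a t + e" by linarith
        qed
        then show "\<omega> \<in> {\<omega> \<in> space R. \<forall>t\<in>J. W t \<omega> \<le> a t}" using w by auto
      qed (fastforce intro: order_trans)
      ultimately show ?thesis by simp
    qed
    have "a t + 1 / real (Suc n) > 0" if "t \<in> J" for t n
      using False that by (intro add_nonneg_pos) (auto simp: not_less)
    then have "measure P {\<omega> \<in> space P. \<forall>t\<in>J. X t \<omega> \<le> a t + 1 / real (Suc n)} =
        measure Q {\<omega> \<in> space Q. \<forall>t\<in>J. Y t \<omega> \<le> a t + 1 / real (Suc n)}" for n
      using J by (intro eq) auto
    with lim[of P X, OF P X] lim[of Q Y, OF Q Y] show ?thesis by (simp only: LIMSEQ_unique)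
  qed
  show ?thesis
    unfolding fdd_eq_def
  proof (intro conjI allI impI X Y)
    fix J :: "'t set" assume J: "finite J"
    define E where "E = {Pi\<^sub>E J F |F. \<forall>t\<in>J. F t \<in> range (\<lambda>a::real. {..a})}"
    have UN: "(\<Union>n. {..real n}) = UNIV" by (auto intro: real_arch_simple)
    have sets: "sets (Pi\<^sub>M J (\<lambda>_. borel :: real measure)) = sigma_sets (Pi\<^sub>E J (\<lambda>_. UNIV)) E"
    proof -
      have "sets (\<Pi>\<^sub>M t\<in>J. sigma UNIV (range (\<lambda>a::real. {..a}))) =
          sets (sigma (Pi\<^sub>E J (\<lambda>_. UNIV))
            {{f \<in> Pi\<^sub>E J (\<lambda>_. UNIV). \<forall>i\<in>j. f i \<in> A i} |A j. j \<in> {J} \<and> A \<in> j \<rightarrow> range (\<lambda>a::real. {..a})})"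
        using J UN by (intro sets_PiM_sigma)
          (auto intro!: exI[of _ "range (\<lambda>n. {..real n})"])
      also have "{{f \<in> Pi\<^sub>E J (\<lambda>_. UNIV). \<forall>i\<in>j. f i \<in> A i} |A j. j \<in> {J} \<and> A \<in> j \<rightarrow> range (\<lambda>a::real. {..a})} = E"
      proof -
        have "{f \<in> Pi\<^sub>E J (\<lambda>_. UNIV). \<forall>i\<in>J. f i \<in> A i} = Pi\<^sub>E J A" for A :: "'t \<Rightarrow> real set"
          by (auto simp: PiE_def extensional_def)
        then show ?thesis unfolding E_def by (auto simp: Pi_iff)
      qed
      also have "sets (sigma (Pi\<^sub>E J (\<lambda>_. UNIV)) E) = sigma_sets (Pi\<^sub>E J (\<lambda>_. UNIV)) E"
        by (intro sets_measure_of) (auto simp: E_def PiE_iff)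
      finally show ?thesis by (simp only: borel_eq_atMost)
    qed
    have em: "emeasure (distr R (Pi\<^sub>M J (\<lambda>_. borel)) (\<lambda>\<omega>. \<lambda>t\<in>J. W t \<omega>)) (Pi\<^sub>E J F) =
        ennreal (measure R {\<omega> \<in> space R. \<forall>t\<in>J. W t \<omega> \<le> a t})"
      if "prob_space R" and [measurable]: "\<And>t. W t \<in> borel_measurable R" and F: "\<And>t. t \<in> J \<Longrightarrow> F t = {..a t}"
      for R :: "'r measure" and W :: "'t \<Rightarrow> 'r \<Rightarrow> real" and F a
    proof -
      interpret R: prob_space R by fact
      have "Pi\<^sub>E J F \<in> sets (Pi\<^sub>M J (\<lambda>_. borel))" using J F by (intro sets_PiM_I_finite) auto
      then show ?thesis
        using F by (subst emeasure_distr) (auto simp: R.emeasure_eq_measure PiE_iff vimage_def Int_def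
            conj_commute intro!: arg_cong[where f="measure R"])
    qed
    show "distr P (Pi\<^sub>M J (\<lambda>_. borel)) (\<lambda>\<omega>. \<lambda>t\<in>J. X t \<omega>) = distr Q (Pi\<^sub>M J (\<lambda>_. borel)) (\<lambda>\<omega>. \<lambda>t\<in>J. Y t \<omega>)"
      (is "?P = ?Q")
    proof (rule measure_eqI_generator_eq[where E = E and \<Omega> = "Pi\<^sub>E J (\<lambda>_. UNIV)" and
          A = "\<lambda>n. Pi\<^sub>E J (\<lambda>_. {..real n})"])
      show "Int_stable E"
      proof (rule Int_stableI)
        fix A B assume "A \<in> E" "B \<in> E"
        then obtain F G where FG: "A = Pi\<^sub>E J F" "B = Pi\<^sub>E J G"
          "\<forall>t\<in>J. F t \<in> range (\<lambda>a::real. {..a})" "\<forall>t\<in>J. G t \<in> range (\<lambda>a::real. {..a})"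
          by (auto simp: E_def)
        have "A \<inter> B = Pi\<^sub>E J (\<lambda>t. F t \<inter> G t)" using FG by (auto simp: PiE_iff)
        moreover have "\<forall>t\<in>J. F t \<inter> G t \<in> range (\<lambda>a::real. {..a})"
        proof
          fix t assume "t \<in> J"
          with FG obtain a b where "F t = {..a}" "G t = {..b}" by blast
          then show "F t \<inter> G t \<in> range (\<lambda>a::real. {..a})" by (auto simp: Int_atMost)
        qed
        ultimately show "A \<inter> B \<in> E" by (auto simp: E_def)
      qed
      show "E \<subseteq> Pow (Pi\<^sub>E J (\<lambda>_. UNIV))" by (auto simp: E_def PiE_iff)
      show "emeasure ?P A = emeasure ?Q A" if "A \<in> E" for A
      proof -
        from that obtain F where F: "A = Pi\<^sub>E J F" "\<forall>t\<in>J. F t \<in> range (\<lambda>a::real. {..a})"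
          by (auto simp: E_def)
        then have "\<forall>t\<in>J. \<exists>a. F t = {..a}" by blast
        then obtain a where a: "\<And>t. t \<in> J \<Longrightarrow> F t = {..a t}" by metis
        show ?thesis unfolding F(1) using em[of P X F a, OF P X] em[of Q Y F a, OF Q Y] a cdf[OF J, of a] by simp
      qed
      show "sets ?P = sigma_sets (Pi\<^sub>E J (\<lambda>_. UNIV)) E" "sets ?Q = sigma_sets (Pi\<^sub>E J (\<lambda>_. UNIV)) E"
        using sets by auto
      show "range (\<lambda>n. Pi\<^sub>E J (\<lambda>_. {..real n})) \<subseteq> E" by (auto simp: E_def)
      show "(\<Union>n. Pi\<^sub>E J (\<lambda>_. {..real n})) = Pi\<^sub>E J (\<lambda>_. UNIV)"
      proof (intro set_eqI iffI)
        fix x assume x: "x \<in> Pi\<^sub>E J (\<lambda>_. UNIV :: real set)"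
        obtain n :: nat where n: "(\<Sum>t\<in>J. \<bar>x t\<bar>) \<le> real n" using real_arch_simple by blast
        have "x t \<le> real n" if "t \<in> J" for t
          using member_le_sum[of t J "\<lambda>t. \<bar>x t\<bar>"] that J n by auto
        then show "x \<in> (\<Union>n. Pi\<^sub>E J (\<lambda>_. {..real n}))" using x by (auto simp: PiE_iff)
      qed (auto simp: PiE_iff)
      show "emeasure ?P (Pi\<^sub>E J (\<lambda>_. {..real n})) \<noteq> \<infinity>" for n
        using em[of P X "\<lambda>_. {..real n}" "\<lambda>_. real n", OF P X] by simp
    qed
  qed
qed

abbreviation exceedance :: "'a measure \<Rightarrow> ('t \<Rightarrow> 'a \<Rightarrow> real) \<Rightarrow> 't set \<Rightarrow> ('t \<Rightarrow> real) \<Rightarrow> 'a set" where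
  "exceedance M f J a \<equiv> {w \<in> space M. \<exists>t\<in>J. a t < f t w}"

text \<open>The finite-dimensional distributions of the suprema \<open>I(f t)\<close> over a Poisson process with intensity
  \<open>M\<close>, expressed by the probability that no point exceeds given levels.\<close>
definition sup_law :: "'p measure \<Rightarrow> ('t \<Rightarrow> 'p \<Rightarrow> real) \<Rightarrow> 'a measure \<Rightarrow> ('t \<Rightarrow> 'a \<Rightarrow> real) \<Rightarrow> bool" where
  "sup_law P X M f \<longleftrightarrow>
     (\<forall>t. X t \<in> borel_measurable P) \<and> (\<forall>t. AE \<omega> in P. 0 \<le> X t \<omega>) \<and>
     (\<forall>J a. finite J \<longrightarrow> (\<forall>t\<in>J. 0 < a t) \<longrightarrow>
       measure P {\<omega> \<in> space P. \<forall>t\<in>J. X t \<omega> \<le> a t} =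
       exp (- measure M (exceedance M f J a)))"

lemma sup_lawD:
  assumes "sup_law P X M f" "finite J" "\<And>t. t \<in> J \<Longrightarrow> 0 < a t"
  shows "measure P {\<omega> \<in> space P. \<forall>t\<in>J. X t \<omega> \<le> a t} =
       exp (- measure M (exceedance M f J a))"
  using assms by (simp add: sup_law_def)

lemma sup_law_fdd_eq:
  assumes "prob_space P" "prob_space Q" "sup_law P X M f" "sup_law Q Y M f"
  shows "fdd_eq P X Q Y"
  using assms by (intro fdd_eqI) (auto simp: sup_law_def)

lemma sup_law_stationary:
  fixes X :: "'t :: ab_group_add \<Rightarrow> 'p \<Rightarrow> real"
  assumes P: "prob_space P" and X: "sup_law P X M f"
    and shift: "\<And>s J a. finite J \<Longrightarrow>
      measure M {w \<in> space M. \<exists>t\<in>J. a t < f (t + s) w} = measure M (exceedance M f J a)"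
  shows "stationary_process P X"
  unfolding stationary_process_def
proof (intro allI fdd_eqI P)
  fix s and J :: "'t set" and a :: "'t \<Rightarrow> real" assume J: "finite J" and a: "\<And>t. t \<in> J \<Longrightarrow> 0 < a t"
  have "measure P {\<omega> \<in> space P. \<forall>t\<in>J. X (t + s) \<omega> \<le> a t} =
      measure P {\<omega> \<in> space P. \<forall>t\<in>(\<lambda>t. t + s) ` J. X t \<omega> \<le> a (t - s)}"
    by (intro arg_cong[where f="measure P"]) auto
  also have "\<dots> = exp (- measure M {w \<in> space M. \<exists>t\<in>(\<lambda>t. t + s) ` J. a (t - s) < f t w})"
    using J a by (intro sup_lawD[OF X]) auto
  also have "{w \<in> space M. \<exists>t\<in>(\<lambda>t. t + s) ` J. a (t - s) < f t w} = {w \<in> space M. \<exists>t\<in>J. a t < f (t + s) w}"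
    by auto
  also have "exp (- measure M \<dots>) = measure P {\<omega> \<in> space P. \<forall>t\<in>J. X t \<omega> \<le> a t}"
    using X J a by (simp add: sup_law_def shift)
  finally show "measure P {\<omega> \<in> space P. \<forall>t\<in>J. X (t + s) \<omega> \<le> a t} =
      measure P {\<omega> \<in> space P. \<forall>t\<in>J. X t \<omega> \<le> a t}" .
qed (use X in \<open>auto simp: sup_law_def\<close>)

text \<open>The common form of the suprema in the spectral representation and of the maximum over the
  lines.\<close>
definition sup_over :: "('p \<Rightarrow> nat set) \<Rightarrow> (nat \<Rightarrow> 'p \<Rightarrow> real) \<Rightarrow> 'p \<Rightarrow> real" where
  "sup_over K g \<omega> = (if K \<omega> = {} then 0 else (SUP i\<in>K \<omega>. g i \<omega>))"

text \<open>The supremum of an unbounded set of reals is a default value that does not depend on the set.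
  Hence suprema of countably many random variables are measurable even where they are
  unbounded.\<close>
lemma Sup_unbounded_real:
  fixes S :: "real set"
  assumes "\<not> bdd_above S"
  shows "Sup S = (LEAST z. False)"
proof -
  have "(\<forall>x\<in>S. x \<le> z) = False" for z using assms by (auto simp: bdd_above_def)
  then show ?thesis unfolding Sup_real_def by (simp only:)
qed

lemma bdd_above_image_iff: "bdd_above (g ` K) \<longleftrightarrow> (\<exists>n::nat. \<forall>i\<in>K. g i \<le> (real n :: real))"
proof
  assume "bdd_above (g ` K)"
  then obtain b where b: "\<And>i. i \<in> K \<Longrightarrow> g i \<le> b" by (auto simp: bdd_above_def)
  obtain n :: nat where "b \<le> real n" using real_arch_simple by blast
  with b show "\<exists>n::nat. \<forall>i\<in>K. g i \<le> real n" by (auto intro: order_trans)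
qed (auto simp: bdd_above_def)

lemma borel_measurable_sup_over:
  assumes meas: "\<And>i a. {\<omega> \<in> space P. i \<in> K \<omega> \<and> a < g i \<omega>} \<in> sets P"
  shows "sup_over K g \<in> borel_measurable P"
  unfolding borel_measurable_iff_le
proof
  fix b
  define c where "c = (LEAST z::real. False)"
  have [measurable]: "Measurable.pred P (\<lambda>\<omega>. i \<in> K \<omega> \<and> a < g i \<omega>)" for i a
    using meas[of i a] by (simp add: pred_def)
  have K: "i \<in> K \<omega> \<longleftrightarrow> (\<exists>n::nat. i \<in> K \<omega> \<and> - real n < g i \<omega>)" for i \<omega>
  proof -
    obtain n :: nat where "- g i \<omega> < real n" using reals_Archimedean2 by blast
    then have "- real n < g i \<omega>" by linarith
    then show ?thesis by blast
  qed
  have [measurable]: "Measurable.pred P (\<lambda>\<omega>. i \<in> K \<omega>)" for i by (subst K) measurable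
  have "sup_over K g \<omega> \<le> b \<longleftrightarrow>
      (if \<forall>i. \<not> i \<in> K \<omega> then 0 \<le> b
       else if \<exists>n::nat. \<forall>i. \<not> (i \<in> K \<omega> \<and> real n < g i \<omega>) then \<forall>i. \<not> (i \<in> K \<omega> \<and> b < g i \<omega>)
       else c \<le> b)" for \<omega>
  proof -
    have *: "(\<exists>n::nat. \<forall>i. \<not> (i \<in> K \<omega> \<and> real n < g i \<omega>)) \<longleftrightarrow> bdd_above ((\<lambda>i. g i \<omega>) ` K \<omega>)"
      unfolding bdd_above_image_iff by (auto simp: not_less)
    show ?thesis
      unfolding * sup_over_def c_def
      by (auto simp: Sup_unbounded_real cSUP_le_iff not_less)
  qed
  then show "{\<omega> \<in> space P. sup_over K g \<omega> \<le> b} \<in> sets P"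
    by (simp only:) measurable
qed

lemma sup_over_le_iff:
  assumes "bdd_above ((\<lambda>i. g i \<omega>) ` K \<omega>)" "0 \<le> a"
  shows "sup_over K g \<omega> \<le> a \<longleftrightarrow> (\<forall>i\<in>K \<omega>. g i \<omega> \<le> a)"
  using assms by (auto simp: sup_over_def cSUP_le_iff)

lemma L_vee_union:
  assumes f: "\<And>t. t \<in> J \<Longrightarrow> f t \<in> L_vee M" and J: "finite J" and a: "\<And>t. t \<in> J \<Longrightarrow> 0 < a t"
  shows "exceedance M f J a \<in> sets M"
    "emeasure M (exceedance M f J a) \<noteq> \<infinity>"
proof -
  have m: "{w \<in> space M. a t < f t w} \<in> sets M" "emeasure M {w \<in> space M. a t < f t w} < \<infinity>" if "t \<in> J" for t
  proof -
    have "f t \<in> borel_measurable M" using f[OF that] by (simp add: L_vee_def)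
    then show "{w \<in> space M. a t < f t w} \<in> sets M" by measurable
    show "emeasure M {w \<in> space M. a t < f t w} < \<infinity>" using f[OF that] a[OF that] by (simp add: L_vee_def)
  qed
  have eq: "exceedance M f J a = (\<Union>t\<in>J. {w \<in> space M. a t < f t w})" by auto
  show "exceedance M f J a \<in> sets M" unfolding eq using J m by auto
  have "emeasure M (\<Union>t\<in>J. {w \<in> space M. a t < f t w}) \<le> (\<Sum>t\<in>J. emeasure M {w \<in> space M. a t < f t w})"
    using J m by (intro emeasure_subadditive_finite) auto
  also have "\<dots> < \<infinity>" using m J by (simp add: less_top)
  finally show "emeasure M (exceedance M f J a) \<noteq> \<infinity>" unfolding eq by simp
qed

lemma L_vee_tail:
  assumes f: "f \<in> L_vee M"
  shows "(\<lambda>n. measure M {w \<in> space M. real (Suc n) < f w}) \<longlonglongrightarrow> 0"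
proof -
  have [measurable]: "f \<in> borel_measurable M" using f by (simp add: L_vee_def)
  have "(\<lambda>n. measure M {w \<in> space M. real (Suc n) < f w}) \<longlonglongrightarrow> measure M (\<Inter>n. {w \<in> space M. real (Suc n) < f w})"
  proof (rule Lim_measure_decseq)
    show "range (\<lambda>n. {w \<in> space M. real (Suc n) < f w}) \<subseteq> sets M" by auto
    show "decseq (\<lambda>n. {w \<in> space M. real (Suc n) < f w})" by (intro monotoneI) auto
    show "emeasure M {w \<in> space M. real (Suc n) < f w} \<noteq> \<infinity>" for n
      using f unfolding L_vee_def by (auto simp: less_top)
  qed
  moreover have "(\<Inter>n. {w \<in> space M. real (Suc n) < f w}) = {}"
  proof -
    have "\<exists>n. \<not> real (Suc n) < f w" for w
    proof -
      obtain n :: nat where "f w \<le> real n" using real_arch_simple by blast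
      then have "\<not> real (Suc n) < f w" by simp
      then show ?thesis by blast
    qed
    then show ?thesis by blast
  qed
  ultimately show ?thesis by simp
qed

text \<open>It suffices to know the probabilities that no term exceeds given positive levels. As the
  level for a single \<open>t\<close> tends to infinity, they tend to \<open>1\<close>; so the supremum is almost surely one
  of a bounded set.\<close>
lemma sup_over_sup_law:
  fixes g :: "'t \<Rightarrow> nat \<Rightarrow> 'p \<Rightarrow> real"
  assumes P: "prob_space P"
    and meas: "\<And>t i a. {\<omega> \<in> space P. i \<in> K \<omega> \<and> a < g t i \<omega>} \<in> sets P"
    and nonneg: "\<And>t. AE \<omega> in P. \<forall>i\<in>K \<omega>. 0 \<le> g t i \<omega>"
    and f: "\<And>t. f t \<in> L_vee M"
    and avoid: "\<And>J a. finite J \<Longrightarrow> (\<And>t. t \<in> J \<Longrightarrow> 0 < a t) \<Longrightarrow>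
      measure P {\<omega> \<in> space P. \<forall>t\<in>J. \<forall>i\<in>K \<omega>. g t i \<omega> \<le> a t} =
      exp (- measure M (exceedance M f J a))"
  shows "sup_law P (\<lambda>t. sup_over K (g t)) M f"
proof -
  interpret prob_space P by fact
  have X [measurable]: "sup_over K (g t) \<in> borel_measurable P" for t
    by (rule borel_measurable_sup_over) (rule meas)
  have [measurable]: "Measurable.pred P (\<lambda>\<omega>. i \<in> K \<omega> \<and> a < g t i \<omega>)" for i a t
    using meas[of i a t] by (simp add: pred_def)
  have ball: "(\<forall>i\<in>K \<omega>. g t i \<omega> \<le> a) \<longleftrightarrow> (\<forall>i. \<not> (i \<in> K \<omega> \<and> a < g t i \<omega>))" for t a \<omega>
    by (auto simp: not_less)
  have [measurable]: "Measurable.pred P (\<lambda>\<omega>. \<forall>i\<in>K \<omega>. g t i \<omega> \<le> a)" for t a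
    unfolding ball by measurable
  have bdd: "AE \<omega> in P. bdd_above ((\<lambda>i. g t i \<omega>) ` K \<omega>)" for t
  proof -
    let ?B = "{\<omega> \<in> space P. \<exists>n::nat. \<forall>i\<in>K \<omega>. g t i \<omega> \<le> real n}"
    have B: "?B \<in> sets P" by measurable
    have "1 \<le> prob ?B"
    proof (rule LIMSEQ_le_const2)
      have "(\<lambda>n. exp (- measure M {w \<in> space M. real (Suc n) < f t w})) \<longlonglongrightarrow> exp (- 0)"
        by (intro tendsto_exp tendsto_minus L_vee_tail f)
      then show "(\<lambda>n. exp (- measure M {w \<in> space M. real (Suc n) < f t w})) \<longlonglongrightarrow> 1" by simp
      have "exp (- measure M {w \<in> space M. real (Suc n) < f t w}) \<le> prob ?B" for n
      proof -
        have "exp (- measure M {w \<in> space M. real (Suc n) < f t w}) =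
            prob {\<omega> \<in> space P. \<forall>i\<in>K \<omega>. g t i \<omega> \<le> real (Suc n)}"
          using avoid[of "{t}" "\<lambda>_. real (Suc n)"] by simp
        also have "\<dots> \<le> prob ?B" using B by (intro finite_measure_mono) blast+
        finally show ?thesis .
      qed
      then show "\<exists>N. \<forall>n\<ge>N. exp (- measure M {w \<in> space M. real (Suc n) < f t w}) \<le> prob ?B" by blast
    qed
    then have "prob ?B = 1" using prob_le_1[of ?B] by linarith
    then have "AE \<omega> in P. \<omega> \<in> ?B" using B by (subst (asm) prob_eq_1) auto
    then show ?thesis by eventually_elim (auto simp: bdd_above_image_iff)
  qed
  have pos: "AE \<omega> in P. 0 \<le> sup_over K (g t) \<omega>" for t
    using bdd[of t] nonneg[of t]
  proof eventually_elim
    case (elim \<omega>)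
    show ?case
    proof (cases "K \<omega> = {}")
      case False
      then obtain i where "i \<in> K \<omega>" by blast
      then show ?thesis using elim by (auto simp: sup_over_def intro!: cSUP_upper2)
    qed (simp add: sup_over_def)
  qed
  show ?thesis
    unfolding sup_law_def
  proof (intro conjI allI impI X pos)
    fix J :: "'t set" and a :: "'t \<Rightarrow> real" assume J: "finite J" and a: "\<forall>t\<in>J. 0 < a t"
    have "AE \<omega> in P. \<forall>t\<in>J. bdd_above ((\<lambda>i. g t i \<omega>) ` K \<omega>)"
      using J bdd by (simp add: AE_finite_all)
    then have "AE \<omega> in P. \<omega> \<in> {\<omega> \<in> space P. \<forall>t\<in>J. sup_over K (g t) \<omega> \<le> a t} \<longleftrightarrow>
        \<omega> \<in> {\<omega> \<in> space P. \<forall>t\<in>J. \<forall>i\<in>K \<omega>. g t i \<omega> \<le> a t}"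
    proof eventually_elim
      case (elim \<omega>)
      have "sup_over K (g t) \<omega> \<le> a t \<longleftrightarrow> (\<forall>i\<in>K \<omega>. g t i \<omega> \<le> a t)" if "t \<in> J" for t
        using elim a that by (intro sup_over_le_iff) (auto simp: less_imp_le)
      then show ?case by auto
    qed
    then have "measure P {\<omega> \<in> space P. \<forall>t\<in>J. sup_over K (g t) \<omega> \<le> a t} =
        measure P {\<omega> \<in> space P. \<forall>t\<in>J. \<forall>i\<in>K \<omega>. g t i \<omega> \<le> a t}"
      using J by (intro finite_measure_eq_AE) measurable
    also have "\<dots> = exp (- measure M (exceedance M f J a))"
      using J a by (intro avoid) auto
    finally show "measure P {\<omega> \<in> space P. \<forall>t\<in>J. sup_over K (g t) \<omega> \<le> a t} =
        exp (- measure M (exceedance M f J a))" .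
  qed
qed

lemma ppp_points_space:
  assumes ppp: "poisson_point_process P M K U" and "\<omega> \<in> space P" "i \<in> K \<omega>"
  shows "U i \<omega> \<in> space M"
proof -
  have "U i \<in> restrict_space P {\<omega>. i \<in> K \<omega>} \<rightarrow>\<^sub>M M" using ppp by (simp add: poisson_point_process_def)
  then show ?thesis using assms(2,3) by (auto simp: space_restrict_space dest!: measurable_space[of _ _ _ \<omega>])
qed

lemma ppp_void_probability:
  assumes ppp: "poisson_point_process P M K U" and B: "B \<in> sets M" "emeasure M B \<noteq> \<infinity>"
  shows "measure P {\<omega> \<in> space P. \<forall>i\<in>K \<omega>. U i \<omega> \<notin> B} = exp (- measure M B)"
proof -
  have "\<forall>n::nat. measure P {\<omega> \<in> space P. point_count K U B \<omega> = of_nat n} =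
               measure M B ^ n / fact n * exp (- measure M B)"
    using ppp B unfolding poisson_point_process_def by meson
  from spec[OF this, of 0]
  have "measure P {\<omega> \<in> space P. point_count K U B \<omega> = of_nat 0} = exp (- measure M B)"
    by simp
  moreover have "point_count K U B \<omega> = of_nat 0 \<longleftrightarrow> (\<forall>i\<in>K \<omega>. U i \<omega> \<notin> B)" for \<omega>
    by (auto simp: point_count_def emeasure_count_space_eq_0)
  ultimately show ?thesis by simp
qed

lemma ppp_sup_law:
  fixes f :: "'t \<Rightarrow> 'a \<Rightarrow> real"
  assumes ppp: "poisson_point_process P M K U" and f: "\<And>t. f t \<in> L_vee M"
  shows "sup_law P (\<lambda>t. sup_points K U (f t)) M f"
proof -
  interpret prob_space P using ppp by (rule ppp_prob_space)
  have [measurable]: "f t \<in> borel_measurable M" for t using f[of t] by (simp add: L_vee_def)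
  have "sup_law P (\<lambda>t. sup_over K (\<lambda>i \<omega>. f t (U i \<omega>))) M f"
  proof (rule sup_over_sup_law[OF _ _ _ f])
    show "prob_space P" by (rule prob_space_axioms)
    show "{\<omega> \<in> space P. i \<in> K \<omega> \<and> a < f t (U i \<omega>)} \<in> sets P" for t i a
    proof -
      have "{w \<in> space M. a < f t w} \<in> sets M" by measurable
      from ppp_points_measurable[OF ppp this, of i] show ?thesis
        using ppp_points_space[OF ppp] by (auto intro: back_subst[where P="\<lambda>A. A \<in> sets P"])
    qed
    show "AE \<omega> in P. \<forall>i\<in>K \<omega>. 0 \<le> f t (U i \<omega>)" for t
    proof -
      let ?B = "{w \<in> space M. f t w < 0}"
      have B: "?B \<in> sets M" by measurable
      have "AE w in M. \<not> f t w < 0" using f[of t] by (auto simp: L_vee_def not_less)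
      then have B0: "emeasure M ?B = 0" using B by (simp add: AE_iff_measurable[OF B])
      have "{\<omega> \<in> space P. \<forall>i\<in>K \<omega>. U i \<omega> \<notin> ?B} \<in> sets P"
      proof -
        have "{\<omega> \<in> space P. \<forall>i\<in>K \<omega>. U i \<omega> \<notin> ?B} = space P - (\<Union>i. {\<omega> \<in> space P. i \<in> K \<omega> \<and> U i \<omega> \<in> ?B})"
          by auto
        then show ?thesis using ppp_points_measurable[OF ppp B] by auto
      qed
      moreover have "prob {\<omega> \<in> space P. \<forall>i\<in>K \<omega>. U i \<omega> \<notin> ?B} = 1"
        using ppp_void_probability[OF ppp B] B0 by (simp add: measure_def)
      ultimately have "AE \<omega> in P. \<omega> \<in> {\<omega> \<in> space P. \<forall>i\<in>K \<omega>. U i \<omega> \<notin> ?B}"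
        by (subst (asm) prob_eq_1) auto
      then show ?thesis
      proof eventually_elim
        case (elim \<omega>)
        then show ?case using ppp_points_space[OF ppp, of \<omega>] by (auto simp: not_less)
      qed
    qed
    fix J :: "'t set" and a :: "'t \<Rightarrow> real" assume J: "finite J" and a: "\<And>t. t \<in> J \<Longrightarrow> 0 < a t"
    let ?B = "exceedance M f J a"
    have "prob {\<omega> \<in> space P. \<forall>i\<in>K \<omega>. U i \<omega> \<notin> ?B} = exp (- measure M ?B)"
      using L_vee_union[of J f M a, OF f J a] by (intro ppp_void_probability[OF ppp]) auto
    moreover have "{\<omega> \<in> space P. \<forall>i\<in>K \<omega>. U i \<omega> \<notin> ?B} = {\<omega> \<in> space P. \<forall>t\<in>J. \<forall>i\<in>K \<omega>. f t (U i \<omega>) \<le> a t}"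
      using ppp_points_space[OF ppp] by (auto simp: not_less)
    ultimately show "prob {\<omega> \<in> space P. \<forall>t\<in>J. \<forall>i\<in>K \<omega>. f t (U i \<omega>) \<le> a t} = exp (- measure M ?B)"
      by simp
  qed
  then show ?thesis by (simp add: sup_over_def[abs_def] sup_points_def[abs_def])
qed

text \<open>If \<open>Y\<close> is of type \<open>(M / n, f)\<close>, then the maximum of \<open>n\<close> independent copies of \<open>Y\<close> is of type
  \<open>(M, f)\<close>. The copies are the coordinates of an infinite product of the law of \<open>Y\<close>.\<close>
lemma sup_law_max_id:
  fixes X :: "'t \<Rightarrow> 'p \<Rightarrow> real"
  assumes P: "prob_space P" and X: "sup_law P X M f"
    and roots: "\<And>n::nat. 1 \<le> n \<Longrightarrow> \<exists>(Q :: 'q measure) Y. prob_space Q \<and>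
      sup_law Q Y (scale_measure (ennreal (1 / real n)) M) f"
  shows "max_id P X"
  unfolding max_id_def
proof (intro allI impI)
  fix n :: nat assume n: "1 \<le> n"
  obtain Q :: "'q measure" and Y where Q: "prob_space Q"
    and Y: "sup_law Q Y (scale_measure (ennreal (1 / real n)) M) f"
    using roots[OF n] by blast
  interpret Q: prob_space Q by fact
  let ?B = "Pi\<^sub>M (UNIV :: 't set) (\<lambda>_. borel :: real measure)"
  have Ym [measurable]: "Y t \<in> borel_measurable Q" for t using Y by (simp add: sup_law_def)
  define N where "N = distr Q ?B (\<lambda>\<omega> t. Y t \<omega>)"
  have YB: "(\<lambda>\<omega> t. Y t \<omega>) \<in> Q \<rightarrow>\<^sub>M ?B" by (intro measurable_PiM_single') (auto simp: space_PiM)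
  have N: "prob_space N" unfolding N_def using YB by (rule Q.prob_space_distr)
  interpret N: prob_space N by fact
  have sets_N [simp, measurable_cong]: "sets N = sets ?B" by (simp add: N_def)
  define R where "R = Pi\<^sub>M (UNIV :: nat set) (\<lambda>_. N)"
  have R: "prob_space R" unfolding R_def by (intro prob_space_PiM) (rule N)
  interpret R: prob_space R by fact
  interpret PR: product_prob_space "\<lambda>_. N" "UNIV :: nat set" ..
  have coord [measurable]: "(\<lambda>\<omega>. \<omega> k) \<in> R \<rightarrow>\<^sub>M ?B" for k
  proof -
    have "(\<lambda>\<omega>. \<omega> k) \<in> R \<rightarrow>\<^sub>M N" unfolding R_def by measurable
    then show ?thesis by (simp cong: measurable_cong_sets)
  qed
  have coord_law: "distr R ?B (\<lambda>\<omega>. \<omega> k) = N" for k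
  proof -
    have "distr R ?B (\<lambda>\<omega>. \<omega> k) = distr R N (\<lambda>\<omega>. \<omega> k)" by (intro distr_cong) auto
    also have "\<dots> = N" unfolding R_def by (rule PR.PiM_component) simp
    finally show ?thesis .
  qed
  have eval [measurable]: "(\<lambda>\<omega>. \<omega> k t) \<in> borel_measurable R" for k t
    using measurable_compose[OF coord measurable_component_singleton[of t UNIV "\<lambda>_. borel"]] by simp
  have nonneg: "AE \<omega> in R. 0 \<le> \<omega> k t" for k t
  proof -
    have "AE x in N. 0 \<le> x t"
      unfolding N_def using Y by (subst AE_distr_iff[OF YB]) (auto simp: sup_law_def)
    then have "AE x in distr R ?B (\<lambda>\<omega>. \<omega> k). 0 \<le> x t" unfolding coord_law .
    then show ?thesis by (rule AE_distrD[OF coord])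
  qed
  show "\<exists>(Q :: (nat \<Rightarrow> 't \<Rightarrow> real) measure) Y. prob_space Q \<and>
      prob_space.indep_vars Q (\<lambda>_. ?B) (\<lambda>k \<omega> t. Y k t \<omega>) {..<n} \<and>
      (\<forall>k<n. \<forall>l<n. fdd_eq Q (Y k) Q (Y l)) \<and>
      fdd_eq P X Q (\<lambda>t \<omega>. Max ((\<lambda>k. Y k t \<omega>) ` {..<n}))"
  proof (intro exI[of _ R] exI[of _ "\<lambda>k t \<omega>. \<omega> k t"] conjI allI impI R)
    show "R.indep_vars (\<lambda>_. ?B) (\<lambda>k \<omega> t. \<omega> k t) {..<n}"
    proof (rule R.indep_vars_iff_distr_eq_PiM'[THEN iffD2])
      have sets_eq: "sets (Pi\<^sub>M {..<n} (\<lambda>_. ?B)) = sets (Pi\<^sub>M {..<n} (\<lambda>_. N))"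
        by (intro sets_PiM_cong) auto
      have "distr R (Pi\<^sub>M {..<n} (\<lambda>_. ?B)) (\<lambda>\<omega>. \<lambda>k\<in>{..<n}. \<lambda>t. \<omega> k t) =
          distr R (Pi\<^sub>M {..<n} (\<lambda>_. N)) (\<lambda>\<omega>. restrict \<omega> {..<n})"
        using sets_eq by (intro distr_cong) auto
      also have "\<dots> = Pi\<^sub>M {..<n} (\<lambda>_. N)"
        unfolding R_def by (intro PR.distr_PiM_restrict_finite) auto
      finally show "distr R (Pi\<^sub>M {..<n} (\<lambda>_. ?B)) (\<lambda>\<omega>. \<lambda>k\<in>{..<n}. \<lambda>t. \<omega> k t) =
          (\<Pi>\<^sub>M k\<in>{..<n}. distr R ?B (\<lambda>\<omega> t. \<omega> k t))"
        by (simp add: coord_law)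
    qed (use n in \<open>auto simp: lessThan_empty_iff\<close>)
    show "fdd_eq R (\<lambda>t \<omega>. \<omega> k t) R (\<lambda>t \<omega>. \<omega> l t)" for k l
      unfolding fdd_eq_def
    proof (intro conjI allI impI eval)
      fix J :: "'t set" assume "finite J"
      have "distr R (Pi\<^sub>M J (\<lambda>_. borel)) (\<lambda>\<omega>. \<lambda>t\<in>J. \<omega> k t) =
          distr (distr R ?B (\<lambda>\<omega>. \<omega> k)) (Pi\<^sub>M J (\<lambda>_. borel)) (\<lambda>x. restrict x J)" for k
        by (subst distr_distr) (auto simp: comp_def intro!: measurable_restrict_subset)
      then show "distr R (Pi\<^sub>M J (\<lambda>_. borel)) (\<lambda>\<omega>. \<lambda>t\<in>J. \<omega> k t) =
          distr R (Pi\<^sub>M J (\<lambda>_. borel)) (\<lambda>\<omega>. \<lambda>t\<in>J. \<omega> l t)"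
        by (simp add: coord_law)
    qed
    show "fdd_eq P X R (\<lambda>t \<omega>. Max ((\<lambda>k. \<omega> k t) ` {..<n}))"
    proof (rule fdd_eqI[OF P R])
      show "X t \<in> borel_measurable P" "AE \<omega> in P. 0 \<le> X t \<omega>" for t
        using X by (auto simp: sup_law_def)
      show "(\<lambda>\<omega>. Max ((\<lambda>k. \<omega> k t) ` {..<n})) \<in> borel_measurable R" for t by measurable
      show "AE \<omega> in R. 0 \<le> Max ((\<lambda>k. \<omega> k t) ` {..<n})" for t
        using nonneg[of 0 t]
      proof eventually_elim
        case (elim \<omega>)
        have "\<omega> 0 t \<le> Max ((\<lambda>k. \<omega> k t) ` {..<n})" using n by (intro Max_ge) auto
        with elim show ?case by simp
      qed
      fix J :: "'t set" and a :: "'t \<Rightarrow> real" assume J: "finite J" and a: "\<And>t. t \<in> J \<Longrightarrow> 0 < a t"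
      let ?m = "measure M (exceedance M f J a)"
      define A where "A = {x \<in> space ?B. \<forall>t\<in>J. x t \<le> a t}"
      have A [measurable]: "A \<in> sets ?B" unfolding A_def using J by measurable
      have NA: "emeasure N A = ennreal (exp (- (?m / real n)))"
      proof -
        have "emeasure N A = emeasure Q {\<omega> \<in> space Q. \<forall>t\<in>J. Y t \<omega> \<le> a t}"
          unfolding N_def using YB A by (subst emeasure_distr)
            (auto simp: A_def space_PiM intro!: arg_cong[where f="emeasure Q"])
        also have "\<dots> = ennreal (exp (- measure (scale_measure (ennreal (1 / real n)) M)
            {w \<in> space (scale_measure (ennreal (1 / real n)) M). \<exists>t\<in>J. a t < f t w}))"
          using sup_lawD[OF Y J a] by (simp add: Q.emeasure_eq_measure)
        finally show ?thesis by (simp add: space_scale_measure measure_scale_measure measure_def enn2real_mult)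
      qed
      have "{\<omega> \<in> space R. \<forall>t\<in>J. Max ((\<lambda>k. \<omega> k t) ` {..<n}) \<le> a t} = {\<omega> \<in> space R. \<forall>k<n. \<omega> k \<in> A}"
        using n by (subst Max_le_iff) (auto simp: A_def space_PiM lessThan_empty_iff)
      moreover have "emeasure R {\<omega> \<in> space R. \<forall>k<n. \<omega> k \<in> A} = emeasure N A ^ n"
      proof -
        have "emeasure R {\<omega> \<in> space R. \<forall>k<n. \<omega> k \<in> A} = (\<integral>\<^sup>+\<omega>. indicator {\<omega> \<in> space R. \<forall>k<n. \<omega> k \<in> A} \<omega> \<partial>R)"
          by (subst nn_integral_indicator) auto
        also have "\<dots> = (\<integral>\<^sup>+\<omega>. (\<Prod>k<n. indicator A (\<omega> k)) \<partial>R)"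
        proof (intro nn_integral_cong)
          fix \<omega> assume "\<omega> \<in> space R"
          then show "indicator {\<omega> \<in> space R. \<forall>k<n. \<omega> k \<in> A} \<omega> = (\<Prod>k<n. indicator A (\<omega> k) :: ennreal)"
            by (cases "\<forall>k<n. \<omega> k \<in> A") (auto simp: prod_zero_iff indicator_def)
        qed
        also have "\<dots> = emeasure N A ^ n"
        proof -
          have AN: "A \<in> sets N" using A by simp
          show ?thesis
            unfolding R_def using AN
            by (subst nn_integral_iid_prod[OF N borel_measurable_indicator[OF AN]]) simp
        qed
        finally show ?thesis .
      qed
      ultimately have "emeasure R {\<omega> \<in> space R. \<forall>t\<in>J. Max ((\<lambda>k. \<omega> k t) ` {..<n}) \<le> a t} =
          ennreal (exp (- (?m / real n)) ^ n)"
        by (simp add: NA ennreal_power)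
      also have "exp (- (?m / real n)) ^ n = exp (- ?m)"
        using n by (simp flip: exp_of_nat_mult)
      finally show "measure P {\<omega> \<in> space P. \<forall>t\<in>J. X t \<omega> \<le> a t} =
          measure R {\<omega> \<in> space R. \<forall>t\<in>J. Max ((\<lambda>k. \<omega> k t) ` {..<n}) \<le> a t}"
        using sup_lawD[OF X J a] by (simp add: measure_def)
    qed
  qed
qed

section \<open>Replacing the profile process by one on a Polish space\<close>

abbreviation seq_borel :: "(nat \<Rightarrow> real) measure" where
  "seq_borel \<equiv> Pi\<^sub>M UNIV (\<lambda>_. borel)"

definition factors_through_seq ::
  "'a measure \<Rightarrow> 'b measure \<Rightarrow> ('a \<times> 'b \<Rightarrow> ennreal) \<Rightarrow> bool" where
  "factors_through_seq M Q u \<longleftrightarrow>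
     (\<exists>g\<in>Q \<rightarrow>\<^sub>M seq_borel. \<exists>v\<in>borel_measurable (M \<Otimes>\<^sub>M seq_borel).
        \<forall>x\<in>space M. \<forall>y\<in>space Q. u (x, y) = v (x, g y))"

text \<open>Countably many sequences \<open>g n\<close> are interleaved into a single one.\<close>
lemma factors_through_seq_combine:
  fixes u :: "nat \<Rightarrow> 'a \<times> 'b \<Rightarrow> ennreal"
  assumes "\<And>n. factors_through_seq M Q (u n)"
  shows "\<exists>g\<in>Q \<rightarrow>\<^sub>M seq_borel. \<exists>v. \<forall>n. v n \<in> borel_measurable (M \<Otimes>\<^sub>M seq_borel) \<and>
    (\<forall>x\<in>space M. \<forall>y\<in>space Q. u n (x, y) = v n (x, g y))"
proof -
  obtain g v where g [measurable]: "\<And>n. g n \<in> Q \<rightarrow>\<^sub>M seq_borel"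
    and v [measurable]: "\<And>n. v n \<in> borel_measurable (M \<Otimes>\<^sub>M seq_borel)"
    and eq: "\<And>n x y. x \<in> space M \<Longrightarrow> y \<in> space Q \<Longrightarrow> u n (x, y) = v n (x, g n y)"
    using assms unfolding factors_through_seq_def by metis
  define G where "G y k = g (fst (prod_decode k)) y (snd (prod_decode k))" for y k
  define pr where "pr n z m = z (prod_encode (n, m))" for n m :: nat and z :: "nat \<Rightarrow> real"
  have G: "G \<in> Q \<rightarrow>\<^sub>M seq_borel"
  proof (rule measurable_PiM_single')
    show "(\<lambda>y. G y k) \<in> borel_measurable Q" for k
      unfolding G_def using measurable_compose[OF g measurable_component_singleton] by simp
  qed (auto simp: space_PiM)
  have [measurable]: "pr n \<in> seq_borel \<rightarrow>\<^sub>M seq_borel" for n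
    unfolding pr_def by (rule measurable_PiM_single') (auto simp: space_PiM)
  have "pr n (G y) = g n y" for n y by (auto simp: pr_def G_def)
  then have "u n (x, y) = v n (x, pr n (G y))" if "x \<in> space M" "y \<in> space Q" for n x y
    using eq[OF that] by simp
  moreover have "(\<lambda>(x, z). v n (x, pr n z)) \<in> borel_measurable (M \<Otimes>\<^sub>M seq_borel)" for n
    by measurable
  ultimately show ?thesis
    using G by (intro bexI[of _ G] exI[of _ "\<lambda>n (x, z). v n (x, pr n z)"]) auto
qed

lemma factors_through_seq_indicator:
  assumes A: "A \<in> sets (M \<Otimes>\<^sub>M Q)"
  shows "factors_through_seq M Q (indicator A)"
  using A unfolding sets_pair_measure
proof (induction rule: sigma_sets.induct)
  case (Basic A)
  then obtain a b where ab: "A = a \<times> b" and [measurable]: "a \<in> sets M" "b \<in> sets Q" by auto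
  \<comment> \<open>A constant sequence; only its coordinate \<open>0\<close> is used.\<close>
  define g where "g y k = (indicator b y :: real)" for y and k :: nat
  have g: "g \<in> Q \<rightarrow>\<^sub>M seq_borel"
    unfolding g_def by (rule measurable_PiM_single') (auto simp: space_PiM)
  have v: "(\<lambda>(x, z). indicator a x * ennreal (z (0::nat))) \<in> borel_measurable (M \<Otimes>\<^sub>M seq_borel)"
    by measurable
  have "indicator A (x, y) = (case (x, g y) of (x, z) \<Rightarrow> indicator a x * ennreal (z (0::nat)))" for x y
    by (auto simp: ab g_def indicator_def)
  then show ?case
    unfolding factors_through_seq_def using g v by blast
next
  case Empty
  show ?case
    unfolding factors_through_seq_def
    by (rule bexI[of _ "\<lambda>y _. 0"], rule bexI[of _ "\<lambda>_. 0"]) (auto intro!: measurable_PiM_single' simp: space_PiM)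
next
  case (Compl A)
  then obtain g and v :: "_ \<Rightarrow> ennreal" where g: "g \<in> Q \<rightarrow>\<^sub>M seq_borel" and v [measurable]: "v \<in> borel_measurable (M \<Otimes>\<^sub>M seq_borel)"
    and eq: "\<And>x y. x \<in> space M \<Longrightarrow> y \<in> space Q \<Longrightarrow> indicator A (x, y) = v (x, g y)"
    unfolding factors_through_seq_def by blast
  have "indicator (space M \<times> space Q - A) (x, y) = 1 - v (x, g y)" if "x \<in> space M" "y \<in> space Q" for x y
    using that by (auto simp: eq[OF that, symmetric] indicator_def)
  then show ?case
    unfolding factors_through_seq_def using g
    by (intro bexI[of _ g] bexI[of _ "\<lambda>x. 1 - v x"]) auto
next
  case (Union A)
  obtain g and v :: "nat \<Rightarrow> _ \<Rightarrow> ennreal" where g: "g \<in> Q \<rightarrow>\<^sub>M seq_borel" and v [measurable]: "\<And>n. v n \<in> borel_measurable (M \<Otimes>\<^sub>M seq_borel)"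
    and eq: "\<And>n x y. x \<in> space M \<Longrightarrow> y \<in> space Q \<Longrightarrow> indicator (A n) (x, y) = v n (x, g y)"
    using factors_through_seq_combine[of M Q "\<lambda>n. indicator (A n)", OF Union.IH] by blast
  have "indicator (\<Union>n. A n) (x, y) = (SUP n. v n (x, g y))" if "x \<in> space M" "y \<in> space Q" for x y
    unfolding eq[OF that, symmetric]
  proof (rule antisym)
    show "indicator (\<Union>n. A n) (x, y) \<le> (SUP n. indicator (A n) (x, y) :: ennreal)"
    proof (cases "(x, y) \<in> (\<Union>n. A n)")
      case True
      then obtain n where "(x, y) \<in> A n" by blast
      then show ?thesis using True by (intro SUP_upper2[of n]) auto
    qed simp
    show "(SUP n. indicator (A n) (x, y) :: ennreal) \<le> indicator (\<Union>n. A n) (x, y)"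
      by (intro SUP_least) (auto simp: indicator_def)
  qed
  then show ?case
    unfolding factors_through_seq_def using g
    by (intro bexI[of _ g] bexI[of _ "\<lambda>x. SUP n. v n x"]) auto
qed

text \<open>A jointly measurable function of \<open>x\<close> and \<open>y\<close> involves only countably many measurable rectangles,
  hence depends on \<open>y\<close> only through a sequence of indicators. The proof is an induction over
  measurable functions, as each construction step uses at most countably many earlier ones.\<close>
lemma factors_through_seq:
  assumes "u \<in> borel_measurable (M \<Otimes>\<^sub>M Q)"
  shows "factors_through_seq M Q u"
  using assms
proof (induction u rule: borel_measurable_induct)
  case (cong f g)
  then show ?case by (auto simp: factors_through_seq_def space_pair_measure)
next
  case (set A)
  then show ?case by (rule factors_through_seq_indicator)
next
  case (mult u c)
  then obtain g and v :: "_ \<Rightarrow> ennreal" where g: "g \<in> Q \<rightarrow>\<^sub>M seq_borel" and v [measurable]: "v \<in> borel_measurable (M \<Otimes>\<^sub>M seq_borel)"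
    and eq: "\<And>x y. x \<in> space M \<Longrightarrow> y \<in> space Q \<Longrightarrow> u (x, y) = v (x, g y)"
    unfolding factors_through_seq_def by blast
  then show ?case
    unfolding factors_through_seq_def by (intro bexI[of _ g] bexI[of _ "\<lambda>x. c * v x"]) auto
next
  case (add u w)
  have uw: "factors_through_seq M Q (if n = 0 then u else w)" for n :: nat using add by simp
  obtain g and v :: "nat \<Rightarrow> _ \<Rightarrow> ennreal" where g: "g \<in> Q \<rightarrow>\<^sub>M seq_borel" and v [measurable]: "\<And>n. v n \<in> borel_measurable (M \<Otimes>\<^sub>M seq_borel)"
    and eq: "\<And>n x y. x \<in> space M \<Longrightarrow> y \<in> space Q \<Longrightarrow> (if n = 0 then u else w) (x, y) = v n (x, g y)"
    using factors_through_seq_combine[of M Q "\<lambda>n::nat. if n = 0 then u else w", OF uw] by blast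
  have "w (x, y) + u (x, y) = v 1 (x, g y) + v 0 (x, g y)" if "x \<in> space M" "y \<in> space Q" for x y
    using eq[OF that, of 0] eq[OF that, of 1] by simp
  then show ?case
    unfolding factors_through_seq_def using g
    by (intro bexI[of _ g] bexI[of _ "\<lambda>x. v 1 x + v 0 x"]) auto
next
  case (seq U)
  obtain g and v :: "nat \<Rightarrow> _ \<Rightarrow> ennreal" where g: "g \<in> Q \<rightarrow>\<^sub>M seq_borel" and v [measurable]: "\<And>n. v n \<in> borel_measurable (M \<Otimes>\<^sub>M seq_borel)"
    and eq: "\<And>n x y. x \<in> space M \<Longrightarrow> y \<in> space Q \<Longrightarrow> U n (x, y) = v n (x, g y)"
    using factors_through_seq_combine[of M Q U, OF seq.IH] by blast
  have "(SUP n. U n) (x, y) = (SUP n. v n (x, g y))" if "x \<in> space M" "y \<in> space Q" for x y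
    using eq[OF that] by (simp add: image_comp)
  then show ?case
    unfolding factors_through_seq_def using g
    by (intro bexI[of _ g] bexI[of _ "\<lambda>x. SUP n. v n x"]) auto
qed

lemma measurable_process_factorization:
  assumes F: "measurable_process Q F" and nonneg: "\<forall>t. \<forall>\<omega>\<in>space Q. 0 \<le> F t \<omega>"
  obtains g F' where "g \<in> Q \<rightarrow>\<^sub>M (borel :: (nat \<Rightarrow> real) measure)"
    "(\<lambda>(t, z). F' t z) \<in> borel_measurable (borel \<Otimes>\<^sub>M (borel :: (nat \<Rightarrow> real) measure))"
    "\<And>t z. 0 \<le> F' t z" "\<And>t \<omega>. \<omega> \<in> space Q \<Longrightarrow> F t \<omega> = (F' t (g \<omega>) :: real)"
proof -
  have B: "sets seq_borel = sets (borel :: (nat \<Rightarrow> real) measure)" by (rule sets_PiM_equal_borel)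
  have "(\<lambda>(t, \<omega>). F t \<omega>) \<in> borel_measurable (borel \<Otimes>\<^sub>M Q)"
    using F by (simp add: measurable_process_def)
  from measurable_compose[OF this measurable_ennreal]
  have "(\<lambda>x. ennreal (F (fst x) (snd x))) \<in> borel_measurable (borel \<Otimes>\<^sub>M Q)"
    by (simp add: split_beta')
  from factors_through_seq[OF this]
  obtain g and v :: "_ \<Rightarrow> ennreal" where g: "g \<in> Q \<rightarrow>\<^sub>M seq_borel"
    and v: "v \<in> borel_measurable (borel \<Otimes>\<^sub>M seq_borel)"
    and v_eq: "\<forall>x\<in>space borel. \<forall>y\<in>space Q. ennreal (F (fst (x, y)) (snd (x, y))) = v (x, g y)"
    unfolding factors_through_seq_def by blast
  have eq: "ennreal (F t \<omega>) = v (t, g \<omega>)" if "\<omega> \<in> space Q" for t \<omega>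
    using v_eq that by simp
  have v' [measurable]: "v \<in> borel_measurable (borel \<Otimes>\<^sub>M borel)"
    using v by (simp add: measurable_cong_sets[OF sets_pair_measure_cong[OF refl B] refl])
  show ?thesis
  proof (rule that[of g "\<lambda>t z. enn2real (v (t, z))"])
    show "g \<in> Q \<rightarrow>\<^sub>M borel" using g by (simp add: measurable_cong_sets[OF refl B])
    show "F t \<omega> = enn2real (v (t, g \<omega>))" if "\<omega> \<in> space Q" for t \<omega>
      using eq[OF that, of t, symmetric] nonneg that by simp
  qed auto
qed

section \<open>Transporting a Polish space to the real line\<close>

text \<open>Both sides have the cardinality of the continuum: a line with a profile is coded by a sequence
  of reals, hence by a sequence of sets of naturals, hence by one set of naturals.\<close>
lemma ex_bij_real_lines: "\<exists>b :: real \<Rightarrow> (real \<times> real) \<times> (nat \<Rightarrow> real). bij b"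
proof -
  obtain e :: "real \<Rightarrow> nat set" where e: "inj e"
    using eqpoll_sym[OF nat_sets_eqpoll_reals] by (auto simp: eqpoll_def bij_betw_def)
  obtain d :: "nat set \<Rightarrow> real" where d: "inj d"
    using nat_sets_eqpoll_reals by (auto simp: eqpoll_def bij_betw_def)
  define s :: "(real \<times> real) \<times> (nat \<Rightarrow> real) \<Rightarrow> nat \<Rightarrow> real"
    where "s x = (\<lambda>k. case k of 0 \<Rightarrow> fst (fst x) | Suc 0 \<Rightarrow> snd (fst x) | Suc (Suc n) \<Rightarrow> snd x n)" for x
  have s: "inj s"
  proof (rule injI)
    fix x y assume "s x = s y"
    then have eq: "s x k = s y k" for k by simp
    have "snd x n = snd y n" for n using eq[of "Suc (Suc n)"] by (simp add: s_def)
    moreover have "fst (fst x) = fst (fst y)" "snd (fst x) = snd (fst y)"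
      using eq[of 0] eq[of "Suc 0"] by (simp_all add: s_def)
    ultimately show "x = y" by (simp add: prod_eq_iff fun_eq_iff)
  qed
  define c :: "(nat \<Rightarrow> real) \<Rightarrow> nat set" where "c z = {prod_encode (k, m) |k m. m \<in> e (z k)}" for z
  have c_iff: "prod_encode (k, m) \<in> c z \<longleftrightarrow> m \<in> e (z k)" for k m z by (auto simp: c_def)
  have c: "inj c"
  proof (rule injI, rule ext)
    fix x y k assume "c x = c y"
    then have "e (x k) = e (y k)" using c_iff by blast
    then show "x k = y k" using e by (simp add: inj_eq)
  qed
  have "inj (d \<circ> (c \<circ> s))" using c d s by (intro inj_compose)
  then have "(UNIV :: ((real \<times> real) \<times> (nat \<Rightarrow> real)) set) \<lesssim> (UNIV :: real set)"
    unfolding lepoll_def by blast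
  moreover have "(UNIV :: real set) \<lesssim> (UNIV :: ((real \<times> real) \<times> (nat \<Rightarrow> real)) set)"
    unfolding lepoll_def by (intro exI[of _ "\<lambda>x. ((x, 0), \<lambda>_. 0)"]) (auto simp: inj_on_def)
  ultimately have "(UNIV :: real set) \<approx> (UNIV :: ((real \<times> real) \<times> (nat \<Rightarrow> real)) set)"
    by (rule lepoll_antisym[rotated])
  then show ?thesis by (auto simp: eqpoll_def)
qed

text \<open>The metric, the topology and the Borel sets of \<open>'a\<close> are all pulled back along \<open>b\<close>.\<close>
lemma sigma_finite_borel_space_vimage:
  fixes b :: "real \<Rightarrow> 'a :: {complete_space, second_countable_topology}"
  assumes b: "bij b" and sf: "sigma_finite_measure M"
    and sets: "sets M = sets (vimage_algebra UNIV b borel)"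
  shows "sigma_finite_borel_space M"
proof -
  define d where "d x y = dist (b x) (b y)" for x y
  have inj: "b x = b y \<longleftrightarrow> x = y" for x y using b by (auto simp: bij_def inj_eq)
  have surj: "\<exists>x. b x = y" for y using b by (metis bij_pointE)
  have space: "space M = UNIV" using sets_eq_imp_space_eq[OF sets] by simp
  interpret Metric_space "UNIV :: real set" d
    by unfold_locales (auto simp: d_def inj dist_commute dist_triangle)
  have open_iff: "openin mtopology (b -` W) \<longleftrightarrow> open W" for W
  proof
    assume *: "openin mtopology (b -` W)"
    show "open W"
      unfolding open_contains_ball
    proof
      fix y assume "y \<in> W"
      obtain x where x: "b x = y" using surj by blast
      with \<open>y \<in> W\<close> * obtain r where r: "r > 0" "mball x r \<subseteq> b -` W"
        unfolding openin_mtopology by blast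
      have "ball y r \<subseteq> W"
      proof
        fix v assume v: "v \<in> ball y r"
        obtain u where u: "b u = v" using surj by blast
        then have "u \<in> mball x r" using v x by (auto simp: d_def)
        then show "v \<in> W" using r u by auto
      qed
      with r show "\<exists>e>0. ball y e \<subseteq> W" by blast
    qed
  next
    assume W: "open W"
    show "openin mtopology (b -` W)"
      unfolding openin_mtopology
    proof (intro conjI allI impI)
      fix x assume "x \<in> b -` W"
      then obtain r where r: "r > 0" "ball (b x) r \<subseteq> W" using W by (auto simp: open_contains_ball)
      then have "mball x r \<subseteq> b -` W" by (auto simp: d_def subset_eq)
      with r show "\<exists>r>0. mball x r \<subseteq> b -` W" by blast
    qed simp
  qed
  have vim: "\<exists>W. V = b -` W" for V
    using b by (intro exI[of _ "b ` V"]) (auto simp: inj)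
  let ?S = "sigma UNIV {V. openin mtopology V}"
  have bS: "b \<in> borel_measurable ?S"
    by (rule borel_measurableI) (auto simp: open_iff)
  show ?thesis
    unfolding sigma_finite_borel_space_def
  proof (intro conjI sf exI[of _ UNIV] exI[of _ d] exI[of _ id])
    show "Metric_space UNIV d" by (rule Metric_space_axioms)
    show "mcomplete"
      unfolding mcomplete_def
    proof (intro allI impI)
      fix \<sigma> assume "MCauchy \<sigma>"
      then have "Cauchy (\<lambda>n. b (\<sigma> n))" by (auto simp: MCauchy_def Cauchy_def d_def)
      then obtain y where y: "(\<lambda>n. b (\<sigma> n)) \<longlonglongrightarrow> y" using Cauchy_convergent convergent_def by blast
      obtain x where "b x = y" using surj by blast
      with y have "limitin mtopology \<sigma> x sequentially"
        by (auto simp: limit_metric_sequentially lim_sequentially d_def)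
      then show "\<exists>x. limitin mtopology \<sigma> x sequentially" ..
    qed
    show "separable_space mtopology"
    proof -
      obtain D :: "'a set" where D: "countable D" "\<And>X. open X \<Longrightarrow> X \<noteq> {} \<Longrightarrow> \<exists>d\<in>D. d \<in> X"
        using countable_dense_exists by (metis (no_types))
      have "countable (b -` D)"
        using b by (intro countable_image_inj_on[OF countable_subset[OF _ D(1), of "b ` (b -` D)"]])
          (auto simp: bij_def inj_on_def)
      moreover have "mtopology closure_of (b -` D) = topspace mtopology"
      proof (intro set_eqI iffI)
        fix x assume "x \<in> topspace mtopology"
        have "\<exists>y\<in>b -` D. y \<in> V" if V: "x \<in> V" "openin mtopology V" for V
        proof -
          obtain W where W: "V = b -` W" using vim by blast
          then have "open W" "b x \<in> W" using V open_iff by auto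
          then obtain v where v: "v \<in> D" "v \<in> W" using D(2)[of W] by blast
          obtain u where "b u = v" using surj by blast
          then show ?thesis using v W by (intro bexI[of _ u]) auto
        qed
        then show "x \<in> mtopology closure_of (b -` D)" by (auto simp: in_closure_of)
      qed (simp add: in_closure_of)
      ultimately show ?thesis unfolding separable_space_def by (intro exI[of _ "b -` D"]) auto
    qed
    show "bij_betw id (space M) UNIV" by (simp add: space)
    show "id \<in> M \<rightarrow>\<^sub>M ?S"
    proof (rule measurable_measure_of)
      fix V assume "V \<in> {V. openin mtopology V}"
      moreover obtain W where "V = b -` W" using vim by blast
      ultimately have "V = b -` W \<inter> UNIV" "W \<in> sets borel" using open_iff by auto
      then show "id -` V \<inter> space M \<in> sets M"
        unfolding sets space by (auto simp: sets_vimage_algebra2)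
    qed (auto simp: space)
    have "the_inv_into (space M) id = id"
      by (intro ext) (simp add: space the_inv_into_f_eq)
    moreover have "id \<in> ?S \<rightarrow>\<^sub>M M"
    proof (rule measurableI)
      fix A assume "A \<in> sets M"
      then obtain B where "A = b -` B" "B \<in> sets borel" unfolding sets by (auto simp: sets_vimage_algebra2)
      then show "id -` A \<inter> space ?S \<in> sets ?S" using measurable_sets[OF bS, of B] by simp
    qed (simp add: space)
    ultimately show "the_inv_into (space M) id \<in> ?S \<rightarrow>\<^sub>M M" by simp
  qed
qed

section \<open>Lines in the plane\<close>

type_synonym line = "(real \<times> real) \<times> (nat \<Rightarrow> real)"

text \<open>The signed distance from the origin to the line through the point \<open>t\<close> whose normal has direction
  \<open>\<phi>\<close>. The line \<open>(r, \<phi>)\<close> consists of all \<open>t\<close> with \<open>along t \<phi> = r\<close>.\<close>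
definition along :: "real \<times> real \<Rightarrow> real \<Rightarrow> real" where
  "along t \<phi> = fst t * cos \<phi> + snd t * sin \<phi>"

lemma along_add: "along (s + t) \<phi> = along s \<phi> + along t \<phi>"
  by (simp add: along_def algebra_simps)

lemma along_0 [simp]: "along 0 \<phi> = 0"
  by (simp add: along_def)

lemma along_minus [simp]: "along (- t) \<phi> = - along t \<phi>"
  by (simp add: along_def)

lemma borel_measurable_along [measurable (raw)]:
  assumes [measurable]: "f \<in> borel_measurable M" "g \<in> borel_measurable M"
  shows "(\<lambda>x. along (f x) (g x)) \<in> borel_measurable M"
proof -
  have [measurable]: "f \<in> M \<rightarrow>\<^sub>M borel \<Otimes>\<^sub>M borel" using assms(1) by (simp add: borel_prod)
  have [measurable]: "(\<lambda>x. cos (g x)) \<in> borel_measurable M" "(\<lambda>x. sin (g x)) \<in> borel_measurable M"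
    by (intro measurable_compose[OF assms(2)] borel_measurable_continuous_onI continuous_intros)+
  show ?thesis unfolding along_def by measurable
qed

lemma nn_integral_translate:
  fixes k :: "real \<Rightarrow> ennreal"
  assumes "k \<in> borel_measurable borel"
  shows "(\<integral>\<^sup>+r. k (r + c) \<partial>lborel) = (\<integral>\<^sup>+r. k r \<partial>lborel)"
  using nn_integral_real_affine[OF assms, of 1 c] by (simp add: add.commute)

lemma nn_integral_reflect:
  fixes k :: "real \<Rightarrow> ennreal"
  assumes "k \<in> borel_measurable borel"
  shows "(\<integral>\<^sup>+r. k (c - r) \<partial>lborel) = (\<integral>\<^sup>+r. k r \<partial>lborel)"
  using nn_integral_real_affine[OF assms, of "-1" c] by simp

lemma nn_integral_affine_pos:
  fixes k :: "real \<Rightarrow> ennreal"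
  assumes k: "k \<in> borel_measurable borel" and "c \<noteq> 0" and pos: "(\<integral>\<^sup>+u. k u \<partial>lborel) \<noteq> 0"
  shows "\<exists>m. m \<noteq> 0 \<and> (\<forall>d. (\<integral>\<^sup>+x. k (x * c + d) \<partial>lborel) = m)"
proof (intro exI conjI allI)
  have 1: "(\<integral>\<^sup>+u. k u \<partial>lborel) = ennreal \<bar>c\<bar> * (\<integral>\<^sup>+x. k (x * c + d) \<partial>lborel)" for d
    using nn_integral_real_affine[OF k \<open>c \<noteq> 0\<close>, of d] by (simp add: algebra_simps)
  have "k (x * c + d) = k ((x + d / c) * c)" for x d
    using \<open>c \<noteq> 0\<close> by (simp add: distrib_right)
  then show "(\<integral>\<^sup>+x. k (x * c + d) \<partial>lborel) = (\<integral>\<^sup>+x. k (x * c) \<partial>lborel)" for d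
    using nn_integral_translate[of "\<lambda>x. k (x * c)" "d / c"] k by simp
  show "(\<integral>\<^sup>+x. k (x * c) \<partial>lborel) \<noteq> 0" using 1[of 0] pos by auto
qed

text \<open>The integrand is constant on each line \<open>along t \<phi> = c\<close>, which has infinite length. Instead of
  rotating coordinates, one integrates first over a coordinate axis that is transversal to these
  lines; the result does not depend on the other coordinate.\<close>
lemma nn_integral_plane_infinite:
  fixes k :: "real \<Rightarrow> ennreal"
  assumes k [measurable]: "k \<in> borel_measurable borel" and pos: "(\<integral>\<^sup>+u. k u \<partial>lborel) \<noteq> 0"
  shows "(\<integral>\<^sup>+t. k (along t \<phi> - r) \<partial>lborel) = \<infinity>"
proof -
  have km: "(\<lambda>t. k (along t \<phi> - r)) \<in> borel_measurable borel" by measurable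
  show ?thesis
  proof (cases "cos \<phi> = 0")
    case False
    from nn_integral_affine_pos[OF k this pos]
    obtain m where m: "m \<noteq> 0" "\<And>d. (\<integral>\<^sup>+x. k (x * cos \<phi> + d) \<partial>lborel) = m" by blast
    have "(\<integral>\<^sup>+t. k (along t \<phi> - r) \<partial>lborel) = (\<integral>\<^sup>+t. k (along t \<phi> - r) \<partial>(lborel \<Otimes>\<^sub>M lborel))"
      by (simp add: lborel_prod)
    also have "\<dots> = (\<integral>\<^sup>+y. (\<integral>\<^sup>+x. k (along (x, y) \<phi> - r) \<partial>lborel) \<partial>lborel)"
      by (subst lborel_pair.nn_integral_snd[symmetric]) (simp_all add: lborel_prod km)
    also have "\<dots> = (\<integral>\<^sup>+(y::real). m \<partial>lborel)"
      using m(2) by (intro nn_integral_cong) (simp add: along_def add_diff_eq[symmetric])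
    also have "\<dots> = \<infinity>" using m(1) by (simp add: ennreal_mult_top)
    finally show ?thesis .
  next
    case True
    then have "sin \<phi> \<noteq> 0" using sin_cos_squared_add[of \<phi>] by auto
    from nn_integral_affine_pos[OF k this pos]
    obtain m where m: "m \<noteq> 0" "\<And>d. (\<integral>\<^sup>+y. k (y * sin \<phi> + d) \<partial>lborel) = m" by blast
    have "(\<integral>\<^sup>+t. k (along t \<phi> - r) \<partial>lborel) = (\<integral>\<^sup>+t. k (along t \<phi> - r) \<partial>(lborel \<Otimes>\<^sub>M lborel))"
      by (simp add: lborel_prod)
    also have "\<dots> = (\<integral>\<^sup>+x. (\<integral>\<^sup>+y. k (along (x, y) \<phi> - r) \<partial>lborel) \<partial>lborel)"
      by (subst lborel.nn_integral_fst[symmetric]) (simp_all add: lborel_prod km)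
    also have "\<dots> = (\<integral>\<^sup>+(y::real). m \<partial>lborel)"
      using m(2)[of "- r"] True by (intro nn_integral_cong) (simp add: along_def)
    also have "\<dots> = \<infinity>" using m(1) by (simp add: ennreal_mult_top)
    finally show ?thesis .
  qed
qed

lemma sets_line_intensity: "sets (line_intensity lam) = sets (lborel \<Otimes>\<^sub>M restrict_space lborel {0..<2*pi})"
  by (simp add: line_intensity_def)

lemma space_line_intensity: "space (line_intensity lam) = UNIV \<times> {0..<2*pi}"
  by (simp add: line_intensity_def space_scale_measure space_pair_measure space_restrict_space)

lemma measurable_line_intensity_borel [measurable]: "(\<lambda>x. x) \<in> line_intensity lam \<rightarrow>\<^sub>M borel"
proof -
  have "(\<lambda>x. (fst x, snd x)) \<in> lborel \<Otimes>\<^sub>M restrict_space lborel {0..<2*pi} \<rightarrow>\<^sub>M borel \<Otimes>\<^sub>M borel"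
    by (intro measurable_Pair measurable_compose[OF measurable_fst] measurable_compose[OF measurable_snd])
      (auto intro!: measurable_restrict_space1)
  then show ?thesis
    by (simp add: borel_prod measurable_cong_sets[OF sets_line_intensity refl])
qed

lemma sigma_finite_restrict_lborel: "sigma_finite_measure (restrict_space lborel {0..<2*pi})"
  by (intro sigma_finite_measure_restrict_space lborel.sigma_finite_measure_axioms) auto

lemma nn_integral_line_intensity:
  assumes u: "u \<in> borel_measurable (borel :: (real \<times> real) measure)"
  shows "(\<integral>\<^sup>+x. u x \<partial>line_intensity lam) =
    ennreal lam * (\<integral>\<^sup>+\<phi>. (\<integral>\<^sup>+r. u (r, \<phi>) \<partial>lborel) * indicator {0..<2*pi} \<phi> \<partial>lborel)"
proof -
  let ?A = "restrict_space lborel {0..<2*pi}"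
  interpret A: sigma_finite_measure ?A by (rule sigma_finite_restrict_lborel)
  interpret LA: pair_sigma_finite "lborel :: real measure" ?A ..
  have u': "u \<in> borel_measurable (lborel \<Otimes>\<^sub>M ?A)"
    using measurable_compose[OF measurable_line_intensity_borel u]
    by (simp add: measurable_cong_sets[OF sets_line_intensity refl])
  have "(\<integral>\<^sup>+x. u x \<partial>line_intensity lam) = ennreal lam * (\<integral>\<^sup>+x. u x \<partial>(lborel \<Otimes>\<^sub>M ?A))"
    unfolding line_intensity_def by (rule nn_integral_scale_measure[OF u'])
  also have "(\<integral>\<^sup>+x. u x \<partial>(lborel \<Otimes>\<^sub>M ?A)) = (\<integral>\<^sup>+\<phi>. (\<integral>\<^sup>+r. u (r, \<phi>) \<partial>lborel) \<partial>?A)"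
    using u' by (subst LA.nn_integral_snd[symmetric]) auto
  also have "\<dots> = (\<integral>\<^sup>+\<phi>. (\<integral>\<^sup>+r. u (r, \<phi>) \<partial>lborel) * indicator {0..<2*pi} \<phi> \<partial>lborel)"
    by (subst nn_integral_restrict_space) auto
  finally show ?thesis .
qed

lemma sigma_finite_line_intensity: "sigma_finite_measure (line_intensity lam)"
proof -
  let ?A = "\<lambda>n::nat. {- real n..real n} \<times> {0..<2*pi}"
  have sets: "?A n \<in> sets (line_intensity lam)" for n
    unfolding sets_line_intensity by (intro pair_measureI) (auto simp: sets_restrict_space)
  have fin: "emeasure (line_intensity lam) (?A n) \<noteq> \<infinity>" for n
  proof -
    interpret A: sigma_finite_measure "restrict_space lborel {0..<2*pi}" by (rule sigma_finite_restrict_lborel)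
    have "emeasure (line_intensity lam) (?A n) = ennreal lam * (ennreal (2 * real n) * ennreal (2 * pi))"
      unfolding line_intensity_def emeasure_scale_measure
      by (subst A.emeasure_pair_measure_Times) (auto simp: sets_restrict_space emeasure_restrict_space)
    then show ?thesis by (simp add: ennreal_mult_eq_top_iff)
  qed
  have "(\<Union>n. ?A n) = space (line_intensity lam)"
  proof -
    have "\<exists>n::nat. - real n \<le> x \<and> x \<le> real n" for x :: real
    proof -
      obtain n :: nat where "\<bar>x\<bar> \<le> real n" using real_arch_simple by blast
      then show ?thesis by (intro exI[of _ n]) auto
    qed
    then show ?thesis by (auto simp: space_line_intensity)
  qed
  then show ?thesis
    using sets fin by (intro sigma_finite_measure.intro exI[of _ "range ?A"]) auto
qed

lemma emeasure_eq_nn_integral_of_bool: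
  assumes "{w \<in> space M. P w} \<in> sets M"
  shows "emeasure M {w \<in> space M. P w} = (\<integral>\<^sup>+w. of_bool (P w) \<partial>M)"
proof -
  have "(\<integral>\<^sup>+w. of_bool (P w) \<partial>M) = (\<integral>\<^sup>+w. indicator {w \<in> space M. P w} w \<partial>M)"
    by (intro nn_integral_cong) (simp add: indicator_def)
  with assms show ?thesis by simp
qed

section \<open>The flow on lines with profiles\<close>

text \<open>A point \<open>((r, \<phi>), z)\<close> is a line together with a profile \<open>u \<mapsto> F u z\<close> across it. The bijection \<open>b\<close>
  serves only to put this space on the reals.\<close>
locale line_flow = prob_space N for N :: "(nat \<Rightarrow> real) measure" +
  fixes lam :: real and F :: "real \<Rightarrow> (nat \<Rightarrow> real) \<Rightarrow> real" and b :: "real \<Rightarrow> line"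
  assumes lam: "0 < lam"
    and sets_N [simp, measurable_cong]: "sets N = sets borel"
    and F [measurable]: "(\<lambda>(t, z). F t z) \<in> borel_measurable (borel \<Otimes>\<^sub>M borel)"
    and F_nonneg: "\<And>t z. 0 \<le> F t z"
    and F_int: "\<And>a. 0 < a \<Longrightarrow> (\<integral>\<^sup>+t. emeasure N {z. a < F t z} \<partial>lborel) < \<infinity>"
    and b: "bij b"
begin

abbreviation LN :: "line measure" where "LN \<equiv> line_intensity lam \<Otimes>\<^sub>M N"

text \<open>A profile that vanishes almost everywhere contributes nothing to \<open>f t\<close>, up to null sets. Such
  profiles are removed from \<open>M\<close> to obtain full support.\<close>
definition alive :: "(nat \<Rightarrow> real) \<Rightarrow> bool" where
  "alive z \<longleftrightarrow> (\<integral>\<^sup>+u. ennreal (F u z) \<partial>lborel) \<noteq> 0"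

definition D :: "line set" where "D = {x \<in> space LN. alive (snd x)}"

definition J :: "real measure" where "J = vimage_algebra UNIV b borel"

definition M :: "real measure" where "M = distr (density LN (indicator D)) J (inv b)"

definition shift :: "real \<times> real \<Rightarrow> line \<Rightarrow> line" where
  "shift t x = ((fst (fst x) - along t (snd (fst x)), snd (fst x)), snd x)"

definition T :: "real \<times> real \<Rightarrow> real \<Rightarrow> real" where "T t w = inv b (shift t (b w))"

definition f :: "real \<times> real \<Rightarrow> real \<Rightarrow> real" where
  "f t w = F (along t (snd (fst (b w))) - fst (fst (b w))) (snd (b w))"

lemma b_inv [simp]: "b (inv b x) = x" and inv_b [simp]: "inv b (b w) = w"
  using b by (simp_all add: bij_is_surj surj_f_inv_f bij_is_inj)

lemma F_measurable [measurable (raw)]: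
  assumes "g \<in> borel_measurable R" "h \<in> borel_measurable R"
  shows "(\<lambda>x. F (g x) (h x)) \<in> borel_measurable R"
  using measurable_compose[OF measurable_Pair[OF assms] F] by simp

lemma line_fst_snd [measurable]:
  "(\<lambda>x :: line. fst (fst x)) \<in> borel_measurable borel"
  "(\<lambda>x :: line. snd (fst x)) \<in> borel_measurable borel"
  "(\<lambda>x :: line. snd x) \<in> borel_measurable borel"
  by (intro borel_measurable_continuous_onI continuous_intros)+

lemma line_measurable [measurable (raw)]:
  assumes [measurable]: "g \<in> borel_measurable R" "k \<in> borel_measurable R" "h \<in> borel_measurable R"
  shows "(\<lambda>x. ((g x, k x), h x)) \<in> R \<rightarrow>\<^sub>M (borel :: line measure)"
proof -
  have "(\<lambda>x. ((g x, k x), h x)) \<in> R \<rightarrow>\<^sub>M (borel \<Otimes>\<^sub>M borel) \<Otimes>\<^sub>M borel" by measurable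
  then show ?thesis by (simp add: borel_prod)
qed

lemma space_J [simp]: "space J = UNIV" by (simp add: J_def)

lemma b_measurable [measurable]: "b \<in> J \<rightarrow>\<^sub>M borel"
  unfolding J_def by (rule measurable_vimage_algebra1) simp

lemma inv_b_measurable [measurable]: "inv b \<in> borel \<rightarrow>\<^sub>M J"
  unfolding J_def by (rule measurable_vimage_algebra2) auto

lemma sets_M [simp, measurable_cong]: "sets M = sets J" by (simp add: M_def)

lemma space_M [simp]: "space M = UNIV" by (simp add: M_def)

lemma shift_measurable [measurable (raw)]:
  assumes [measurable]: "g \<in> borel_measurable R" "h \<in> borel_measurable R"
  shows "(\<lambda>x. shift (g x) (h x)) \<in> borel_measurable R"
  unfolding shift_def by measurable

lemma T_measurable [measurable (raw)]:
  assumes [measurable]: "g \<in> borel_measurable R" "h \<in> R \<rightarrow>\<^sub>M J"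
  shows "(\<lambda>x. T (g x) (h x)) \<in> R \<rightarrow>\<^sub>M J"
  unfolding T_def by measurable

lemma f_measurable [measurable (raw)]:
  assumes [measurable]: "g \<in> borel_measurable R" "h \<in> R \<rightarrow>\<^sub>M J"
  shows "(\<lambda>x. f (g x) (h x)) \<in> borel_measurable R"
  unfolding f_def by measurable

lemma alive_measurable [measurable]: "Measurable.pred borel alive"
proof -
  have "(\<lambda>z. \<integral>\<^sup>+u. ennreal (F u z) \<partial>lborel) \<in> borel_measurable borel"
    by (intro lborel.borel_measurable_nn_integral) measurable
  then show ?thesis unfolding alive_def[abs_def] by measurable
qed

lemma LN_borel [measurable]: "(\<lambda>x. x) \<in> LN \<rightarrow>\<^sub>M borel"
proof -
  have "(\<lambda>x. (fst x, snd x)) \<in> LN \<rightarrow>\<^sub>M borel \<Otimes>\<^sub>M borel"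
    by (intro measurable_Pair measurable_compose[OF measurable_fst] measurable_compose[OF measurable_snd])
      (auto simp: measurable_cong_sets[OF sets_N refl])
  then show ?thesis by (simp add: borel_prod)
qed

lemma borel_LN: "u \<in> borel \<rightarrow>\<^sub>M R \<Longrightarrow> u \<in> LN \<rightarrow>\<^sub>M R"
  using measurable_compose[OF LN_borel] by simp

lemma D_sets [measurable]: "D \<in> sets LN"
proof -
  have "Measurable.pred borel (\<lambda>x :: line. alive (snd x))" by measurable
  from borel_LN[OF this] show ?thesis unfolding D_def by measurable
qed

lemma inv_b_LN [measurable]: "inv b \<in> LN \<rightarrow>\<^sub>M J"
  by (rule borel_LN) measurable

lemma sigma_finite_LN: "sigma_finite_measure LN"
proof -
  interpret L: sigma_finite_measure "line_intensity lam" by (rule sigma_finite_line_intensity)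
  interpret pair_sigma_finite "line_intensity lam" N ..
  show ?thesis by (rule sigma_finite_measure_axioms)
qed

lemma nn_integral_LN:
  assumes u [measurable]: "u \<in> borel_measurable (borel :: line measure)"
  shows "(\<integral>\<^sup>+x. u x \<partial>LN) =
    (\<integral>\<^sup>+z. ennreal lam * (\<integral>\<^sup>+\<phi>. (\<integral>\<^sup>+r. u ((r, \<phi>), z) \<partial>lborel) * indicator {0..<2*pi} \<phi> \<partial>lborel) \<partial>N)"
proof -
  interpret L: sigma_finite_measure "line_intensity lam" by (rule sigma_finite_line_intensity)
  interpret LN: pair_sigma_finite "line_intensity lam" N ..
  have "(\<integral>\<^sup>+x. u x \<partial>LN) = (\<integral>\<^sup>+z. (\<integral>\<^sup>+y. u (y, z) \<partial>line_intensity lam) \<partial>N)"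
    using borel_LN[OF u] by (subst LN.nn_integral_snd[symmetric]) auto
  also have "\<dots> = (\<integral>\<^sup>+z. ennreal lam * (\<integral>\<^sup>+\<phi>. (\<integral>\<^sup>+r. u ((r, \<phi>), z) \<partial>lborel) * indicator {0..<2*pi} \<phi> \<partial>lborel) \<partial>N)"
  proof (intro nn_integral_cong nn_integral_line_intensity)
    fix z
    have "(\<lambda>y. (y, z)) \<in> borel \<rightarrow>\<^sub>M (borel :: line measure)"
      by (intro borel_measurable_continuous_onI continuous_intros)
    from measurable_compose[OF this u] show "(\<lambda>y. u (y, z)) \<in> borel_measurable borel" .
  qed
  finally show ?thesis .
qed

text \<open>The innermost integral runs over the offset \<open>r\<close>, the only coordinate that the flow changes.\<close>
lemma nn_integral_M:
  assumes v [measurable]: "v \<in> borel_measurable J"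
  shows "(\<integral>\<^sup>+w. v w \<partial>M) =
    (\<integral>\<^sup>+z. ennreal lam * (\<integral>\<^sup>+\<phi>. (\<integral>\<^sup>+r. v (inv b ((r, \<phi>), z)) * of_bool (alive z) \<partial>lborel) *
      indicator {0..<2*pi} \<phi> \<partial>lborel) \<partial>N)"
proof -
  have "(\<integral>\<^sup>+w. v w \<partial>M) = (\<integral>\<^sup>+x. v (inv b x) \<partial>density LN (indicator D))"
    unfolding M_def by (subst nn_integral_distr) auto
  also have "\<dots> = (\<integral>\<^sup>+x. indicator D x * v (inv b x) \<partial>LN)"
    by (subst nn_integral_density) (auto intro!: borel_LN)
  also have "\<dots> = (\<integral>\<^sup>+x. v (inv b x) * of_bool (alive (snd x)) \<partial>LN)"
    by (intro nn_integral_cong) (auto simp: D_def indicator_def)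
  also have "\<dots> = (\<integral>\<^sup>+z. ennreal lam * (\<integral>\<^sup>+\<phi>. (\<integral>\<^sup>+r. v (inv b ((r, \<phi>), z)) * of_bool (alive z) \<partial>lborel) *
      indicator {0..<2*pi} \<phi> \<partial>lborel) \<partial>N)"
    by (subst nn_integral_LN) auto
  finally show ?thesis .
qed

lemma section_measurable: "(\<lambda>r. inv b ((r, \<phi>), z)) \<in> borel \<rightarrow>\<^sub>M J" by measurable

lemma b_T: "b (T t w) = shift t (b w)" by (simp add: T_def)

lemma f_T: "f (t + s) w = f t (T s w)"
  by (simp add: f_def b_T shift_def along_add algebra_simps)

lemma T_0: "T 0 w = w" by (simp add: T_def shift_def)

lemma T_T: "T t (T s w) = T (t + s) w"
  by (simp add: T_def shift_def along_add algebra_simps)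

text \<open>For a fixed direction the flow translates the offset, and Lebesgue measure is translation
  invariant.\<close>
lemma nn_integral_T:
  assumes v [measurable]: "v \<in> borel_measurable J"
  shows "(\<integral>\<^sup>+w. v (T t w) \<partial>M) = (\<integral>\<^sup>+w. v w \<partial>M)"
proof -
  have "(\<integral>\<^sup>+r. v (T t (inv b ((r, \<phi>), z))) * of_bool (alive z) \<partial>lborel) =
      (\<integral>\<^sup>+r. v (inv b ((r, \<phi>), z)) * of_bool (alive z) \<partial>lborel)" for \<phi> z
  proof -
    have "T t (inv b ((r, \<phi>), z)) = inv b ((r + (- along t \<phi>), \<phi>), z)" for r
      by (simp add: T_def shift_def)
    then show ?thesis
      using nn_integral_translate[of "\<lambda>r. v (inv b ((r, \<phi>), z)) * of_bool (alive z)" "- along t \<phi>"]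
        measurable_compose[OF section_measurable v] by simp
  qed
  then show ?thesis by (simp add: nn_integral_M)
qed

lemma distr_T: "distr M M (T t) = M"
proof (rule measure_eqI)
  fix A assume "A \<in> sets (distr M M (T t))"
  then have A [measurable]: "A \<in> sets J" by simp
  have "emeasure (distr M M (T t)) A = (\<integral>\<^sup>+w. indicator A (T t w) \<partial>M)"
    by (subst nn_integral_indicator[symmetric], simp, subst nn_integral_distr) auto
  also have "\<dots> = (\<integral>\<^sup>+w. indicator A w \<partial>M)" by (rule nn_integral_T) measurable
  finally show "emeasure (distr M M (T t)) A = emeasure M A" by simp
qed simp

lemma bij_T: "bij (T t)"
  by (rule bij_betw_byWitness[of _ "T (- t)"]) (auto simp: T_T T_0)

lemma measure_preserving_flow_T: "measure_preserving_flow M T"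
  unfolding measure_preserving_flow_def measure_space_automorphism_def
proof (intro conjI allI ballI)
  fix t
  show Tm: "T t \<in> M \<rightarrow>\<^sub>M M" by measurable
  show "distr M M (T t) = M" by (rule distr_T)
  have "the_inv_into (space M - {}) (T t) = T (- t)"
    using bij_T[of t] by (intro ext) (simp add: the_inv_into_f_eq bij_is_inj T_T T_0)
  moreover have "T (- t) \<in> restrict_space M (space M - {}) \<rightarrow>\<^sub>M M"
    by (intro measurable_restrict_space1) measurable
  ultimately show "\<exists>A\<in>null_sets M. \<exists>B\<in>null_sets M. bij_betw (T t) (space M - A) (space M - B) \<and>
      the_inv_into (space M - A) (T t) \<in> restrict_space M (space M - B) \<rightarrow>\<^sub>M M"
    using bij_T[of t] by (intro bexI[of _ "{}"]) auto
next
  show "T 0 w = w" for w by (rule T_0)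
  show "AE w in M. T t (T s w) = T (t + s) w" for s t by (simp add: T_T)
  show "(\<lambda>(t, w). T t w) \<in> borel \<Otimes>\<^sub>M M \<rightarrow>\<^sub>M M" by measurable
qed

lemma AE_alive: "AE w in M. alive (snd (b w))"
proof -
  have "(\<integral>\<^sup>+w. of_bool (\<not> alive (snd (b w))) \<partial>M) = 0"
  proof -
    have 0: "(\<integral>\<^sup>+r. of_bool (\<not> alive (snd (b (inv b ((r, \<phi>), z))))) * of_bool (alive z) \<partial>lborel) = 0" for \<phi> z
      by (cases "alive z") auto
    show ?thesis by (subst nn_integral_M, measurable) (simp only: 0, simp)
  qed
  then have "AE w in M. of_bool (\<not> alive (snd (b w))) = (0 :: ennreal)"
    by (subst (asm) nn_integral_0_iff_AE) auto
  then show ?thesis by eventually_elim auto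
qed

text \<open>The orbit integral of \<open>h\<close> is infinite unless the integral \<open>S\<close> of \<open>h\<close> over all parallel lines with
  the same profile vanishes. But \<open>h\<close> integrates to \<open>0\<close> over the set where \<open>S = 0\<close>, so that this
  set is null.\<close>
lemma conservative_T: "conservative_flow M T"
  unfolding conservative_flow_def
proof (intro conjI allI impI measure_preserving_flow_T)
  fix h :: "real \<Rightarrow> real" assume "integrable M h \<and> (AE w in M. 0 < h w)"
  then have h [measurable]: "h \<in> borel_measurable J" and pos: "AE w in M. 0 < h w"
    by (auto dest!: borel_measurable_integrable simp: measurable_cong_sets[OF sets_M refl])
  define S where "S x = (\<integral>\<^sup>+u. ennreal (h (inv b ((u, snd (fst x)), snd x))) \<partial>lborel)" for x :: line
  have S [measurable]: "S \<in> borel_measurable borel"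
    unfolding S_def by (intro lborel.borel_measurable_nn_integral) measurable
  have H: "(\<integral>\<^sup>+t. ennreal (h (T t w)) \<partial>lborel) = \<infinity>" if "S (b w) \<noteq> 0" for w
  proof -
    \<comment> \<open>The sign turns the offset \<open>r - along t \<phi>\<close> into the argument \<open>along t \<phi> - r\<close>.\<close>
    define k where "k u = ennreal (h (inv b ((- u, snd (fst (b w))), snd (b w))))" for u
    have k [measurable]: "k \<in> borel_measurable borel" unfolding k_def by measurable
    have "(\<integral>\<^sup>+u. k u \<partial>lborel) = S (b w)"
      unfolding S_def using nn_integral_reflect[OF k, of 0] by (simp add: k_def)
    then have "(\<integral>\<^sup>+t. k (along t (snd (fst (b w))) - fst (fst (b w))) \<partial>lborel) = \<infinity>"
      using that by (intro nn_integral_plane_infinite) auto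
    then show ?thesis by (simp add: k_def T_def shift_def)
  qed
  have "(\<integral>\<^sup>+w. ennreal (h w) * of_bool (S (b w) = 0) \<partial>M) = 0"
  proof -
    have "(\<integral>\<^sup>+r. ennreal (h (inv b ((r, \<phi>), z))) * of_bool (S ((r, \<phi>), z) = 0) * of_bool (alive z) \<partial>lborel) = 0" for \<phi> z
    proof -
      have S0: "S ((r, \<phi>), z) = S ((0, \<phi>), z)" for r by (simp add: S_def)
      have "of_bool (S ((r, \<phi>), z) = 0) * of_bool (alive z) = (of_bool (S ((0, \<phi>), z) = 0 \<and> alive z) :: ennreal)" for r
        using S0[of r] by auto
      then have "(\<integral>\<^sup>+r. ennreal (h (inv b ((r, \<phi>), z))) * of_bool (S ((r, \<phi>), z) = 0) * of_bool (alive z) \<partial>lborel) =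
          (\<integral>\<^sup>+r. ennreal (h (inv b ((r, \<phi>), z))) * of_bool (S ((0, \<phi>), z) = 0 \<and> alive z) \<partial>lborel)"
        by (simp add: mult.assoc)
      also have "\<dots> = S ((0, \<phi>), z) * of_bool (S ((0, \<phi>), z) = 0 \<and> alive z)"
        unfolding S_def by (subst nn_integral_multc) auto
      finally show ?thesis by auto
    qed
    then show ?thesis by (subst nn_integral_M) auto
  qed
  then have "AE w in M. ennreal (h w) * of_bool (S (b w) = 0) = 0"
    by (subst (asm) nn_integral_0_iff_AE) auto
  with pos have "AE w in M. (\<integral>\<^sup>+t. ennreal (h (T t w)) \<partial>lborel) = \<infinity>"
  proof eventually_elim
    case (elim w)
    then have "S (b w) \<noteq> 0" by auto
    then show ?case by (rule H)
  qed
  moreover have "dissipative_part M T h \<in> sets M"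
  proof -
    have "(\<lambda>w. \<integral>\<^sup>+t. ennreal (h (T t w)) \<partial>lborel) \<in> borel_measurable J"
      by (intro lborel.borel_measurable_nn_integral) measurable
    then show ?thesis
      unfolding dissipative_part_def conservative_part_def by measurable
  qed
  ultimately show "dissipative_part M T h \<in> null_sets M"
    by (subst AE_iff_null_sets) (auto simp: dissipative_part_def conservative_part_def)
qed

lemma sigma_finite_M: "sigma_finite_measure M"
proof -
  let ?A = "\<lambda>n::nat. {w \<in> space M. \<bar>fst (fst (b w))\<bar> \<le> real n}"
  have sets: "?A n \<in> sets M" for n by measurable
  have fin: "emeasure M (?A n) \<noteq> \<infinity>" for n
  proof -
    have "emeasure M (?A n) = (\<integral>\<^sup>+w. of_bool (\<bar>fst (fst (b w))\<bar> \<le> real n) \<partial>M)"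
      by (rule emeasure_eq_nn_integral_of_bool[OF sets])
    also have "\<dots> \<le> (\<integral>\<^sup>+z. ennreal lam * (\<integral>\<^sup>+\<phi>. ennreal (2 * real n) * indicator {0..<2*pi} \<phi> \<partial>lborel) \<partial>N)"
    proof (subst nn_integral_M, measurable, intro nn_integral_mono mult_left_mono mult_right_mono)
      fix z \<phi>
      have "(\<integral>\<^sup>+r. of_bool (\<bar>fst (fst (b (inv b ((r, \<phi>), z))))\<bar> \<le> real n) * of_bool (alive z) \<partial>lborel) \<le>
          (\<integral>\<^sup>+r. indicator {- real n..real n} r \<partial>lborel)"
        by (intro nn_integral_mono) (auto simp: indicator_def)
      then show "(\<integral>\<^sup>+r. of_bool (\<bar>fst (fst (b (inv b ((r, \<phi>), z))))\<bar> \<le> real n) * of_bool (alive z) \<partial>lborel) \<le>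
          ennreal (2 * real n)"
        by simp
    qed auto
    also have "\<dots> < \<infinity>"
      by (simp add: nn_integral_cmult ennreal_mult_less_top emeasure_space_1)
    finally show ?thesis by simp
  qed
  have "(\<Union>n. ?A n) = space M" using real_arch_simple by auto
  then show ?thesis
    using sets fin by (intro sigma_finite_measure.intro exI[of _ "range ?A"]) auto
qed

lemma f_L_vee: "f t \<in> L_vee M"
  unfolding L_vee_def
proof (intro CollectI conjI allI impI)
  show "f t \<in> borel_measurable M" by measurable
  show "AE w in M. 0 \<le> f t w" by (simp add: f_def F_nonneg)
  fix a :: real assume a: "0 < a"
  have "emeasure M {w \<in> space M. a < f t w} = (\<integral>\<^sup>+w. of_bool (a < f t w) \<partial>M)"
    by (rule emeasure_eq_nn_integral_of_bool) measurable
  also have "\<dots> \<le> (\<integral>\<^sup>+z. ennreal lam * (\<integral>\<^sup>+\<phi>. (\<integral>\<^sup>+r. of_bool (a < F r z) \<partial>lborel) * indicator {0..<2*pi} \<phi> \<partial>lborel) \<partial>N)"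
  proof (subst nn_integral_M, measurable, rule nn_integral_mono, rule mult_left_mono, rule nn_integral_mono, rule mult_right_mono)
    fix z \<phi>
    have "(\<integral>\<^sup>+r. of_bool (a < f t (inv b ((r, \<phi>), z))) * of_bool (alive z) \<partial>lborel) \<le>
        (\<integral>\<^sup>+r. of_bool (a < F (along t \<phi> - r) z) \<partial>lborel)"
      by (intro nn_integral_mono) (auto simp: f_def)
    also have "\<dots> = (\<integral>\<^sup>+r. of_bool (a < F r z) \<partial>lborel)"
      by (rule nn_integral_reflect) measurable
    finally show "(\<integral>\<^sup>+r. of_bool (a < f t (inv b ((r, \<phi>), z))) * of_bool (alive z) \<partial>lborel) \<le>
        (\<integral>\<^sup>+r. of_bool (a < F r z) \<partial>lborel)" .
  qed auto
  also have "\<dots> = (\<integral>\<^sup>+z. (\<integral>\<^sup>+r. of_bool (a < F r z) \<partial>lborel) * (ennreal lam * ennreal (2 * pi)) \<partial>N)"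
    by (intro nn_integral_cong, subst nn_integral_cmult) (auto simp: ac_simps)
  also have "\<dots> = (\<integral>\<^sup>+z. (\<integral>\<^sup>+r. of_bool (a < F r z) \<partial>lborel) \<partial>N) * (ennreal lam * ennreal (2 * pi))"
    by (intro nn_integral_multc) measurable
  also have "(\<integral>\<^sup>+z. (\<integral>\<^sup>+r. of_bool (a < F r z) \<partial>lborel) \<partial>N) = (\<integral>\<^sup>+r. (\<integral>\<^sup>+z. of_bool (a < F r z) \<partial>N) \<partial>lborel)"
  proof -
    interpret pair_sigma_finite lborel N ..
    show ?thesis by (rule Fubini') measurable
  qed
  also have "\<dots> = (\<integral>\<^sup>+r. emeasure N {z. a < F r z} \<partial>lborel)"
  proof (intro nn_integral_cong)
    fix r
    have "{z \<in> space N. a < F r z} \<in> sets N" by measurable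
    moreover have "space N = UNIV" using sets_eq_imp_space_eq[OF sets_N] by simp
    ultimately show "(\<integral>\<^sup>+z. of_bool (a < F r z) \<partial>N) = emeasure N {z. a < F r z}"
      using emeasure_eq_nn_integral_of_bool[of N "\<lambda>z. a < F r z"] by simp
  qed
  also have "\<dots> * (ennreal lam * ennreal (2 * pi)) < \<infinity>"
    using F_int[OF a] by (simp add: ennreal_mult_less_top)
  finally show "emeasure M {w \<in> space M. a < f t w} < \<infinity>" .
qed

text \<open>If every \<open>f t\<close> vanishes almost everywhere on \<open>B\<close>, then by Fubini \<open>\<integral> f t w dt = 0\<close> for almost
  every \<open>w\<close> in \<open>B\<close>. This integral is infinite, however, whenever the profile of \<open>w\<close> is alive.\<close>
lemma full_support_f: "full_support M f"
  unfolding full_support_def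
proof (intro notI, elim bexE conjE)
  fix B assume "B \<in> sets M" and pos: "0 < emeasure M B" and zero: "\<forall>t. AE w in M. w \<in> B \<longrightarrow> f t w = 0"
  then have B [measurable]: "B \<in> sets J" by simp
  interpret M: sigma_finite_measure M by (rule sigma_finite_M)
  interpret LM: pair_sigma_finite "lborel :: (real \<times> real) measure" M ..
  have "(\<integral>\<^sup>+w. (\<integral>\<^sup>+t. ennreal (f t w) * indicator B w \<partial>lborel) \<partial>M) =
      (\<integral>\<^sup>+t. (\<integral>\<^sup>+w. ennreal (f t w) * indicator B w \<partial>M) \<partial>lborel)"
    by (rule LM.Fubini') measurable
  also have "\<dots> = (\<integral>\<^sup>+(t :: real \<times> real). 0 \<partial>lborel)"
  proof (intro nn_integral_cong)
    fix t
    have "AE w in M. ennreal (f t w) * indicator B w = 0"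
      using zero[rule_format, of t] by eventually_elim (auto simp: indicator_def)
    then show "(\<integral>\<^sup>+w. ennreal (f t w) * indicator B w \<partial>M) = 0"
      by (subst nn_integral_0_iff_AE) auto
  qed
  finally have "(\<integral>\<^sup>+w. (\<integral>\<^sup>+t. ennreal (f t w) \<partial>lborel) * indicator B w \<partial>M) = 0"
    by (simp add: nn_integral_multc)
  then have "AE w in M. (\<integral>\<^sup>+t. ennreal (f t w) \<partial>lborel) * indicator B w = 0"
    by (subst (asm) nn_integral_0_iff_AE) (auto intro!: borel_measurable_times lborel.borel_measurable_nn_integral)
  with AE_alive have "AE w in M. w \<notin> B"
  proof eventually_elim
    case (elim w)
    have "(\<integral>\<^sup>+t. ennreal (f t w) \<partial>lborel) = \<infinity>"
      unfolding f_def using elim(1)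
      by (intro nn_integral_plane_infinite[of "\<lambda>u. ennreal (F u (snd (b w)))"]) (auto simp: alive_def)
    with elim(2) show ?case by (auto simp: indicator_def split: if_splits)
  qed
  then have "B \<in> null_sets M" by (subst AE_iff_null_sets) auto
  with pos show False by auto
qed

lemma measure_f_shift:
  assumes "finite I"
  shows "measure M {w \<in> space M. \<exists>t\<in>I. a t < f (t + s) w} = measure M (exceedance M f I a)"
proof -
  have "exceedance M f I a \<in> sets M" using assms by measurable
  then have "measure (distr M M (T s)) (exceedance M f I a) =
      measure M (T s -` exceedance M f I a \<inter> space M)"
    by (intro measure_distr) auto
  then show ?thesis by (simp add: distr_T f_T vimage_def)
qed

lemma sigma_finite_borel_space_M: "sigma_finite_borel_space M"
  using b sigma_finite_M by (rule sigma_finite_borel_space_vimage) (simp add: J_def)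

text \<open>The exponent of the spectral representation, as an integral over lines. The removed profiles may
  be included again, since for each direction they exceed a positive level only for a null set of
  offsets.\<close>
lemma emeasure_f_LN:
  assumes I: "finite I" and a: "\<And>t. t \<in> I \<Longrightarrow> 0 < a t"
  shows "emeasure M (exceedance M f I a) =
    (\<integral>\<^sup>+y. emeasure N {z. \<exists>t\<in>I. a t < F (along t (snd y) - fst y) z} \<partial>line_intensity lam)"
proof -
  interpret L: sigma_finite_measure "line_intensity lam" by (rule sigma_finite_line_intensity)
  define u :: "line \<Rightarrow> ennreal"
    where "u x = of_bool (\<exists>t\<in>I. a t < F (along t (snd (fst x)) - fst (fst x)) (snd x))" for x
  have [measurable]: "Measurable.pred borel (\<lambda>x. \<exists>t\<in>I. a t < F (along t (snd (fst x)) - fst (fst x)) (snd x))"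
    using I by measurable
  have u [measurable]: "u \<in> borel_measurable borel" unfolding u_def by measurable
  have ub: "u (b w) = of_bool (\<exists>t\<in>I. a t < f t w)" for w by (simp add: u_def f_def)
  have dead: "(\<integral>\<^sup>+r. u ((r, \<phi>), z) * of_bool (alive z) \<partial>lborel) = (\<integral>\<^sup>+r. u ((r, \<phi>), z) \<partial>lborel)" for \<phi> z
  proof (cases "alive z")
    case False
    have "AE r in lborel. F (along t \<phi> - r) z = 0" for t
    proof -
      have "(\<integral>\<^sup>+r. ennreal (F (along t \<phi> - r) z) \<partial>lborel) = 0"
        using False nn_integral_reflect[of "\<lambda>r. ennreal (F r z)" "along t \<phi>"] by (simp add: alive_def)
      then have "AE r in lborel. ennreal (F (along t \<phi> - r) z) = 0"
        by (subst (asm) nn_integral_0_iff_AE) auto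
      then show ?thesis
        by eventually_elim (use F_nonneg in \<open>auto simp: ennreal_eq_0_iff intro: antisym\<close>)
    qed
    then have "AE r in lborel. \<forall>t\<in>I. F (along t \<phi> - r) z = 0" using I by (simp add: AE_finite_all)
    then have "AE r in lborel. u ((r, \<phi>), z) = 0"
      by eventually_elim (use a in \<open>force simp: u_def\<close>)
    then show ?thesis using False by (subst (2) nn_integral_cong_AE) auto
  qed simp
  have "emeasure M (exceedance M f I a) = (\<integral>\<^sup>+w. u (b w) \<partial>M)"
    unfolding ub using I by (intro emeasure_eq_nn_integral_of_bool) measurable
  also have "\<dots> = (\<integral>\<^sup>+x. u x \<partial>LN)"
    by (subst nn_integral_M, measurable) (simp add: dead nn_integral_LN)
  also have "\<dots> = (\<integral>\<^sup>+y. (\<integral>\<^sup>+z. u (y, z) \<partial>N) \<partial>line_intensity lam)"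
    using borel_LN[OF u] by (subst nn_integral_fst[symmetric]) auto
  also have "\<dots> = (\<integral>\<^sup>+y. emeasure N {z. \<exists>t\<in>I. a t < F (along t (snd y) - fst y) z} \<partial>line_intensity lam)"
  proof (intro nn_integral_cong)
    fix y
    have "{z \<in> space N. \<exists>t\<in>I. a t < F (along t (snd y) - fst y) z} \<in> sets N" using I by measurable
    moreover have "space N = UNIV" using sets_eq_imp_space_eq[OF sets_N] by simp
    ultimately show "(\<integral>\<^sup>+z. u (y, z) \<partial>N) = emeasure N {z. \<exists>t\<in>I. a t < F (along t (snd y) - fst y) z}"
      using emeasure_eq_nn_integral_of_bool[of N "\<lambda>z. \<exists>t\<in>I. a t < F (along t (snd y) - fst y) z"]
      by (simp add: u_def)
  qed
  finally show ?thesis .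
qed

end

section \<open>The law of the maximum over random lines\<close>

text \<open>Averaging over independent marks whose laws need not agree and whose values are the sample
  points themselves. Independence of the \<open>\<sigma>\<close>-algebras is independence of the identity maps into
  them, so the joint law of these maps is a product measure and Fubini's theorem applies.\<close>
lemma nn_integral_indep_marks:
  fixes W :: "nat \<Rightarrow> 'z \<times> 'p \<Rightarrow> ennreal"
  assumes P: "prob_space P" and Z [measurable]: "Z \<in> P \<rightarrow>\<^sub>M N"
    and G: "\<And>i. subalgebra P (G i)"
    and indep: "prob_space.indep_sets P
      (\<lambda>k. case k of None \<Rightarrow> {Z -` A \<inter> space P |A. A \<in> sets N} | Some i \<Rightarrow> sets (G i)) UNIV"
    and W [measurable]: "\<And>i. W i \<in> borel_measurable (N \<Otimes>\<^sub>M G i)"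
  shows "(\<integral>\<^sup>+\<omega>. (\<Prod>i<n. W i (Z \<omega>, \<omega>)) \<partial>P) = (\<integral>\<^sup>+\<omega>. (\<Prod>i<n. \<integral>\<^sup>+\<omega>'. W i (Z \<omega>, \<omega>') \<partial>P) \<partial>P)"
proof -
  interpret P: prob_space P by fact
  define H where "H k = (case k of None \<Rightarrow> vimage_algebra (space P) Z N | Some i \<Rightarrow> G i)" for k
  have Zs: "Z \<in> space P \<rightarrow> space N" using measurable_space[OF Z] by auto
  have space_H: "space (H k) = space P" for k
    using G by (auto simp: H_def subalgebra_def split: option.split)
  have sets_H: "sets (H k) = (case k of None \<Rightarrow> {Z -` A \<inter> space P |A. A \<in> sets N} | Some i \<Rightarrow> sets (G i))" for k
    using Zs by (auto simp: H_def sets_vimage_algebra2 split: option.split)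
  have id_H: "(\<lambda>\<omega>. \<omega>) \<in> P \<rightarrow>\<^sub>M H k" for k
  proof (rule measurableI)
    fix A assume "A \<in> sets (H k)"
    moreover have "sets (H k) \<subseteq> sets P" using indep by (simp add: sets_H P.indep_sets_def)
    ultimately have "A \<in> sets P" by blast
    then show "(\<lambda>\<omega>. \<omega>) -` A \<inter> space P \<in> sets P" by (simp add: vimage_def)
  qed (simp add: space_H)
  have vars: "P.indep_vars H (\<lambda>_ \<omega>. \<omega>) UNIV"
    unfolding P.indep_vars_def2
  proof (intro conjI ballI id_H P.indep_sets_mono_sets[OF indep])
    fix k
    have "{(\<lambda>\<omega>. \<omega>) -` A \<inter> space P |A. A \<in> sets (H k)} \<subseteq> sets (H k)"
      using sets.sets_into_space[of _ "H k"] by (auto simp: space_H vimage_def Int_absorb2)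
    then show "{(\<lambda>\<omega>. \<omega>) -` A \<inter> space P |A. A \<in> sets (H k)} \<subseteq>
        (case k of None \<Rightarrow> {Z -` A \<inter> space P |A. A \<in> sets N} | Some i \<Rightarrow> sets (G i))"
      by (simp only: sets_H)
  qed
  define D where "D k = distr P (H k) (\<lambda>\<omega>. \<omega>)" for k
  have sets_D [simp, measurable_cong]: "sets (D k) = sets (H k)" for k by (simp add: D_def)
  have D: "prob_space (D k)" for k unfolding D_def using id_H by (rule P.prob_space_distr)
  have D_int: "(\<integral>\<^sup>+\<omega>. u \<omega> \<partial>D k) = (\<integral>\<^sup>+\<omega>. u \<omega> \<partial>P)" if "u \<in> borel_measurable (H k)" for u k
    unfolding D_def using that by (subst nn_integral_distr[OF id_H]) auto
  interpret D: product_sigma_finite D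
    by (rule product_sigma_finite.intro) (rule prob_space_imp_sigma_finite[OF D])
  define S where "S = Some ` {..<n}"
  have S: "finite S" "None \<notin> S" by (auto simp: S_def)
  have law: "distr P (Pi\<^sub>M (insert None S) H) (\<lambda>\<omega>. \<lambda>k\<in>insert None S. \<omega>) = Pi\<^sub>M (insert None S) D"
    unfolding D_def
    by (rule P.indep_vars_iff_distr_eq_PiM'[THEN iffD1]) (auto intro: id_H P.indep_vars_subset[OF vars])
  have Z_H [measurable]: "Z \<in> H None \<rightarrow>\<^sub>M N"
    unfolding H_def using Zs by (auto intro: measurable_vimage_algebra1)
  have W_H [measurable]: "W i \<in> borel_measurable (N \<Otimes>\<^sub>M H (Some i))" for i
    using W[of i] by (simp add: H_def)
  define g where "g x = (\<Prod>i<n. W i (Z (x None), x (Some i)))" for x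
  have g: "g \<in> borel_measurable (Pi\<^sub>M (insert None S) H)"
    unfolding g_def
  proof (rule borel_measurable_prod_ennreal)
    fix i assume "i \<in> {..<n}"
    then have [measurable]: "(\<lambda>x. x (Some i)) \<in> Pi\<^sub>M (insert None S) H \<rightarrow>\<^sub>M H (Some i)"
      by (intro measurable_component_singleton) (auto simp: S_def)
    have [measurable]: "(\<lambda>x. x None) \<in> Pi\<^sub>M (insert None S) H \<rightarrow>\<^sub>M H None"
      by (intro measurable_component_singleton) auto
    show "(\<lambda>x. W i (Z (x None), x (Some i))) \<in> borel_measurable (Pi\<^sub>M (insert None S) H)" by measurable
  qed
  have sets_PiD: "sets (Pi\<^sub>M (insert None S) D) = sets (Pi\<^sub>M (insert None S) H)"
    by (intro sets_PiM_cong) auto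
  have "(\<integral>\<^sup>+\<omega>. (\<Prod>i<n. W i (Z \<omega>, \<omega>)) \<partial>P) = (\<integral>\<^sup>+\<omega>. g (\<lambda>k\<in>insert None S. \<omega>) \<partial>P)"
    by (simp add: g_def S_def)
  also have "\<dots> = (\<integral>\<^sup>+x. g x \<partial>Pi\<^sub>M (insert None S) D)"
    unfolding law[symmetric] using g id_H
    by (subst nn_integral_distr) (auto intro!: measurable_restrict)
  also have "\<dots> = (\<integral>\<^sup>+y. (\<integral>\<^sup>+x. g (x(None := y)) \<partial>Pi\<^sub>M S D) \<partial>D None)"
    using g S by (intro D.product_nn_integral_insert_rev) (auto simp: measurable_cong_sets[OF sets_PiD refl])
  also have "\<dots> = (\<integral>\<^sup>+y. (\<Prod>i<n. \<integral>\<^sup>+\<omega>'. W i (Z y, \<omega>') \<partial>P) \<partial>D None)"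
  proof (rule nn_integral_cong)
    fix y assume "y \<in> space (D None)"
    then have y: "y \<in> space P" by (simp add: D_def space_H)
    then have Zy: "Z y \<in> space N" using Zs by auto
    have Wy: "(\<lambda>\<omega>. W i (Z y, \<omega>)) \<in> borel_measurable (H (Some i))" for i
      using measurable_compose[OF measurable_Pair1'[OF Zy] W_H[of i]] by simp
    have "(\<integral>\<^sup>+x. g (x(None := y)) \<partial>Pi\<^sub>M S D) = (\<integral>\<^sup>+x. (\<Prod>k\<in>S. W (the k) (Z y, x k)) \<partial>Pi\<^sub>M S D)"
      unfolding g_def S_def by (subst prod.reindex) (auto simp: inj_on_def)
    also have "\<dots> = (\<Prod>k\<in>S. \<integral>\<^sup>+\<omega>. W (the k) (Z y, \<omega>) \<partial>D k)"
      using S Wy by (intro D.product_nn_integral_prod) (auto simp: S_def measurable_cong_sets[OF sets_D refl])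
    also have "\<dots> = (\<Prod>i<n. \<integral>\<^sup>+\<omega>. W i (Z y, \<omega>) \<partial>D (Some i))"
      unfolding S_def by (subst prod.reindex) (auto simp: inj_on_def)
    also have "\<dots> = (\<Prod>i<n. \<integral>\<^sup>+\<omega>'. W i (Z y, \<omega>') \<partial>P)"
      by (intro prod.cong refl D_int Wy)
    finally show "(\<integral>\<^sup>+x. g (x(None := y)) \<partial>Pi\<^sub>M S D) = (\<Prod>i<n. \<integral>\<^sup>+\<omega>'. W i (Z y, \<omega>') \<partial>P)" .
  qed
  also have "\<dots> = (\<integral>\<^sup>+\<omega>. (\<Prod>i<n. \<integral>\<^sup>+\<omega>'. W i (Z \<omega>, \<omega>') \<partial>P) \<partial>P)"
  proof (rule D_int, rule borel_measurable_prod_ennreal)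
    fix i
    have WP: "W i \<in> borel_measurable (N \<Otimes>\<^sub>M P)"
    proof -
      \<comment> \<open>Every \<open>G i\<close> is contained in the \<open>\<sigma>\<close>-algebra of \<open>P\<close>.\<close>
      have "(\<lambda>x. (fst x, snd x)) \<in> N \<Otimes>\<^sub>M P \<rightarrow>\<^sub>M N \<Otimes>\<^sub>M H (Some i)"
        by (intro measurable_Pair measurable_fst measurable_compose[OF measurable_snd id_H])
      from measurable_compose[OF this W_H] show ?thesis by simp
    qed
    then have "(\<lambda>z. \<integral>\<^sup>+\<omega>'. W i (z, \<omega>') \<partial>P) \<in> borel_measurable N"
      by (intro P.borel_measurable_nn_integral) simp
    from measurable_compose[OF Z_H this]
    show "(\<lambda>\<omega>. \<integral>\<^sup>+\<omega>'. W i (Z \<omega>, \<omega>') \<partial>P) \<in> borel_measurable (H None)" .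
  qed
  finally show ?thesis .
qed

lemma fdd_eq_emeasure:
  assumes fdd: "fdd_eq P X Q Y" and I: "finite I"
  shows "emeasure P {\<omega> \<in> space P. \<forall>t\<in>I. X (\<tau> t) \<omega> \<le> a t} = emeasure Q {\<omega> \<in> space Q. \<forall>t\<in>I. Y (\<tau> t) \<omega> \<le> a t}"
proof -
  let ?S = "Pi\<^sub>M (\<tau> ` I) (\<lambda>_. borel :: real measure)"
  define A where "A = {x \<in> space ?S. \<forall>t\<in>I. x (\<tau> t) \<le> a t}"
  have [measurable]: "(\<lambda>x. x (\<tau> t)) \<in> borel_measurable ?S" if "t \<in> I" for t
    using that by (intro measurable_component_singleton) auto
  have A: "A \<in> sets ?S" unfolding A_def using I by measurable
  have em: "emeasure (distr R ?S (\<lambda>\<omega>. \<lambda>t\<in>\<tau> ` I. W t \<omega>)) A = emeasure R {\<omega> \<in> space R. \<forall>t\<in>I. W (\<tau> t) \<omega> \<le> a t}"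
    if "\<And>t. W t \<in> borel_measurable R" for R :: "'r measure" and W
    using that A by (subst emeasure_distr)
      (auto simp: A_def space_PiM intro!: measurable_restrict arg_cong[where f="emeasure R"])
  have "distr P ?S (\<lambda>\<omega>. \<lambda>t\<in>\<tau> ` I. X t \<omega>) = distr Q ?S (\<lambda>\<omega>. \<lambda>t\<in>\<tau> ` I. Y t \<omega>)"
    "\<And>t. X t \<in> borel_measurable P" "\<And>t. Y t \<in> borel_measurable Q"
    using fdd I by (auto simp: fdd_eq_def)
  then show ?thesis using em[of X P] em[of Y Q] by simp
qed

lemma inf_prod_of_bool: "inf_prod (\<lambda>i. of_bool (A i)) = of_bool (\<forall>i. A i)"
proof (cases "\<forall>i. A i")
  case True
  then show ?thesis by (simp add: inf_prod_def)
next
  case False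
  then obtain i where "\<not> A i" by blast
  then have "(\<Prod>i<Suc i. of_bool (A i)) = (0 :: ennreal)" by (auto simp: prod_zero_iff)
  then have "inf_prod (\<lambda>i. of_bool (A i)) \<le> 0"
    unfolding inf_prod_def by (intro INF_lower2[of "Suc i"]) auto
  then show ?thesis using False by simp
qed

text \<open>Given the lines, the event that no profile exceeds the levels has probability
  \<open>\<Prod>i. 1 - v (r i, \<phi> i)\<close>, where \<open>v y\<close> is the probability that a profile attached to the line \<open>y\<close>
  exceeds a level. Only finitely many times enter for each line, so that equality of
  finite-dimensional distributions with \<open>F\<close> suffices.\<close>
theorem line_void_probability:
  fixes r \<phi> :: "nat \<Rightarrow> 'p \<Rightarrow> real" and Q :: "'q measure"
  assumes ppp: "poisson_point_process P (line_intensity lam) (\<lambda>_. UNIV) (\<lambda>i \<omega>. (r i \<omega>, \<phi> i \<omega>))"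
    and Q: "prob_space Q" and F: "measurable_process Q F"
    and copies: "iid_copies_indep_of P Fs Q F (Pi\<^sub>M UNIV (\<lambda>_. line_intensity lam)) (\<lambda>\<omega> i. (r i \<omega>, \<phi> i \<omega>))"
    and I: "finite I"
  shows "{\<omega> \<in> space P. a < Fs i (along t (\<phi> i \<omega>) - r i \<omega>) \<omega>} \<in> sets P"
    and "emeasure P {\<omega> \<in> space P. \<forall>t\<in>I. \<forall>i. Fs i (along t (\<phi> i \<omega>) - r i \<omega>) \<omega> \<le> c t} =
      nexp (\<integral>\<^sup>+y. emeasure Q {\<omega> \<in> space Q. \<exists>t\<in>I. c t < F (along t (snd y) - fst y) \<omega>} \<partial>line_intensity lam)"
proof -
  interpret P: prob_space P using ppp by (rule ppp_prob_space)
  interpret Q: prob_space Q by fact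
  let ?L = "line_intensity lam" and ?Z = "\<lambda>\<omega> i. (r i \<omega>, \<phi> i \<omega>)"
  let ?N = "Pi\<^sub>M (UNIV :: nat set) (\<lambda>_. ?L)"
  have Zi [measurable]: "(\<lambda>\<omega>. (r i \<omega>, \<phi> i \<omega>)) \<in> P \<rightarrow>\<^sub>M ?L" for i
    by (rule ppp_measurable[OF ppp])
  have Z [measurable]: "?Z \<in> P \<rightarrow>\<^sub>M ?N"
    using measurable_space[OF Zi] by (intro measurable_PiM_single') (auto simp: space_PiM)
  have fdd: "fdd_eq P (Fs i) Q F" for i using copies by (simp add: iid_copies_indep_of_def)
  obtain G where G: "\<And>i. subalgebra P (G i)" "\<And>i. measurable_process (G i) (Fs i)"
    and indep: "P.indep_sets (\<lambda>k. case k of None \<Rightarrow> {?Z -` A \<inter> space P |A. A \<in> sets ?N} | Some i \<Rightarrow> sets (G i)) UNIV"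
    using copies unfolding iid_copies_indep_of_def by blast
  have Fs [measurable (raw)]: "(\<lambda>x. Fs i (g x) (h x)) \<in> borel_measurable R"
    if "g \<in> borel_measurable R" "h \<in> R \<rightarrow>\<^sub>M G i" for i g h and R :: "'r measure"
    using measurable_compose[OF measurable_Pair[OF that] G(2)[of i, unfolded measurable_process_def]] by simp
  have id_G [measurable]: "(\<lambda>\<omega>. \<omega>) \<in> P \<rightarrow>\<^sub>M G i" for i
  proof (rule measurableI)
    fix A assume "A \<in> sets (G i)"
    then have "A \<in> sets P" using G(1)[of i] by (auto simp: subalgebra_def)
    then show "(\<lambda>\<omega>. \<omega>) -` A \<inter> space P \<in> sets P" by (simp add: vimage_def)
  qed (use G(1)[of i] in \<open>simp add: subalgebra_def\<close>)
  have L_borel: "g \<in> R \<rightarrow>\<^sub>M borel" if "g \<in> R \<rightarrow>\<^sub>M ?L" for g :: "'r \<Rightarrow> real \<times> real" and R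
    using measurable_compose[OF that measurable_line_intensity_borel] .
  have fs: "(\<lambda>x. fst (g x)) \<in> borel_measurable R" "(\<lambda>x. snd (g x)) \<in> borel_measurable R"
    if "g \<in> R \<rightarrow>\<^sub>M ?L" for g :: "'r \<Rightarrow> real \<times> real" and R
    using measurable_compose[OF L_borel[OF that], of fst borel] measurable_compose[OF L_borel[OF that], of snd borel]
    by (simp_all add: borel_prod[symmetric])
  have [measurable]: "r i \<in> borel_measurable P" "\<phi> i \<in> borel_measurable P" for i
    using fs[OF Zi[of i]] by simp_all
  have gm [measurable]: "(\<lambda>\<omega>. Fs i (along t (\<phi> i \<omega>) - r i \<omega>) \<omega>) \<in> borel_measurable P" for i t
    by measurable
  show "{\<omega> \<in> space P. a < Fs i (along t (\<phi> i \<omega>) - r i \<omega>) \<omega>} \<in> sets P" by measurable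
  define W where "W i x = (of_bool (\<forall>t\<in>I. Fs i (along t (snd (fst x i)) - fst (fst x i)) (snd x) \<le> c t) :: ennreal)"
    for i and x :: "(nat \<Rightarrow> real \<times> real) \<times> 'p"
  have W: "W i \<in> borel_measurable (?N \<Otimes>\<^sub>M G i)" for i
  proof -
    have comp: "(\<lambda>x. fst x i) \<in> ?N \<Otimes>\<^sub>M G i \<rightarrow>\<^sub>M ?L" by measurable
    note fs[OF comp, measurable]
    show ?thesis unfolding W_def using I by measurable
  qed
  define v where "v y = emeasure Q {\<omega> \<in> space Q. \<exists>t\<in>I. c t < F (along t (snd y) - fst y) \<omega>}" for y
  have Fm [measurable (raw)]: "(\<lambda>x. F (g x) (h x)) \<in> borel_measurable R"
    if "g \<in> borel_measurable R" "h \<in> R \<rightarrow>\<^sub>M Q" for g h and R :: "'r measure"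
    using measurable_compose[OF measurable_Pair[OF that] F[unfolded measurable_process_def]] by simp
  have v_eq: "v y = (\<integral>\<^sup>+\<omega>. of_bool (\<exists>t\<in>I. c t < F (along t (snd y) - fst y) \<omega>) \<partial>Q)" for y
    unfolding v_def using I by (intro emeasure_eq_nn_integral_of_bool) measurable
  have v [measurable]: "v \<in> borel_measurable ?L"
  proof -
    have comp: "(\<lambda>x. fst x) \<in> ?L \<Otimes>\<^sub>M Q \<rightarrow>\<^sub>M ?L" by measurable
    note fs[OF comp, measurable]
    have "(\<lambda>x. of_bool (\<exists>t\<in>I. c t < F (along t (snd (fst x)) - fst (fst x)) (snd x)) :: ennreal) \<in> borel_measurable (?L \<Otimes>\<^sub>M Q)"
      using I by measurable
    from Q.borel_measurable_nn_integral_fst[OF this] show ?thesis unfolding v_eq[abs_def] by simp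
  qed
  have v1: "v y \<le> 1" for y unfolding v_def by (rule Q.emeasure_le_1)
  have one_minus: "(\<integral>\<^sup>+\<omega>'. W i (?Z \<omega>, \<omega>') \<partial>P) = 1 - v (r i \<omega>, \<phi> i \<omega>)" for i \<omega>
  proof -
    let ?\<tau> = "\<lambda>t. along t (\<phi> i \<omega>) - r i \<omega>"
    have "(\<integral>\<^sup>+\<omega>'. W i (?Z \<omega>, \<omega>') \<partial>P) = emeasure P {\<omega>' \<in> space P. \<forall>t\<in>I. Fs i (?\<tau> t) \<omega>' \<le> c t}"
      unfolding W_def using I fdd[of i]
      by (subst emeasure_eq_nn_integral_of_bool) (auto simp: fdd_eq_def)
    also have "\<dots> = emeasure Q {\<omega>' \<in> space Q. \<forall>t\<in>I. F (?\<tau> t) \<omega>' \<le> c t}"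
      by (rule fdd_eq_emeasure[OF fdd I])
    also have "{\<omega>' \<in> space Q. \<forall>t\<in>I. F (?\<tau> t) \<omega>' \<le> c t} = space Q - {\<omega>' \<in> space Q. \<exists>t\<in>I. c t < F (?\<tau> t) \<omega>'}"
      by (auto simp: not_less)
    also have "emeasure Q \<dots> = 1 - v (r i \<omega>, \<phi> i \<omega>)"
      unfolding v_def using I by (subst emeasure_compl) (auto simp: Q.emeasure_space_1)
    finally show ?thesis .
  qed
  have "(\<integral>\<^sup>+\<omega>. inf_prod (\<lambda>i. W i (?Z \<omega>, \<omega>)) \<partial>P) = nexp (\<integral>\<^sup>+y. v y \<partial>?L)"
  proof (rule marked_pgfl[OF ppp sigma_finite_line_intensity P.prob_space_axioms _ _ v v1])
    show "(\<lambda>\<omega>. W i (?Z \<omega>, \<omega>)) \<in> borel_measurable P" for i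
      unfolding W_def fst_conv snd_conv using I by measurable
    show "W i (?Z \<omega>, \<omega>) \<le> 1" for i \<omega> by (simp add: W_def)
    show "(\<integral>\<^sup>+\<omega>. (\<Prod>i<n. W i (?Z \<omega>, \<omega>)) \<partial>P) = (\<integral>\<^sup>+\<omega>. (\<Prod>i<n. 1 - v (r i \<omega>, \<phi> i \<omega>)) \<partial>P)" for n
      using nn_integral_indep_marks[OF P.prob_space_axioms Z G(1) indep W, of n] by (simp add: one_minus)
  qed
  moreover have "(\<integral>\<^sup>+\<omega>. inf_prod (\<lambda>i. W i (?Z \<omega>, \<omega>)) \<partial>P) =
      emeasure P {\<omega> \<in> space P. \<forall>t\<in>I. \<forall>i. Fs i (along t (\<phi> i \<omega>) - r i \<omega>) \<omega> \<le> c t}"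
  proof -
    have "inf_prod (\<lambda>i. W i (?Z \<omega>, \<omega>)) = of_bool (\<forall>t\<in>I. \<forall>i. Fs i (along t (\<phi> i \<omega>) - r i \<omega>) \<omega> \<le> c t)" for \<omega>
      unfolding W_def inf_prod_of_bool by (auto intro!: arg_cong[where f=of_bool])
    then show ?thesis using I by (subst emeasure_eq_nn_integral_of_bool) auto
  qed
  ultimately show "emeasure P {\<omega> \<in> space P. \<forall>t\<in>I. \<forall>i. Fs i (along t (\<phi> i \<omega>) - r i \<omega>) \<omega> \<le> c t} =
      nexp (\<integral>\<^sup>+y. emeasure Q {\<omega> \<in> space Q. \<exists>t\<in>I. c t < F (along t (snd y) - fst y) \<omega>} \<partial>?L)"
    by (simp add: v_def)
qed

text \<open>The law of the maximum is identified first; the three claims are then read off from the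
  spectral representation.\<close>
theorem proposition4p5:
  fixes lam :: real
    and P :: "'p measure" and r \<phi> :: "nat \<Rightarrow> 'p \<Rightarrow> real"
    and Q :: "'q measure" and F :: "real \<Rightarrow> 'q \<Rightarrow> real"
    and Fs :: "nat \<Rightarrow> real \<Rightarrow> 'p \<Rightarrow> real"
  assumes "lam > 0"
    and "poisson_point_process P (line_intensity lam) (\<lambda>_. UNIV) (\<lambda>i \<omega>. (r i \<omega>, \<phi> i \<omega>))"
    and "prob_space Q"
    and "measurable_process Q F"
    and "\<forall>t. \<forall>\<omega>\<in>space Q. F t \<omega> \<ge> 0"
    and "\<forall>a>0. (\<integral>\<^sup>+t. emeasure Q {\<omega> \<in> space Q. F t \<omega> > a} \<partial>lborel) < \<infinity>"
    and "\<forall>i t. \<forall>\<omega>\<in>space P. Fs i t \<omega> \<ge> 0"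
    and "iid_copies_indep_of P Fs Q F
           (Pi\<^sub>M UNIV (\<lambda>_. line_intensity lam)) (\<lambda>\<omega> i. (r i \<omega>, \<phi> i \<omega>))"
  shows "stationary_process P (line_max_process Fs r \<phi>) \<and>
         max_id P (line_max_process Fs r \<phi>) \<and>
         generated_by_conservative_flow P (line_max_process Fs r \<phi>)"
proof -
  note ppp = assms(2) and lines = assms(2,3,4,8)
  interpret P: prob_space P using ppp by (rule ppp_prob_space)
  interpret Q: prob_space Q using assms(3) .
  obtain g F' where g [measurable]: "g \<in> Q \<rightarrow>\<^sub>M (borel :: (nat \<Rightarrow> real) measure)"
    and F' [measurable]: "(\<lambda>(t, z). F' t z) \<in> borel_measurable (borel \<Otimes>\<^sub>M (borel :: (nat \<Rightarrow> real) measure))"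
    and F'_nonneg: "\<And>t z. 0 \<le> F' t z" and F_eq: "\<And>t \<omega>. \<omega> \<in> space Q \<Longrightarrow> F t \<omega> = (F' t (g \<omega>) :: real)"
    using measurable_process_factorization[OF assms(4,5)] by blast
  obtain b :: "real \<Rightarrow> line" where b: "bij b" using ex_bij_real_lines by blast
  \<comment> \<open>The law of the profile, as a probability on the Polish space of sequences.\<close>
  define N where "N = distr Q borel g"
  have N: "prob_space N" unfolding N_def using g by (rule Q.prob_space_distr)
  have F'z: "(\<lambda>z. F' t z) \<in> borel_measurable borel" for t
    using measurable_compose[OF measurable_Pair1'[of t borel borel] F'] by simp
  have N_F: "emeasure N {z. \<exists>t\<in>I. c t < F' (\<tau> t) z} = emeasure Q {\<omega> \<in> space Q. \<exists>t\<in>I. c t < F (\<tau> t) \<omega>}"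
    if "finite I" for I c and \<tau> :: "'t \<Rightarrow> real"
  proof -
    note F'z [measurable]
    have "Measurable.pred borel (\<lambda>z. \<exists>t\<in>I. c t < F' (\<tau> t) z)" using that by measurable
    then have "{z. \<exists>t\<in>I. c t < F' (\<tau> t) z} \<in> sets borel" by (simp add: pred_def)
    then show ?thesis
      unfolding N_def by (subst emeasure_distr) (auto simp: F_eq intro!: arg_cong[where f="emeasure Q"])
  qed
  interpret line_flow N lam F' b
  proof (intro line_flow.intro N line_flow_axioms.intro assms(1) F' F'_nonneg b)
    show "sets N = sets borel" by (simp add: N_def)
    fix a :: real assume "0 < a"
    moreover have "emeasure N {z. a < F' t z} = emeasure Q {\<omega> \<in> space Q. a < F t \<omega>}" for t
      using N_F[of "{()}" "\<lambda>_. a" "\<lambda>_. t"] by simp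
    ultimately show "(\<integral>\<^sup>+t. emeasure N {z. a < F' t z} \<partial>lborel) < \<infinity>"
      using assms(6) by simp
  qed
  define X where "X = line_max_process Fs r \<phi>"
  have X_sup: "X = (\<lambda>t. sup_over (\<lambda>_. UNIV) (\<lambda>i \<omega>. Fs i (along t (\<phi> i \<omega>) - r i \<omega>) \<omega>))"
    by (auto simp: X_def line_max_process_def sup_over_def along_def fun_eq_iff)
  have law: "sup_law P X M f"
    unfolding X_sup
  proof (rule sup_over_sup_law[OF P.prob_space_axioms _ _ f_L_vee])
    show "{\<omega> \<in> space P. i \<in> UNIV \<and> a < Fs i (along t (\<phi> i \<omega>) - r i \<omega>) \<omega>} \<in> sets P" for t i a
      using line_void_probability(1)[OF lines finite.emptyI] by simp
    show "AE \<omega> in P. \<forall>i\<in>UNIV. 0 \<le> Fs i (along t (\<phi> i \<omega>) - r i \<omega>) \<omega>" for t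
      using assms(7) by (intro AE_I2) auto
    fix I :: "(real \<times> real) set" and c :: "real \<times> real \<Rightarrow> real" assume I: "finite I" and c: "\<And>t. t \<in> I \<Longrightarrow> 0 < c t"
    let ?S = "exceedance M f I c"
    have "emeasure P {\<omega> \<in> space P. \<forall>t\<in>I. \<forall>i\<in>UNIV. Fs i (along t (\<phi> i \<omega>) - r i \<omega>) \<omega> \<le> c t} =
        nexp (emeasure M ?S)"
      using line_void_probability(2)[OF lines I, of c] emeasure_f_LN[of I c, OF I c]
      by (simp only: N_F[OF I] ball_UNIV)
    also have "\<dots> = ennreal (exp (- measure M ?S))"
      using L_vee_union(2)[of I f M c, OF f_L_vee I c]
      by (simp add: nexp_def measure_def)
    finally show "measure P {\<omega> \<in> space P. \<forall>t\<in>I. \<forall>i\<in>UNIV. Fs i (along t (\<phi> i \<omega>) - r i \<omega>) \<omega> \<le> c t} =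
        exp (- measure M ?S)"
      by (simp add: measure_def)
  qed
  \<comment> \<open>Intensity \<open>s M\<close>: the value \<open>s = 1\<close> gives the spectral representation, \<open>s = 1 / n\<close> the \<open>n\<close>-th roots of the law.\<close>
  have root: "\<exists>(R :: (nat set \<times> (nat \<Rightarrow> real)) measure) K U.
      poisson_point_process R (scale_measure (ennreal s) M) K U \<and>
      sup_law R (\<lambda>t. sup_points K U (f t)) (scale_measure (ennreal s) M) f"
    if s: "0 \<le> s" "s \<le> 1" for s
  proof -
    obtain R :: "(nat set \<times> (nat \<Rightarrow> real)) measure" where
      R: "poisson_point_process R (scale_measure (ennreal s) M) fst (\<lambda>i x. snd x i)"
      using ppp_thinned_exists[OF ppp_marking[OF ppp sigma_finite_line_intensity N] sigma_finite_LN
          D_sets inv_b_LN space_J s] unfolding M_def by blast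
    have "f t \<in> L_vee (scale_measure (ennreal s) M)" for t
      using f_L_vee[of t] by (auto simp: L_vee_def f_def F_nonneg space_scale_measure ennreal_mult_less_top)
    from R ppp_sup_law[where f = f, OF R this] show ?thesis by blast
  qed
  have "stationary_process P X"
    by (rule sup_law_stationary[OF P.prob_space_axioms law measure_f_shift])
  moreover have "max_id P X"
  proof (rule sup_law_max_id[OF P.prob_space_axioms law])
    fix n :: nat assume "1 \<le> n"
    then have n: "0 \<le> 1 / real n" "1 / real n \<le> 1" by auto
    obtain R :: "(nat set \<times> (nat \<Rightarrow> real)) measure" and K U
      where R: "poisson_point_process R (scale_measure (ennreal (1 / real n)) M) K U"
        "sup_law R (\<lambda>t. sup_points K U (f t)) (scale_measure (ennreal (1 / real n)) M) f"
      using root[OF n] by blast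
    show "\<exists>(R :: (nat set \<times> (nat \<Rightarrow> real)) measure) Y. prob_space R \<and>
        sup_law R Y (scale_measure (ennreal (1 / real n)) M) f"
      using ppp_prob_space[OF R(1)] R(2) by blast
  qed
  moreover have "generated_by_conservative_flow P X"
  proof -
    obtain R :: "(nat set \<times> (nat \<Rightarrow> real)) measure" and K U
      where R: "poisson_point_process R M K U" "sup_law R (\<lambda>t. sup_points K U (f t)) M f"
      using root[of 1] by auto
    have "fdd_eq P X R (\<lambda>t. sup_points K U (f t))"
      by (rule sup_law_fdd_eq[OF P.prob_space_axioms ppp_prob_space[OF R(1)] law R(2)])
    with R(1) have "spectral_representation P X M f"
      unfolding spectral_representation_def by (blast intro: sigma_finite_M f_L_vee)
    moreover have "\<forall>t. AE w in M. f t w = f 0 (T t w)" using f_T[of 0] by simp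
    ultimately show ?thesis
      unfolding generated_by_conservative_flow_def
      using sigma_finite_borel_space_M full_support_f conservative_T by blast
  qed
  ultimately show ?thesis by (simp add: X_def)
qed

end
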